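(* A graph $G$ does not admit an orientation under which every even circuit is clockwise even if and only if $G$ contains a subgraph which is, after the contraction of at most one odd circuit, an even subdivision of $E_1$ or $E_3$; that is, if and only if there is a subgraph $K$ of $G$ such that either $K$ is an even subdivision of $E_1$ or $E_3$, or $K$ has an odd circuit $A$ such that the graph obtained from $K$ by contracting $A$ is an even subdivision of $E_1$ or $E_3$.
   Context: Graphs are finite and undirected; multiple edges are allowed. A circuit is even (odd) if its length, i.e. its number of edges, is even (odd). Clockwise parity: given an orientation of the edges, the clockwise parity of an even circuit is the parity of the number of its edges that are directed in agreement with a specified sense of traversal (since the length is even, this does not depend on the sense chosen). The circuit is clockwise even or clockwise odd accordingly. $E_1$ is the graph with two vertices and three parallel edges joining them. $E_3$ is the graph obtained from $K_4$ by subdividing once each edge of a fixed circuit of length $4$. Contracting an odd circuit $A$ of $K$ means contracting all edges of $A$, so that the resulting graph has edge set $EK\setminus A$. An even subdivision of a graph $F$ is a graph obtained (up to isomorphism) from $F$ by a finite (possibly empty) sequence of steps, each of which subdivides an edge of the current graph twice (i.e. replaces it by a path of length $3$). *)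

theory Defs
  imports Main
begin

record ('v, 'e) mgraph =
  verts :: "'v set"
  edges :: "'e set"
  ends :: "'e \<Rightarrow> 'v set"

text \<open>An edge with a single end is a loop. Loops have to be representable because contracting a
  circuit turns its chords into loops.\<close>

definition multigraph :: "('v, 'e) mgraph \<Rightarrow> bool" where
  "multigraph G \<longleftrightarrow> finite (verts G) \<and> finite (edges G) \<and>
     (\<forall>e\<in>edges G. ends G e \<subseteq> verts G \<and> (card (ends G e) = 1 \<or> card (ends G e) = 2))"

definition subgraph :: "('v, 'e) mgraph \<Rightarrow> ('v, 'e) mgraph \<Rightarrow> bool" where
  "subgraph K G \<longleftrightarrow> multigraph K \<and> verts K \<subseteq> verts G \<and> edges K \<subseteq> edges G \<and>
     (\<forall>e\<in>edges K. ends K e = ends G e)"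

definition isomorphic :: "('v, 'e) mgraph \<Rightarrow> ('w, 'f) mgraph \<Rightarrow> bool" where
  "isomorphic G H \<longleftrightarrow> (\<exists>f g. bij_betw f (verts G) (verts H) \<and> bij_betw g (edges G) (edges H) \<and>
     (\<forall>e\<in>edges G. ends H (g e) = f ` ends G e))"

text \<open>A circuit is given together with a starting vertex and a sense of traversal: the edge
  \<open>es ! i\<close> leads from \<open>vs ! i\<close> to its cyclic successor in \<open>vs\<close>. Loops are circuits of length 1
  and pairs of parallel edges are circuits of length 2.\<close>

definition circuit :: "('v, 'e) mgraph \<Rightarrow> 'v list \<Rightarrow> 'e list \<Rightarrow> bool" where
  "circuit G vs es \<longleftrightarrow> es \<noteq> [] \<and> length vs = length es \<and> distinct vs \<and> distinct es \<and>
     set vs \<subseteq> verts G \<and> set es \<subseteq> edges G \<and>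
     (\<forall>i<length es. ends G (es ! i) = {vs ! i, vs ! (Suc i mod length es)})"

text \<open>An orientation assigns to each edge its pair (tail, head).\<close>

definition orientation :: "('v, 'e) mgraph \<Rightarrow> ('e \<Rightarrow> 'v \<times> 'v) \<Rightarrow> bool" where
  "orientation G d \<longleftrightarrow> (\<forall>e\<in>edges G. ends G e = {fst (d e), snd (d e)})"

definition clockwise_even :: "('e \<Rightarrow> 'v \<times> 'v) \<Rightarrow> 'v list \<Rightarrow> 'e list \<Rightarrow> bool" where
  "clockwise_even d vs es \<longleftrightarrow>
     even (card {i. i < length es \<and> d (es ! i) = (vs ! i, vs ! (Suc i mod length es))})"

text \<open>The vertices of the contracted graph are the classes of the partition of the old vertices
  whose only possibly non-trivial class is the vertex set of the circuit.\<close>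

definition contract_circuit ::
    "('v, 'e) mgraph \<Rightarrow> 'v list \<Rightarrow> 'e list \<Rightarrow> ('v set, 'e) mgraph" where
  "contract_circuit K vs es =
     (let cls = (\<lambda>v. if v \<in> set vs then set vs else {v})
      in \<lparr>verts = cls ` verts K, edges = edges K - set es, ends = (\<lambda>e. cls ` ends K e)\<rparr>)"

definition subdivides_twice :: "('v, 'e) mgraph \<Rightarrow> ('v, 'e) mgraph \<Rightarrow> bool" where
  "subdivides_twice H H' \<longleftrightarrow> (\<exists>e u v x y e1 e2 e3.
     e \<in> edges H \<and> ends H e = {u, v} \<and>
     x \<notin> verts H \<and> y \<notin> verts H \<and> x \<noteq> y \<and>
     e1 \<notin> edges H \<and> e2 \<notin> edges H \<and> e3 \<notin> edges H \<and> distinct [e1, e2, e3] \<and>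
     H' = \<lparr>verts = verts H \<union> {x, y}, edges = (edges H - {e}) \<union> {e1, e2, e3},
           ends = (ends H)(e1 := {u, x}, e2 := {x, y}, e3 := {y, v})\<rparr>)"

text \<open>The subdivision steps are carried out over \<^typ>\<open>nat\<close> so that new vertices and edges are
  always available, whatever the types of the graph \<open>H\<close>.\<close>

definition even_subdivision :: "(nat, nat) mgraph \<Rightarrow> ('v, 'e) mgraph \<Rightarrow> bool" where
  "even_subdivision F H \<longleftrightarrow> (\<exists>F'. subdivides_twice\<^sup>*\<^sup>* F F' \<and> isomorphic F' H)"

definition E1 :: "(nat, nat) mgraph" where
  "E1 = \<lparr>verts = {0, 1}, edges = {0, 1, 2}, ends = (\<lambda>_. {0, 1})\<rparr>"

text \<open>Here \<open>K\<^sub>4\<close> has the vertices 0, 1, 2, 3, and the edges of its circuit 0, 1, 2, 3 are subdivided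
  by the vertices 4, 5, 6, 7, respectively.\<close>

definition E3 :: "(nat, nat) mgraph" where
  "E3 = \<lparr>verts = {..<8}, edges = {..<10},
         ends = (\<lambda>i. [{0, 4}, {4, 1}, {1, 5}, {5, 2}, {2, 6}, {6, 3}, {3, 7}, {7, 0},
                      {0, 2}, {1, 3}] ! i)\<rparr>"

end

theory Submission
  imports Defs
begin

text \<open>An orientation as required is called an even orientation here.

  Even orientations pass to subgraphs, through isomorphisms and back through double subdivisions. They also
  pass to the contraction of an odd circuit: after reversing all edges at suitable vertices the circuit is
  directed, and then its arcs of even length contribute evenly to every circuit. As neither \<open>E1\<close> nor \<open>E3\<close>
  has an even orientation, the condition is sufficient.

  For necessity take an edge-minimal graph without an even orientation. It is 2-connected, hence the union of
  a 2-connected subgraph and an ear. Let \<open>e\<close> be the first edge of the ear. An even orientation of the graph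
  without \<open>e\<close> does not extend to \<open>e\<close>, so two odd paths between the ends of \<open>e\<close> disagree about the direction
  of \<open>e\<close>. Rerouting them as long as no even subdivision of \<open>E1\<close> (three parallel odd paths), of \<open>E3\<close>, or
  of \<open>E1\<close> with a vertex blown up to an odd circuit (\<open>K4\<close> with six odd paths) shows up, one arrives at two
  odd circuits in series, joined by a path avoiding \<open>e\<close> and by a path through \<open>e\<close>. By 2-connectedness there
  is a further path between the two parts avoiding the first end of the joining path. It either shortens the
  joining path, or contradicts the evenness of the orientation, or completes a tetrahedron containing one of
  the forbidden graphs.\<close>

section \<open>Paths\<close>

text \<open>All reasoning on orientations is modulo 2, and it compares paths. Two parallel paths of
  equal parity are tied together by the circuit that they form. If a third parallel path, through
  \<open>e\<close>, has this parity too, all three are even, as three odd ones would be an even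
  subdivision of \<open>E1\<close>; the first two then have equally many forward edges modulo 2.
  This is why a path can be rerouted without losing the disagreement about \<open>e\<close>. The
  obstacle is the final appeal to connectivity. Without \<open>e\<close> the graph can have cut
  vertices, so a path avoiding a given vertex might be forced through \<open>e\<close>. This is why
  \<open>e\<close> is taken from an ear: the two odd circuits avoid \<open>e\<close>, cannot use the
  rest of the ear, which is pendant, and therefore lie in the 2-connected remainder, where every
  path avoids \<open>e\<close> by itself. The avoided vertex is the first end of the joining path,
  so that landing on the joining path makes it strictly shorter.\<close>

fun pverts :: "'v \<Rightarrow> ('v \<times> 'e \<times> 'v) list \<Rightarrow> 'v set" where
  "pverts u [] = {u}"
| "pverts u ((a, e, b) # p) = insert u (pverts b p)"

text \<open>Each step records both ends of its edge, so the sense of traversal is part of the list;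
  \<open>u \<notin> pverts b p\<close> makes the walk simple. The start is a separate argument
  because the empty list names no vertex.\<close>

fun path :: "('v, 'e) mgraph \<Rightarrow> 'v \<Rightarrow> ('v \<times> 'e \<times> 'v) list \<Rightarrow> 'v \<Rightarrow> bool" where
  "path G u [] v \<longleftrightarrow> u = v \<and> u \<in> verts G"
| "path G u ((a, e, b) # p) v \<longleftrightarrow>
     a = u \<and> u \<in> verts G \<and> e \<in> edges G \<and> ends G e = {u, b} \<and> u \<notin> pverts b p \<and> path G b p v"

definition pedges :: "('v \<times> 'e \<times> 'v) list \<Rightarrow> 'e set" where
  "pedges p = (fst \<circ> snd) ` set p"

definition prev :: "('v \<times> 'e \<times> 'v) list \<Rightarrow> ('v \<times> 'e \<times> 'v) list" where
  "prev p = rev (map (\<lambda>(a, e, b). (b, e, a)) p)"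

text \<open>Counts the edges directed along the walk. On a closed list this is the number whose
  parity is the clockwise parity.\<close>

definition fw :: "('e \<Rightarrow> 'v \<times> 'v) \<Rightarrow> ('v \<times> 'e \<times> 'v) list \<Rightarrow> nat" where
  "fw d p = length (filter (\<lambda>(a, e, b). d e = (a, b)) p)"

lemma pedges_simps [simp]:
  "pedges [] = {}" "pedges ((a, e, b) # p) = insert e (pedges p)" "pedges (p @ q) = pedges p \<union> pedges q"
  "finite (pedges p)"
  by (auto simp: pedges_def)

lemma prev_simps [simp]:
  "prev [] = []" "prev ((a, e, b) # p) = prev p @ [(b, e, a)]" "prev (p @ q) = prev q @ prev p"
  "length (prev p) = length p" "pedges (prev p) = pedges p" "prev (prev p) = p" "prev p = [] \<longleftrightarrow> p = []"
  by (auto simp: prev_def pedges_def rev_map image_image case_prod_beta comp_def)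

lemma fw_simps [simp]:
  "fw d [] = 0" "fw d ((a, e, b) # p) = (if d e = (a, b) then 1 else 0) + fw d p"
  "fw d (p @ q) = fw d p + fw d q"
  by (auto simp: fw_def)

lemma start_in_pverts [simp]: "u \<in> pverts u p"
  by (induction u p rule: pverts.induct) auto

lemma finite_pverts [simp]: "finite (pverts u p)"
  by (induction p arbitrary: u) auto

lemma path_end_in_pverts: "path G u p v \<Longrightarrow> v \<in> pverts u p"
  by (induction p arbitrary: u) auto

lemma path_start_in_verts: "path G u p v \<Longrightarrow> u \<in> verts G"
  by (cases p) auto

lemma path_end_in_verts: "path G u p v \<Longrightarrow> v \<in> verts G"
  by (induction p arbitrary: u) auto

lemma pverts_subset: "path G u p v \<Longrightarrow> pverts u p \<subseteq> verts G"
  by (induction p arbitrary: u) (auto, blast)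

lemma pedges_subset: "path G u p v \<Longrightarrow> pedges p \<subseteq> edges G"
  by (induction p arbitrary: u) (auto, blast)

lemma path_end_unique: "path G u p v \<Longrightarrow> path G' u p v' \<Longrightarrow> v = v'"
  by (induction p arbitrary: u) auto

lemma pverts_append: "path G u p m \<Longrightarrow> pverts u (p @ q) = pverts u p \<union> pverts m q"
  by (induction p arbitrary: u) auto

lemma path_append:
  "path G u (p @ q) v \<longleftrightarrow>
     (\<exists>m. path G u p m \<and> path G m q v \<and> pverts u p \<inter> pverts m q = {m})"
proof (induction p arbitrary: u)
  case Nil
  then show ?case by (auto dest: path_start_in_verts)
next
  case (Cons s p)
  obtain a e b where s: "s = (a, e, b)" by (cases s)
  show ?case
  proof
    assume L: "path G u ((s # p) @ q) v"
    then obtain m where m: "path G b p m" "path G m q v" "pverts b p \<inter> pverts m q = {m}"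
      using Cons s by auto
    have "u \<notin> pverts b p \<union> pverts m q" using L s pverts_append[OF m(1), of q] by auto
    then show "\<exists>m. path G u (s # p) m \<and> path G m q v \<and> pverts u (s # p) \<inter> pverts m q = {m}"
      using L m s by (intro exI[of _ m]) auto
  next
    assume "\<exists>m. path G u (s # p) m \<and> path G m q v \<and> pverts u (s # p) \<inter> pverts m q = {m}"
    then obtain m where m: "path G u (s # p) m" "path G m q v" "pverts u (s # p) \<inter> pverts m q = {m}"
      by auto
    have mp: "path G b p m" using m(1) s by auto
    then have "m \<in> pverts b p" by (rule path_end_in_pverts)
    moreover have "u \<notin> pverts b p" using m(1) s by auto
    ultimately have "u \<noteq> m" by auto
    have 1: "pverts b p \<inter> pverts m q = {m}" using m s \<open>m \<in> pverts b p\<close> by auto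
    have "u \<notin> pverts m q" using m(3) s \<open>u \<noteq> m\<close> by auto
    then have "u \<notin> pverts b (p @ q)" using pverts_append[OF mp, of q] \<open>u \<notin> pverts b p\<close> by auto
    moreover have "path G b (p @ q) v" using Cons[of b] mp m(2) 1 by blast
    ultimately show "path G u ((s # p) @ q) v" using m(1) s by auto
  qed
qed

lemma path_appendI:
  "path G u p m \<Longrightarrow> path G m q v \<Longrightarrow> pverts u p \<inter> pverts m q \<subseteq> {m} \<Longrightarrow> path G u (p @ q) v"
  using path_append[of G u p q v] path_end_in_pverts[of G u p m] by fastforce

lemma path_prev: "path G u p v \<Longrightarrow> path G v (prev p) u"
  and pverts_prev: "path G u p v \<Longrightarrow> pverts v (prev p) = pverts u p"
proof -
  have "path G u p v \<Longrightarrow> path G v (prev p) u \<and> pverts v (prev p) = pverts u p"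
  proof (induction p arbitrary: u)
    case (Cons s p)
    obtain a e b where s: "s = (a, e, b)" by (cases s)
    have 1: "path G v (prev p) b" "pverts v (prev p) = pverts b p" using Cons s by auto
    have ub: "u \<notin> pverts b p" "a = u" using Cons.prems s by auto
    then have "u \<noteq> b" by (metis start_in_pverts)
    have 2: "path G b [(b, e, u)] u"
      using Cons.prems s \<open>u \<noteq> b\<close> by (auto dest: path_start_in_verts simp: insert_commute)
    have 3: "path G v (prev p @ [(b, e, u)]) u"
      by (rule path_appendI[OF 1(1) 2]) (use 1 ub in auto)
    then show ?case using s ub pverts_append[OF 1(1), of "[(b, e, u)]"] 1
      by (auto simp: start_in_pverts)
  qed auto
  then show "path G u p v \<Longrightarrow> path G v (prev p) u" "path G u p v \<Longrightarrow> pverts v (prev p) = pverts u p"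
    by auto
qed

lemma path_split:
  assumes "path G u p v" "m \<in> pverts u p"
  obtains p1 p2 where "p = p1 @ p2" "path G u p1 m" "path G m p2 v" "pverts u p1 \<inter> pverts m p2 = {m}"
    "pverts u p = pverts u p1 \<union> pverts m p2"
proof -
  have "\<exists>p1 p2. p = p1 @ p2 \<and> path G u p1 m" using assms
  proof (induction p arbitrary: u)
    case Nil
    then show ?case by auto
  next
    case (Cons s p)
    obtain a e b where s: "s = (a, e, b)" by (cases s)
    show ?case
    proof (cases "m = u")
      case True
      then have "s # p = [] @ (s # p) \<and> path G u [] m" using Cons.prems s by auto
      then show ?thesis by blast
    next
      case False
      then have "path G b p v" "m \<in> pverts b p" using Cons.prems s by auto
      then obtain p1 p2 where "p = p1 @ p2" "path G b p1 m" using Cons.IH by blast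
      moreover from this have "u \<notin> pverts b p1"
        using Cons.prems s pverts_append[of G b p1 m p2] by auto
      ultimately show ?thesis using Cons.prems s by (intro exI[of _ "s # p1"] exI[of _ p2]) auto
    qed
  qed
  then obtain p1 p2 where p: "p = p1 @ p2" "path G u p1 m" by blast
  obtain m' where m': "path G u p1 m'" "path G m' p2 v" "pverts u p1 \<inter> pverts m' p2 = {m'}"
    using assms(1) p path_append by metis
  with p have "m' = m" using path_end_unique by metis
  with p m' that pverts_append[of G u p1 m p2] show ?thesis by metis
qed

lemma path_first_hit:
  assumes "path G u p v" "z \<in> S" "z \<in> pverts u p"
  obtains p1 p2 m where "p = p1 @ p2" "path G u p1 m" "path G m p2 v" "m \<in> S" "pverts u p1 \<inter> S = {m}"
    "pverts u p1 \<inter> pverts m p2 = {m}" "pverts u p = pverts u p1 \<union> pverts m p2"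
proof -
  have "\<exists>p1 p2 m. p = p1 @ p2 \<and> path G u p1 m \<and> m \<in> S \<and> pverts u p1 \<inter> S = {m}" using assms
  proof (induction p arbitrary: u)
    case Nil
    then show ?case by auto
  next
    case (Cons s p)
    obtain a e b where s: "s = (a, e, b)" by (cases s)
    show ?case
    proof (cases "u \<in> S")
      case True
      then have "s # p = [] @ (s # p) \<and> path G u [] u \<and> u \<in> S \<and> pverts u [] \<inter> S = {u}"
        using Cons.prems s by auto
      then show ?thesis by blast
    next
      case False
      then have "z \<noteq> u" using Cons.prems by auto
      then obtain p1 p2 m where 1: "p = p1 @ p2" "path G b p1 m" "m \<in> S" "pverts b p1 \<inter> S = {m}"
        using Cons.IH[of b] Cons.prems s by auto
      moreover from this have "u \<notin> pverts b p1"
        using Cons.prems s pverts_append[of G b p1 m p2] by auto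
      ultimately show ?thesis using Cons.prems s False
        by (intro exI[of _ "s # p1"] exI[of _ p2] exI[of _ m]) auto
    qed
  qed
  then obtain p1 p2 m where p: "p = p1 @ p2" "path G u p1 m" "m \<in> S" "pverts u p1 \<inter> S = {m}" by blast
  obtain m' where m': "path G u p1 m'" "path G m' p2 v" "pverts u p1 \<inter> pverts m' p2 = {m'}"
    using assms(1) p path_append by metis
  with p have "m' = m" using path_end_unique by metis
  with p m' that pverts_append[of G u p1 m p2] show ?thesis by metis
qed

lemma path_last_hit:
  assumes "path G u p v" "z \<in> S" "z \<in> pverts u p"
  obtains p1 p2 m where "p = p1 @ p2" "path G u p1 m" "path G m p2 v" "m \<in> S" "pverts m p2 \<inter> S = {m}"
    "pverts u p1 \<inter> pverts m p2 = {m}" "pverts u p = pverts u p1 \<union> pverts m p2"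
proof -
  have 1: "path G v (prev p) u" "z \<in> pverts v (prev p)"
    using assms path_prev[of G u p v] pverts_prev[of G u p v] by auto
  obtain q1 q2 m where q: "prev p = q1 @ q2" "path G v q1 m" "path G m q2 u" "m \<in> S"
    "pverts v q1 \<inter> S = {m}" "pverts v q1 \<inter> pverts m q2 = {m}"
    "pverts v (prev p) = pverts v q1 \<union> pverts m q2"
    by (rule path_first_hit[OF 1(1) assms(2) 1(2)])
  have "p = prev q2 @ prev q1" using q(1) by (metis prev_simps(3,6))
  then show ?thesis using q path_prev[OF q(2)] path_prev[OF q(3)] pverts_prev[OF q(2)]
    pverts_prev[OF q(3)] pverts_prev[OF assms(1)] by (intro that[of "prev q2" "prev q1" m]) auto
qed

lemma pedge_ends:
  assumes "path G u p v" "f \<in> pedges p"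
  obtains a b where "ends G f = {a, b}" "a \<noteq> b" "a \<in> pverts u p" "b \<in> pverts u p"
proof -
  have "\<exists>a b. ends G f = {a, b} \<and> a \<noteq> b \<and> a \<in> pverts u p \<and> b \<in> pverts u p"
    using assms
  proof (induction p arbitrary: u)
    case (Cons s p)
    obtain a e b where s: "s = (a, e, b)" by (cases s)
    show ?case
    proof (cases "f = e")
      case True
      then show ?thesis using Cons.prems s by (intro exI[of _ u] exI[of _ b]) auto
    next
      case False
      then have "\<exists>x y. ends G f = {x, y} \<and> x \<noteq> y \<and> x \<in> pverts b p \<and> y \<in> pverts b p"
        using Cons s by simp
      then show ?thesis using s by auto
    qed
  qed auto
  with that show ?thesis by blast
qed

lemma pedge_ends_subset: "path G u p v \<Longrightarrow> f \<in> pedges p \<Longrightarrow> ends G f \<subseteq> pverts u p"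
  by (erule pedge_ends) auto

lemma pedges_disjoint:
  assumes "path G u p v" "path G u' q v'" "pverts u p \<inter> pverts u' q \<subseteq> {m}"
  shows "pedges p \<inter> pedges q = {}"
proof (rule ccontr)
  assume "pedges p \<inter> pedges q \<noteq> {}"
  then obtain f where f: "f \<in> pedges p" "f \<in> pedges q" by blast
  obtain a b where ab: "ends G f = {a, b}" "a \<noteq> b" "a \<in> pverts u p" "b \<in> pverts u p"
    using assms(1) f(1) by (rule pedge_ends)
  have "{a, b} \<subseteq> pverts u' q" using pedge_ends_subset[OF assms(2) f(2)] ab by auto
  then show False using ab assms(3) by auto
qed

text \<open>The start \<open>a\<close> occurs in the first step only, so \<open>f\<close> is the
  first edge; it leads straight to \<open>b\<close>, where a simple path has to stop.\<close>

lemma path_single_edge: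
  assumes "path G a p b" "f \<in> pedges p" "ends G f = {a, b}"
  shows "p = [(a, f, b)]"
proof -
  from assms(1,2) obtain e b' p' where p: "p = (a, e, b') # p'" 
    by (cases p) (auto simp: pedges_def)
  have ab: "a \<notin> pverts b' p'" "path G b' p' b" "ends G e = {a, b'}" using assms p by auto
  have "f \<notin> pedges p'" using ab pedge_ends_subset[OF ab(2)] assms(3) by auto
  then have "f = e" using assms(2) p by auto
  then have "b' = b" using assms(3) ab path_end_in_pverts[OF ab(2)] by (auto simp: doubleton_eq_iff)
  moreover have "p' = []"
  proof (rule ccontr)
    assume "p' \<noteq> []"
    then obtain e'' b'' p'' where "p' = (b', e'', b'') # p''" using ab(2) by (cases p') auto
    then show False using ab(2) \<open>b' = b\<close> path_end_in_pverts[of G b'' p'' b] by auto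
  qed
  ultimately show ?thesis using p \<open>f = e\<close> by auto
qed

text \<open>A common edge would have both of its ends in \<open>{a, b}\<close>, so that each of the
  two paths would consist of this edge alone.\<close>

lemma parallel_paths_edge_disjoint:
  assumes "path G a p b" "path G a q b" "pverts a p \<inter> pverts a q = {a, b}" "p \<noteq> q"
  shows "pedges p \<inter> pedges q = {}"
proof (rule ccontr)
  assume "pedges p \<inter> pedges q \<noteq> {}"
  then obtain f where f: "f \<in> pedges p" "f \<in> pedges q" by blast
  obtain x y where ab: "ends G f = {x, y}" "x \<noteq> y" "x \<in> pverts a p" "y \<in> pverts a p"
    using assms(1) f(1) by (rule pedge_ends)
  have "{x, y} \<subseteq> pverts a q" using pedge_ends_subset[OF assms(2) f(2)] ab by auto
  then have "{x, y} \<subseteq> {a, b}" using assms ab by blast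
  then have "ends G f = {a, b}" using ab by auto
  then show False using path_single_edge[OF assms(1) f(1)] path_single_edge[OF assms(2) f(2)] assms(4) by auto
qed

lemma path_self: "path G u p u \<Longrightarrow> p = []"
  by (cases p) (auto dest: path_end_in_pverts)

lemma path_distinct_pedges:
  "path G u p v \<Longrightarrow> distinct (map (fst \<circ> snd) p)"
proof (induction p arbitrary: u)
  case (Cons s p)
  obtain a e b where s: "s = (a, e, b)" by (cases s)
  have 1: "path G b p v" "u \<notin> pverts b p" "ends G e = {u, b}" using Cons.prems s by auto
  have "e \<notin> pedges p" using pedge_ends_subset[OF 1(1)] 1(2,3) by blast
  then show ?case using Cons 1 s by (auto simp: pedges_def)
qed auto

lemma path_card_pedges: "path G u p v \<Longrightarrow> card (pedges p) = length p"
  using distinct_card[OF path_distinct_pedges] by (fastforce simp: pedges_def)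

lemma fw_prev:
  assumes "path G u p v" "\<And>f. f \<in> pedges p \<Longrightarrow> ends G f = {fst (d f), snd (d f)}"
  shows "fw d (prev p) + fw d p = length p"
  using assms
proof (induction p arbitrary: u)
  case (Cons s p)
  obtain a e b where s: "s = (a, e, b)" by (cases s)
  have 1: "path G b p v" "u \<notin> pverts b p" "ends G e = {u, b}" "a = u" using Cons.prems s by auto
  have "u \<noteq> b" using 1(2) by auto
  have "d e = (u, b) \<or> d e = (b, u)"
    using Cons.prems(2)[of e] s 1(3) by (cases "d e") (auto simp: doubleton_eq_iff)
  then show ?case using Cons.IH[OF 1(1)] Cons.prems(2) s 1(4) \<open>u \<noteq> b\<close> by auto
qed auto

definition del :: "('v, 'e) mgraph \<Rightarrow> 'e set \<Rightarrow> ('v, 'e) mgraph" where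
  "del G X = G\<lparr>edges := edges G - X\<rparr>"

lemma del_simps [simp]: "verts (del G X) = verts G" "edges (del G X) = edges G - X" "ends (del G X) = ends G"
  by (auto simp: del_def)

lemma path_del: "path (del G X) u p v \<longleftrightarrow> path G u p v \<and> pedges p \<inter> X = {}"
  by (induction p arbitrary: u) auto

lemma path_mono:
  "path K u p v \<Longrightarrow> verts K \<subseteq> verts G \<Longrightarrow> edges K \<subseteq> edges G \<Longrightarrow> (\<And>f. f \<in> edges K \<Longrightarrow> ends K f = ends G f)
   \<Longrightarrow> path G u p v"
  by (induction p arbitrary: u) auto

section \<open>Even orientations\<close>

text \<open>A circuit is cut open at one edge, so that everything known about paths applies to it.
  Its length is \<open>Suc (length p)\<close>; hence the even circuits are those with
  \<open>odd (length p)\<close>, and a loop is the case \<open>p = []\<close>.\<close>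

definition cycle :: "('v, 'e) mgraph \<Rightarrow> 'v \<Rightarrow> ('v \<times> 'e \<times> 'v) list \<Rightarrow> 'v \<Rightarrow> 'e \<Rightarrow> bool" where
  "cycle G u p v e \<longleftrightarrow> path G u p v \<and> e \<in> edges G \<and> ends G e = {v, u} \<and> e \<notin> pedges p"

definition even_orientation :: "('v, 'e) mgraph \<Rightarrow> ('e \<Rightarrow> 'v \<times> 'v) \<Rightarrow> bool" where
  "even_orientation G d \<longleftrightarrow> orientation G d \<and>
     (\<forall>u p v e. cycle G u p v e \<and> odd (length p) \<longrightarrow> even (fw d (p @ [(v, e, u)])))"

section \<open>Circuits given by lists and circuits given by a path with a closing edge\<close>

lemma path_zip:
  "length ws = Suc (length es) \<Longrightarrow> distinct ws \<Longrightarrow> set ws \<subseteq> verts G \<Longrightarrow> set es \<subseteq> edges G \<Longrightarrow>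
   (\<And>i. i < length es \<Longrightarrow> ends G (es ! i) = {ws ! i, ws ! Suc i}) \<Longrightarrow>
   path G (hd ws) (zip ws (zip es (tl ws))) (last ws) \<and> pverts (hd ws) (zip ws (zip es (tl ws))) = set ws"
proof (induction es arbitrary: ws)
  case Nil
  then show ?case by (cases ws) auto
next
  case (Cons e es)
  then obtain w w' ws' where ws: "ws = w # w' # ws'" by (metis length_Suc_conv)
  have 1: "path G w' (zip (w' # ws') (zip es ws')) (last (w' # ws')) \<and>
      pverts w' (zip (w' # ws') (zip es ws')) = set (w' # ws')"
    using Cons.IH[of "w' # ws'"] Cons.prems(1-4) Cons.prems(5)[of "Suc _"] ws by auto
  have "ends G e = {w, w'}" using Cons.prems(5)[of 0] ws by auto
  then show ?case using 1 Cons.prems ws by auto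
qed

lemma path_vertex_list:
  assumes "path G u p v"
  shows "map fst p @ [v] = u # map (snd \<circ> snd) p \<and> distinct (map fst p @ [v]) \<and>
     set (map fst p @ [v]) = pverts u p \<and> (\<forall>s\<in>set p. ends G (fst (snd s)) = {fst s, snd (snd s)})"
  using assms
proof (induction p arbitrary: u)
  case (Cons s p)
  obtain a e b where s: "s = (a, e, b)" by (cases s)
  have c: "path G b p v" "u \<notin> pverts b p" "ends G e = {u, b}" "a = u" using Cons.prems s by auto
  have IH: "map fst p @ [v] = b # map (snd \<circ> snd) p" "distinct (map fst p @ [v])"
    "set (map fst p @ [v]) = pverts b p" "\<forall>s\<in>set p. ends G (fst (snd s)) = {fst s, snd (snd s)}"
    using Cons.IH[OF c(1)] by blast+
  have "map fst (s # p) @ [v] = u # (map fst p @ [v])" using s c by simp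
  then show ?case using IH c s by simp
qed auto

lemma circuit_imp_cycle:
  assumes "circuit G vs es"
  obtains u p v e where "cycle G u p v e" "length es = Suc (length p)"
    "set vs = pverts u p" "set es = insert e (pedges p)"
    "\<And>d. clockwise_even d vs es \<longleftrightarrow> even (fw d (p @ [(v, e, u)]))"
proof -
  define n where "n = length es"
  have c: "es \<noteq> []" "length vs = n" "distinct vs" "distinct es" "set vs \<subseteq> verts G" "set es \<subseteq> edges G"
    "\<And>i. i < n \<Longrightarrow> ends G (es ! i) = {vs ! i, vs ! (Suc i mod n)}"
    using assms unfolding circuit_def n_def by auto
  \<comment> \<open>The last edge closes the circuit: it is the one whose successor index wraps
    around to 0.\<close>
  obtain es' e where es: "es = es' @ [e]" using c(1) by (metis rev_exhaust)
  have n: "n = Suc (length es')" using es n_def by auto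
  have "vs \<noteq> []" using c n by auto
  define p where "p = zip vs (zip es' (tl vs))"
  have p: "path G (hd vs) p (last vs) \<and> pverts (hd vs) p = set vs"
    unfolding p_def
  proof (rule path_zip)
    show "ends G (es' ! i) = {vs ! i, vs ! Suc i}" if "i < length es'" for i
      using c(7)[of i] that n es by (auto simp: nth_append)
  qed (use c n es in auto)
  have len: "length p = length es'" using p_def c n by auto
  have pe: "pedges p \<subseteq> set es'" by (auto simp: p_def pedges_def in_set_zip)
  then have "e \<notin> pedges p" using c(4) es by auto
  have hl: "hd vs = vs ! 0" "last vs = vs ! (n - 1)" using \<open>vs \<noteq> []\<close> c(2)
    by (auto simp: hd_conv_nth last_conv_nth)
  have "ends G e = {last vs, hd vs}"
    using c(7)[of "n - 1"] n es hl by (auto simp: nth_append)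
  then have "cycle G (hd vs) p (last vs) e"
    using p c(6) es \<open>e \<notin> pedges p\<close> by (auto simp: cycle_def)
  moreover have "clockwise_even d vs es \<longleftrightarrow> even (fw d (p @ [(last vs, e, hd vs)]))" for d
  proof -
    let ?L = "p @ [(last vs, e, hd vs)]"
    have "?L ! i = (vs ! i, es ! i, vs ! (Suc i mod n))" if "i < n" for i
    proof (cases "i < length es'")
      case True
      then show ?thesis using n es c(2) len by (auto simp: p_def nth_append nth_tl)
    next
      case False
      then have "i = n - 1" using that n by auto
      then show ?thesis using n es c(2) len hl by (auto simp: nth_append)
    qed
    then have "fw d ?L = card {i. i < n \<and> d (es ! i) = (vs ! i, vs ! (Suc i mod n))}"
      unfolding fw_def length_filter_conv_card using len n
      by (intro arg_cong[where f = card] Collect_cong conj_cong) (simp_all del: fw_simps)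
    then show ?thesis unfolding clockwise_even_def n_def by simp
  qed
  moreover have "pedges p = set es'"
    using pe path_card_pedges[of G "hd vs" p "last vs"] p len c(4) es
    by (intro card_subset_eq) (auto simp: distinct_card)
  ultimately show ?thesis using that[of "hd vs" p "last vs" e] len es p by auto
qed

lemma cycle_imp_circuit:
  assumes "cycle G u p v e"
  defines "L \<equiv> p @ [(v, e, u)]"
  shows "circuit G (map fst L) (map (fst \<circ> snd) L)"
    and "clockwise_even d (map fst L) (map (fst \<circ> snd) L) \<longleftrightarrow> even (fw d L)"
proof -
  have c: "path G u p v" "e \<in> edges G" "ends G e = {v, u}" "e \<notin> pedges p"
    using assms by (auto simp: cycle_def)
  note l = path_vertex_list[OF c(1)]
  have vs: "map fst L = u # map (snd \<circ> snd) p" using l L_def by auto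
  have snds: "snd (snd (L ! i)) = map fst L ! (Suc i mod length L)" if "i < length L" for i
  proof (cases "i < length p")
    case True
    then show ?thesis unfolding vs using L_def by (auto simp: nth_append)
  next
    case False
    then have "i = length p" using that L_def by auto
    then show ?thesis unfolding vs using L_def by (auto simp: nth_append)
  qed
  have e: "ends G (fst (snd s)) = {fst s, snd (snd s)}" if "s \<in> set L" for s
    using that l c L_def by auto
  have "ends G (map (fst \<circ> snd) L ! i) = {map fst L ! i, map fst L ! (Suc i mod length L)}"
    if "i < length L" for i
    using e[of "L ! i"] snds[of i] that by auto
  moreover have "distinct (map (fst \<circ> snd) L)"
    using path_distinct_pedges[OF c(1)] c(4) L_def by (auto simp: pedges_def)
  moreover have fstL: "map fst L = map fst p @ [v]" by (simp add: L_def)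
  moreover have "set (map fst L) \<subseteq> verts G" "distinct (map fst L)"
    unfolding fstL using l pverts_subset[OF c(1)] by metis+
  moreover have "set (map (fst \<circ> snd) L) \<subseteq> edges G"
    using pedges_subset[OF c(1)] c(2) L_def by (auto simp: pedges_def)
  ultimately show "circuit G (map fst L) (map (fst \<circ> snd) L)"
    unfolding circuit_def using L_def by (intro conjI) simp_all
  have "fw d L = card {i. i < length L \<and> d (map (fst \<circ> snd) L ! i) =
      (map fst L ! i, map fst L ! (Suc i mod length L))}"
    unfolding fw_def length_filter_conv_card using snds
    by (intro arg_cong[where f = card]) (auto simp: case_prod_beta)
  then show "clockwise_even d (map fst L) (map (fst \<circ> snd) L) \<longleftrightarrow> even (fw d L)"
    unfolding clockwise_even_def by simp
qed

lemma even_orientation_iff: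
  "even_orientation G d \<longleftrightarrow>
     orientation G d \<and> (\<forall>vs es. circuit G vs es \<and> even (length es) \<longrightarrow> clockwise_even d vs es)"
proof
  assume L: "even_orientation G d"
  have "clockwise_even d vs es" if "circuit G vs es" "even (length es)" for vs es
  proof -
    obtain u p v e where "cycle G u p v e" "length es = Suc (length p)"
      "\<And>d. clockwise_even d vs es \<longleftrightarrow> even (fw d (p @ [(v, e, u)]))"
      by (rule circuit_imp_cycle[OF \<open>circuit G vs es\<close>]) blast
    then show ?thesis using L that unfolding even_orientation_def by auto
  qed
  then show "orientation G d \<and> (\<forall>vs es. circuit G vs es \<and> even (length es) \<longrightarrow> clockwise_even d vs es)"
    using L unfolding even_orientation_def by auto
next
  assume R: "orientation G d \<and> (\<forall>vs es. circuit G vs es \<and> even (length es) \<longrightarrow> clockwise_even d vs es)"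
  have "even (fw d (p @ [(v, e, u)]))" if "cycle G u p v e" "odd (length p)" for u p v e
    using cycle_imp_circuit(1)[OF that(1)] cycle_imp_circuit(2)[OF that(1), of d] that(2) R
    by (metis even_Suc length_append_singleton length_map)
  then show "even_orientation G d" using R unfolding even_orientation_def by auto
qed

section \<open>Changing the closing edge and the sense of a circuit\<close>

lemma cycle_rotate:
  assumes "cycle G u (p @ (s, f, t) # q) v e"
  shows "cycle G t (q @ (v, e, u) # p) s f"
proof -
  have c: "path G u (p @ (s, f, t) # q) v" "e \<in> edges G" "ends G e = {v, u}" "e \<notin> pedges (p @ (s, f, t) # q)"
    using assms by (auto simp: cycle_def)
  have "u \<noteq> v" using path_self[of G u "p @ (s, f, t) # q"] c(1) by auto
  obtain m where m: "path G u p m" "path G m ((s, f, t) # q) v" "pverts u p \<inter> pverts m ((s, f, t) # q) = {m}"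
    using c(1) path_append by metis
  then have q: "m = s" "path G s ((s, f, t) # q) v" "path G t q v" "ends G f = {s, t}" "f \<in> edges G" "s \<notin> pverts t q"
    by auto
  have uq: "u \<notin> pverts t q" using m q by (metis IntI pverts.simps(2) insertCI singletonD start_in_pverts)
  have int: "pverts u p \<inter> pverts t q = {}" using m(3) q by auto
  have 1: "path G v ((v, e, u) # p) s"
    using m(1) q c(2,3) int path_end_in_pverts[OF q(3)] path_end_in_verts[OF q(3)] by auto
  have "path G t (q @ (v, e, u) # p) s"
    by (rule path_appendI[OF q(3) 1]) (use int in auto)
  moreover have "f \<notin> pedges p" "f \<notin> pedges q"
    using path_distinct_pedges[OF c(1)] by (auto simp: pedges_def)
  ultimately show ?thesis using q c(4) by (auto simp: cycle_def)
qed

lemma cycle_prev: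
  assumes "cycle G u p v e"
  shows "cycle G v (prev p) u e"
  using assms path_prev[of G u p v] by (auto simp: cycle_def insert_commute)

lemma orientation_cases:
  assumes "orientation G d" "e \<in> edges G" "ends G e = {a, b}"
  shows "d e = (a, b) \<or> d e = (b, a)"
  using assms by (cases "d e") (auto simp: orientation_def doubleton_eq_iff)

lemma fw_prev_orientation:
  assumes "path G u p v" "orientation G d"
  shows "fw d (prev p) + fw d p = length p"
  using assms pedges_subset[OF assms(1)] by (intro fw_prev) (auto simp: orientation_def)

lemma even_fw_prev:
  "path G u p v \<Longrightarrow> orientation G d \<Longrightarrow> even (fw d (prev p)) \<longleftrightarrow> (even (fw d p) \<longleftrightarrow> even (length p))"
  by (metis even_add fw_prev_orientation)

text \<open>Reversal turns the count into the length minus the count, and the length is even. This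
  is the independence of clockwise parity from the sense of traversal.\<close>

lemma fw_cycle_prev:
  assumes "cycle G u p v e" "odd (length p)" "orientation G d"
  shows "even (fw d (prev p @ [(u, e, v)])) \<longleftrightarrow> even (fw d (p @ [(v, e, u)]))"
proof -
  have c: "path G u p v" "e \<in> edges G" "ends G e = {v, u}" using assms by (auto simp: cycle_def)
  have "u \<noteq> v" using path_self[of G u p] c(1) assms(2) by auto
  have "d e = (v, u) \<or> d e = (u, v)" using orientation_cases assms(3) c by metis
  then have "odd (fw d [(v, e, u)] + fw d [(u, e, v)])" using \<open>u \<noteq> v\<close> by auto
  moreover have "odd (fw d (prev p) + fw d p)" using fw_prev_orientation[OF c(1) assms(3)] assms(2) by simp
  ultimately show ?thesis unfolding fw_simps(3) even_add by argo
qed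

text \<open>Arguments about a particular edge of a circuit may thus assume that it is the closing
  one. Only the starting point moves, so the count is the same for every orientation.\<close>

lemma cycle_close_at:
  assumes "cycle G u p v e" "f \<in> insert e (pedges p)"
  obtains s q t where "cycle G s q t f" "length q = length p" "pedges q \<union> {f} = pedges p \<union> {e}"
    "\<And>d. fw d (q @ [(t, f, s)]) = fw d (p @ [(v, e, u)])"
proof (cases "f = e")
  case True
  then show ?thesis using that[of u p v] assms(1) by auto
next
  case False
  then obtain a b where "(a, f, b) \<in> set p" using assms(2) by (auto simp: pedges_def)
  then obtain p1 p2 where p: "p = p1 @ (a, f, b) # p2" by (meson split_list)
  show ?thesis
  proof (rule that)
    show "cycle G b (p2 @ (v, e, u) # p1) a f" using cycle_rotate assms(1) p by metis
  qed (use p in auto)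
qed

text \<open>Two parallel paths of odd length disagree: the closed walk traverses one of them backwards.\<close>

lemma even_orientation_parallel:
  assumes "even_orientation G d" "path G a p b" "path G a q b" "pverts a p \<inter> pverts a q = {a, b}"
    "p \<noteq> q" "a \<noteq> b" "even (length p + length q)"
  shows "even (fw d p + fw d q + length p)"
proof -
  obtain f m q' where q: "q = (a, f, m) # q'" using assms(3,6) by (cases q) auto
  have q': "path G m q' b" "a \<notin> pverts m q'" "f \<in> edges G" "ends G f = {a, m}" using assms(3) q by auto
  have 1: "path G b (prev q') m" "pverts b (prev q') = pverts m q'"
    using path_prev[OF q'(1)] pverts_prev[OF q'(1)] by auto
  have "path G a (p @ prev q') m"
    by (rule path_appendI[OF assms(2) 1(1)]) (use 1 assms(4) q' q in auto)
  moreover have "f \<notin> pedges p" using parallel_paths_edge_disjoint[OF assms(2-5)] q by auto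
  moreover have "f \<notin> pedges q'" using path_distinct_pedges[OF assms(3)] q by (auto simp: pedges_def)
  ultimately have "cycle G a (p @ prev q') m f" using q' by (auto simp: cycle_def)
  moreover have "odd (length (p @ prev q'))" using assms(7) q by auto
  ultimately have "even (fw d ((p @ prev q') @ [(m, f, a)]))"
    using assms(1) unfolding even_orientation_def by blast
  then have "even (fw d p + fw d (prev q))" using q by auto
  moreover have "even (fw d (prev q)) \<longleftrightarrow> (even (fw d q) \<longleftrightarrow> even (length q))"
    using even_fw_prev[OF assms(3)] assms(1) unfolding even_orientation_def by blast
  ultimately show ?thesis using assms(7) unfolding even_add by argo
qed

section \<open>Even orientations of subgraphs, isomorphic copies and double subdivisions\<close>

lemma even_orientation_mono:
  assumes "even_orientation G d" "verts K \<subseteq> verts G" "edges K \<subseteq> edges G"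
    "\<And>f. f \<in> edges K \<Longrightarrow> ends K f = ends G f"
  shows "even_orientation K d"
  unfolding even_orientation_def
proof (intro conjI allI impI)
  show "orientation K d" using assms unfolding even_orientation_def orientation_def by (metis subsetD)
  fix u p v e assume "cycle K u p v e \<and> odd (length p)"
  then have "cycle G u p v e" "odd (length p)"
    using path_mono[of K u p v G] assms by (auto simp: cycle_def)
  then show "even (fw d (p @ [(v, e, u)]))" using assms(1) unfolding even_orientation_def by blast
qed

lemma path_map:
  assumes "inj_on f (verts G)" "f ` verts G \<subseteq> verts K" "g ` edges G \<subseteq> edges K"
    "\<And>e. e \<in> edges G \<Longrightarrow> ends K (g e) = f ` ends G e" "path G u p v"
  shows "path K (f u) (map (\<lambda>(a, e, b). (f a, g e, f b)) p) (f v) \<and>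
    pverts (f u) (map (\<lambda>(a, e, b). (f a, g e, f b)) p) = f ` pverts u p"
  using assms(5)
proof (induction p arbitrary: u)
  case (Cons s p)
  obtain a e b where s: "s = (a, e, b)" by (cases s)
  have c: "path G b p v" "u \<in> verts G" "u \<notin> pverts b p" "e \<in> edges G" "ends G e = {u, b}" "a = u"
    using Cons.prems s by auto
  have "f u \<notin> f ` pverts b p" using c assms(1) pverts_subset[OF c(1)] by (auto simp: inj_on_def)
  then show ?case using Cons.IH[OF c(1)] c assms s by auto
qed (use assms(2) in auto)

lemma even_orientation_isomorphic:
  assumes "even_orientation K d" "isomorphic F K" "multigraph F"
  obtains d' where "even_orientation F d'"
proof -
  obtain f g where f: "bij_betw f (verts F) (verts K)" "bij_betw g (edges F) (edges K)"
    "\<And>e. e \<in> edges F \<Longrightarrow> ends K (g e) = f ` ends F e"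
    using assms(2) unfolding isomorphic_def by auto
  have inj: "inj_on f (verts F)" "inj_on g (edges F)" and im: "f ` verts F = verts K" "g ` edges F = edges K"
    using f by (auto simp: bij_betw_def)
  have ends: "ends F e \<subseteq> verts F" if "e \<in> edges F" for e
    using assms(3) that by (auto simp: multigraph_def)
  let ?h = "the_inv_into (verts F) f"
  define d' where "d' e = (?h (fst (d (g e))), ?h (snd (d (g e))))" for e
  have or: "{fst (d (g e)), snd (d (g e))} = f ` ends F e" if "e \<in> edges F" for e
  proof -
    have "g e \<in> edges K" using that im by auto
    then show ?thesis using assms(1) that f(3) unfolding even_orientation_def orientation_def by metis
  qed
  have d': "d' e = (a, b) \<longleftrightarrow> d (g e) = (f a, f b)" if "e \<in> edges F" "a \<in> verts F" "b \<in> verts F" for e a b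
  proof -
    obtain a' b' where "a' \<in> ends F e" "b' \<in> ends F e" "d (g e) = (f a', f b')"
      using or[OF \<open>e \<in> edges F\<close>] by (metis imageE insertCI prod.collapse)
    moreover from this have "a' \<in> verts F" "b' \<in> verts F" using ends that by auto
    ultimately show ?thesis using that inj by (auto simp: d'_def the_inv_into_f_f inj_on_eq_iff)
  qed
  have "orientation F d'"
    unfolding orientation_def
  proof
    fix e assume e: "e \<in> edges F"
    have "{fst (d' e), snd (d' e)} = ?h ` {fst (d (g e)), snd (d (g e))}" by (auto simp: d'_def)
    also have "\<dots> = ends F e" using or[OF e] ends[OF e] inj
      by (auto simp: image_image the_inv_into_f_f subset_iff)
    finally show "ends F e = {fst (d' e), snd (d' e)}" ..
  qed
  moreover have "even (fw d' (p @ [(v, e, u)]))" if c: "cycle F u p v e" and o: "odd (length p)" for u p v e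
  proof -
    let ?m = "map (\<lambda>(a, e, b). (f a, g e, f b))"
    have p: "path F u p v" "e \<in> edges F" "ends F e = {v, u}" "e \<notin> pedges p"
      using c by (auto simp: cycle_def)
    have pe: "pedges p \<subseteq> edges F" using pedges_subset[OF p(1)] .
    have "pedges (?m p) = g ` pedges p" by (auto simp: pedges_def image_image case_prod_beta)
    then have "cycle K (f u) (?m p) (f v) (g e)"
      using path_map[of f F K g u p v] p f im inj pe
      by (auto simp: cycle_def inj_on_image_mem_iff[OF inj(2)])
    then have 1: "even (fw d (?m p @ [(f v, g e, f u)]))"
      using assms(1) o unfolding even_orientation_def by auto
    have 2: "fw d (?m q) = fw d' q" if "path F w q z" for w q z
      using that
    proof (induction q arbitrary: w)
      case (Cons s q)
      obtain a e b where s: "s = (a, e, b)" by (cases s)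
      have "path F b q z" "a \<in> verts F" "e \<in> edges F" using Cons.prems s by auto
      moreover from this have "b \<in> verts F" using path_start_in_verts by metis
      ultimately show ?case using Cons.IH[of b] d'[of e a b] s by auto
    qed auto
    have "u \<in> verts F" "v \<in> verts F" using p path_start_in_verts path_end_in_verts by metis+
    then show ?thesis using 1 2[OF p(1)] d'[of e v u] p by auto
  qed
  ultimately have "even_orientation F d'" unfolding even_orientation_def by auto
  then show ?thesis by (rule that)
qed

lemma multigraph_subdivides_twice:
  assumes "multigraph H" "subdivides_twice H H'"
  shows "multigraph H'"
proof -
  obtain e u v x y e1 e2 e3 where H: "e \<in> edges H" "ends H e = {u, v}" "x \<notin> verts H" "y \<notin> verts H" "x \<noteq> y"
    "e1 \<notin> edges H" "e2 \<notin> edges H" "e3 \<notin> edges H" "distinct [e1, e2, e3]"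
    "H' = \<lparr>verts = verts H \<union> {x, y}, edges = (edges H - {e}) \<union> {e1, e2, e3},
           ends = (ends H)(e1 := {u, x}, e2 := {x, y}, e3 := {y, v})\<rparr>"
    using assms(2) unfolding subdivides_twice_def by (elim exE conjE) blast
  have "{u, v} \<subseteq> verts H" using assms(1) H unfolding multigraph_def by metis
  then have uv: "u \<noteq> x" "v \<noteq> y" "u \<in> verts H" "v \<in> verts H" using H by auto
  have "finite (verts H')" "finite (edges H')" using assms(1) H(10) by (auto simp: multigraph_def)
  moreover have "ends H' f \<subseteq> verts H' \<and> (card (ends H' f) = 1 \<or> card (ends H' f) = 2)"
    if "f \<in> edges H'" for f
  proof (cases "f \<in> {e1, e2, e3}")
    case True
    then have "ends H' f \<in> {{u, x}, {x, y}, {y, v}}" using H(9) by (auto simp: H(10))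
    moreover have "card {u, x} = 2" "card {x, y} = 2" "card {y, v} = 2" using uv H(5) by auto
    moreover have "verts H' = verts H \<union> {x, y}" by (simp add: H(10))
    ultimately show ?thesis using uv by auto
  next
    case False
    then have "f \<in> edges H" "ends H' f = ends H f" using that H(10) by auto
    then show ?thesis using assms(1) H(10) unfolding multigraph_def by auto
  qed
  ultimately show ?thesis unfolding multigraph_def by blast
qed

lemma even_orientation_unsubdivide:
  assumes "multigraph H" "subdivides_twice H H'" "even_orientation H' d'"
  obtains d where "even_orientation H d"
proof -
  obtain e u v x y e1 e2 e3 where H: "e \<in> edges H" "ends H e = {u, v}" "x \<notin> verts H" "y \<notin> verts H" "x \<noteq> y"
    "e1 \<notin> edges H" "e2 \<notin> edges H" "e3 \<notin> edges H" "e1 \<noteq> e2" "e1 \<noteq> e3" "e2 \<noteq> e3"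
    and H': "H' = \<lparr>verts = verts H \<union> {x, y}, edges = (edges H - {e}) \<union> {e1, e2, e3},
           ends = (ends H)(e1 := {u, x}, e2 := {x, y}, e3 := {y, v})\<rparr>"
    using assms(2) unfolding subdivides_twice_def by (elim exE conjE) auto
  have uv: "u \<in> verts H" "v \<in> verts H" using assms(1) H unfolding multigraph_def by auto
  have or: "orientation H' d'" using assms(3) by (auto simp: even_orientation_def)
  define P where "P = [(u, e1, x), (x, e2, y), (y, e3, v)]"
  \<comment> \<open>\<open>e\<close> gets the direction for which traversing it counts, modulo 2,
    like traversing \<open>P\<close>. As \<open>P\<close> is odd, just like a single edge, the two
    also agree in the reverse sense.\<close>
  define d where "d = d'(e := if odd (fw d' P) then (u, v) else (v, u))"
  have de1: "d' e1 = (u, x) \<or> d' e1 = (x, u)" and de2: "d' e2 = (x, y) \<or> d' e2 = (y, x)"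
    and de3: "d' e3 = (y, v) \<or> d' e3 = (v, y)"
    using orientation_cases[OF or, of e1 u x] orientation_cases[OF or, of e2 x y]
      orientation_cases[OF or, of e3 y v] H H' by auto
  have orH: "orientation H d"
    unfolding orientation_def
  proof
    fix f assume f: "f \<in> edges H"
    show "ends H f = {fst (d f), snd (d f)}"
    proof (cases "f = e")
      case True
      then show ?thesis using H(2) by (auto simp: d_def)
    next
      case False
      then have "f \<in> edges H'" "ends H' f = ends H f" using f H H' by auto
      then show ?thesis using or False unfolding orientation_def d_def by simp
    qed
  qed
  have fw_d: "fw d q = fw d' q" if "e \<notin> pedges q" for q
    using that by (induction q) (auto simp: d_def)
  have path': "path H' s q t" if "path H s q t" "e \<notin> pedges q" for s q t
    using that H H' by (induction q arbitrary: s) auto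
  \<comment> \<open>Replacing \<open>e\<close> by \<open>P\<close> gives a circuit of
    \<open>H'\<close> with closing edge \<open>e3\<close>, longer by 2.\<close>
  have closed: "even (fw d (q @ [(t, e, s)]))" if c: "cycle H s q t e" and o: "odd (length q)" and st: "s = v" "t = u" for s q t
  proof -
    have q: "path H v q u" "e \<notin> pedges q" using c st by (auto simp: cycle_def)
    have "u \<noteq> v" using path_self[of H v q] q o by auto
    have xy: "x \<notin> pverts v q" "y \<notin> pverts v q" using pverts_subset[OF q(1)] H by auto
    have 1: "path H' u [(u, e1, x), (x, e2, y)] y"
      using H H' uv by auto
    have "path H' v (q @ [(u, e1, x), (x, e2, y)]) y"
      by (rule path_appendI[OF path'[OF q] 1]) (use xy in auto)
    moreover have "e3 \<notin> pedges q" using pedges_subset[OF q(1)] H by auto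
    ultimately have "cycle H' v (q @ [(u, e1, x), (x, e2, y)]) y e3"
      using H H' by (auto simp: cycle_def)
    then have "even (fw d' ((q @ [(u, e1, x), (x, e2, y)]) @ [(y, e3, v)]))"
      using assms(3) o unfolding even_orientation_def
      by (elim conjE allE[of _ v] allE[of _ "q @ [(u, e1, x), (x, e2, y)]"] allE[of _ y] allE[of _ e3]) simp
    then have "even (fw d' q + fw d' P)" by (simp add: P_def)
    moreover have "odd (fw d' P) \<longleftrightarrow> odd (fw d [(u, e, v)])" using \<open>u \<noteq> v\<close> by (auto simp: d_def)
    ultimately show ?thesis using fw_d[OF q(2)] st unfolding fw_simps(3) by presburger
  qed
  have "even (fw d (p @ [(t, f, s)]))" if c: "cycle H s p t f" and o: "odd (length p)" for s p t f
  proof (cases "e \<in> insert f (pedges p)")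
    case False
    then have "cycle H' s p t f" using c path'[of s p t] H H' by (auto simp: cycle_def)
    then have "even (fw d' (p @ [(t, f, s)]))" using assms(3) o unfolding even_orientation_def by auto
    then show ?thesis using fw_d[of "p @ [(t, f, s)]"] False by auto
  next
    case True
    obtain s' q t' where q: "cycle H s' q t' e" "length q = length p"
      "\<And>d. fw d (q @ [(t', e, s')]) = fw d (p @ [(t, f, s)])"
      by (rule cycle_close_at[OF c True]) blast
    have "{t', s'} = {u, v}" using q(1) H(2) by (auto simp: cycle_def)
    then consider "s' = v" "t' = u" | "s' = u" "t' = v" by (auto simp: doubleton_eq_iff)
    then have "even (fw d (q @ [(t', e, s')]))"
    proof cases
      case 1
      then show ?thesis using closed q o by metis
    next
      case 2
      then have "even (fw d (prev q @ [(s', e, t')]))" using closed[OF cycle_prev[OF q(1)]] q o by simp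
      then show ?thesis using fw_cycle_prev[OF q(1) _ orH] q(2) o by auto
    qed
    then show ?thesis using q(3) by metis
  qed
  then have "even_orientation H d" using orH unfolding even_orientation_def by auto
  then show ?thesis by (rule that)
qed

lemma even_orientation_even_subdivision:
  assumes "multigraph F" "even_subdivision F H" "even_orientation H d"
  obtains d' where "even_orientation F d'"
proof -
  obtain F' where F': "subdivides_twice\<^sup>*\<^sup>* F F'" "isomorphic F' H"
    using assms(2) unfolding even_subdivision_def by auto
  have m: "multigraph F'" using F'(1) assms(1)
    by (induction rule: rtranclp_induct) (auto intro: multigraph_subdivides_twice)
  obtain d' where "even_orientation F' d'" using even_orientation_isomorphic[OF assms(3) F'(2) m] .
  have "\<exists>d. even_orientation F d" using F'(1) assms(1) \<open>even_orientation F' d'\<close>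
  proof (induction rule: converse_rtranclp_induct)
    case (step F1 F2)
    then show ?case using multigraph_subdivides_twice even_orientation_unsubdivide by metis
  qed auto
  then show ?thesis using that by auto
qed

section \<open>The graphs \<open>E1\<close> and \<open>E3\<close> have no even orientation\<close>

lemma multigraph_E1: "multigraph E1" and multigraph_E3: "multigraph E3"
proof -
  show "multigraph E1" by (auto simp: multigraph_def E1_def)
  have "{..<10::nat} = {0,1,2,3,4,5,6,7,8,9}" by auto
  then show "multigraph E3" by (auto simp: multigraph_def E3_def)
qed

text \<open>Two of the three edges point the same way, and the circuit formed by these two is
  clockwise odd.\<close>

lemma E1_no_even_orientation: "\<not> even_orientation E1 d"
proof
  assume d: "even_orientation E1 d"
  have c: "cycle E1 0 [(0, i, 1)] 1 j" if "i \<in> {0, 1, 2}" "j \<in> {0, 1, 2}" "i \<noteq> j" for i j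
    using that by (auto simp: cycle_def E1_def)
  have 1: "even (fw d ([(0, i, 1)] @ [(1, j, 0)]))" if "i \<in> {0, 1, 2}" "j \<in> {0, 1, 2}" "i \<noteq> j" for i j
    using d c[OF that] unfolding even_orientation_def by fastforce
  have "d i = (0, 1) \<or> d i = (1, 0)" if "i \<in> {0, 1, 2}" for i
    using d that orientation_cases[of E1 d i 0 1] unfolding even_orientation_def by (auto simp: E1_def)
  from this[of 0] this[of 1] this[of 2] 1[of 0 1] 1[of 0 2] 1[of 1 2] show False by auto
qed

lemma E3_no_even_orientation: "\<not> even_orientation E3 d"
proof
  assume d: "even_orientation E3 d"
  \<comment> \<open>Each edge of \<open>E3\<close> lies in exactly two of these three even circuits.
    The five edges 2, 3, 4, 5 and 8 are traversed in opposite senses by their two circuits, the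
    others in the same sense; so the three counts add up to an odd number.\<close>
  have c1: "cycle E3 0 [(0,0,4),(4,1,1),(1,2,5),(5,3,2),(2,4,6),(6,5,3),(3,6,7)] 7 7"
    and c2: "cycle E3 0 [(0,0,4),(4,1,1),(1,9,3),(3,5,6),(6,4,2)] 2 8"
    and c3: "cycle E3 0 [(0,8,2),(2,3,5),(5,2,1),(1,9,3),(3,6,7)] 7 7"
    by (auto simp: cycle_def E3_def insert_commute)
  have or: "orientation E3 d" using d by (auto simp: even_orientation_def)
  have f: "fw d [(a, i, b)] + fw d [(b, i, a)] = 1" if "i \<in> edges E3" "ends E3 i = {a, b}" "a \<noteq> b" for a i b
    using orientation_cases[OF or that(1,2)] that(3) by auto
  have cycE: "even (fw d (p @ [(v, e, u)]))" if "cycle E3 u p v e" "odd (length p)" for u p v e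
    using d that unfolding even_orientation_def by blast
  let ?f = "\<lambda>a i b. fw d [(a, i, b)]"
  have cons: "fw d (s # p) = fw d [s] + fw d p" if "p \<noteq> []" for s p by (auto simp: fw_def)
  have "even (?f 0 0 4 + (?f 4 1 1 + (?f 1 2 5 + (?f 5 3 2 + (?f 2 4 6 + (?f 6 5 3 + (?f 3 6 7 + ?f 7 7 0)))))))"
    using cycE[OF c1] by (simp del: fw_simps(2) even_add add: cons)
  moreover have "even (?f 0 0 4 + (?f 4 1 1 + (?f 1 9 3 + (?f 3 5 6 + (?f 6 4 2 + ?f 2 8 0)))))"
    using cycE[OF c2] by (simp del: fw_simps(2) even_add add: cons)
  moreover have "even (?f 0 8 2 + (?f 2 3 5 + (?f 5 2 1 + (?f 1 9 3 + (?f 3 6 7 + ?f 7 7 0)))))"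
    using cycE[OF c3] by (simp del: fw_simps(2) even_add add: cons)
  moreover have "odd (?f 5 3 2 + ?f 2 3 5)" "odd (?f 1 2 5 + ?f 5 2 1)" "odd (?f 2 4 6 + ?f 6 4 2)"
    "odd (?f 6 5 3 + ?f 3 5 6)" "odd (?f 0 8 2 + ?f 2 8 0)"
    by (subst f; simp add: E3_def; fail)+
  ultimately show False unfolding even_add by argo
qed

section \<open>Contracting an odd circuit\<close>

text \<open>An edge is reversed exactly if \<open>h\<close> separates its ends, which amounts to
  reversing all edges at each vertex of \<open>h\<close> in turn. A circuit crosses this cut an even
  number of times, so clockwise parities persist.\<close>

definition switch :: "('v \<Rightarrow> bool) \<Rightarrow> ('e \<Rightarrow> 'v \<times> 'v) \<Rightarrow> 'e \<Rightarrow> 'v \<times> 'v" where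
  "switch h d e = (if h (fst (d e)) = h (snd (d e)) then d e else (snd (d e), fst (d e)))"

lemma orientation_switch: "orientation G d \<Longrightarrow> orientation G (switch h d)"
  by (auto simp: orientation_def switch_def insert_commute)

lemma even_fw_switch_edge:
  assumes "orientation G d" "e \<in> edges G" "ends G e = {a, b}" "a \<noteq> b"
  shows "even (fw (switch h d) [(a, e, b)]) \<longleftrightarrow> (even (fw d [(a, e, b)]) \<longleftrightarrow> h a = h b)"
  using orientation_cases[OF assms(1-3)] assms(4) by (auto simp: switch_def)

lemma even_fw_switch:
  assumes "orientation G d" "path G u p v"
  shows "even (fw (switch h d) p) \<longleftrightarrow> (even (fw d p) \<longleftrightarrow> h u = h v)"
  using assms(2)
proof (induction p arbitrary: u)
  case (Cons s p)
  obtain a e b where s: "s = (a, e, b)" by (cases s)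
  have c: "path G b p v" "u \<notin> pverts b p" "e \<in> edges G" "ends G e = {u, b}" "a = u" using Cons.prems s by auto
  have "u \<noteq> b" using c(2) by auto
  have sp: "fw d' (s # p) = fw d' [(u, e, b)] + fw d' p" for d' using s c by simp
  show ?case
    unfolding sp even_add Cons.IH[OF c(1)] even_fw_switch_edge[OF assms(1) c(3,4) \<open>u \<noteq> b\<close>] by auto
qed auto

lemma even_orientation_switch:
  assumes "even_orientation G d"
  shows "even_orientation G (switch h d)"
  unfolding even_orientation_def
proof (intro conjI allI impI)
  have or: "orientation G d" using assms by (auto simp: even_orientation_def)
  then show "orientation G (switch h d)" by (rule orientation_switch)
  fix u p v e assume "cycle G u p v e \<and> odd (length p)"
  then have c: "cycle G u p v e" "odd (length p)" by auto
  then have p: "path G u p v" "e \<in> edges G" "ends G e = {v, u}" by (auto simp: cycle_def)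
  have "u \<noteq> v" using path_self[of G u p] p(1) c(2) by auto
  have "even (fw d (p @ [(v, e, u)]))" using assms c unfolding even_orientation_def by auto
  then show "even (fw (switch h d) (p @ [(v, e, u)]))"
    using even_fw_switch[OF or p(1), of h] even_fw_switch_edge[OF or p(2,3) \<open>u \<noteq> v\<close>[symmetric], of h]
    unfolding fw_simps(3) even_add by auto
qed

text \<open>The flag allows for both senses: switching preserves the parity of the count on a
  circuit, so the sense in which an odd circuit can be made directed is not free.\<close>

definition aligned :: "bool \<Rightarrow> ('e \<Rightarrow> 'v \<times> 'v) \<Rightarrow> ('v \<times> 'e \<times> 'v) list \<Rightarrow> bool" where
  "aligned c d p \<longleftrightarrow> (\<forall>(a, e, b)\<in>set p. d e = (if c then (a, b) else (b, a)))"

lemma aligned_simps [simp]: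
  "aligned c d []" "aligned c d ((a, e, b) # p) \<longleftrightarrow> d e = (if c then (a, b) else (b, a)) \<and> aligned c d p"
  "aligned c d (p @ q) \<longleftrightarrow> aligned c d p \<and> aligned c d q"
  by (auto simp: aligned_def ball_Un)

lemma fw_aligned: "path G u p v \<Longrightarrow> aligned c d p \<Longrightarrow> fw d p = (if c then length p else 0)"
proof (induction p arbitrary: u)
  case (Cons s p)
  obtain a e b where s: "s = (a, e, b)" by (cases s)
  have "u \<noteq> b" using Cons.prems s by auto
  then show ?case using Cons s by auto
qed auto

text \<open>The values of \<open>h\<close> are chosen from the far end backwards: \<open>u\<close>
  is an end of none of the later edges, so \<open>h u\<close> can still be set to fix the first
  edge.\<close>

lemma ex_switch_aligned:
  assumes "orientation G d" "path G u p v"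
  shows "\<exists>h. aligned c (switch h d) p"
  using assms(2)
proof (induction p arbitrary: u)
  case (Cons s p)
  obtain a e b where s: "s = (a, e, b)" by (cases s)
  have c: "path G b p v" "u \<notin> pverts b p" "e \<in> edges G" "ends G e = {u, b}" "a = u" using Cons.prems s by auto
  have "u \<noteq> b" using c(2) by auto
  obtain h where h: "aligned c (switch h d) p" using Cons.IH[OF c(1)] by blast
  define h' where "h' = h(u := (h b \<longleftrightarrow> d e = (if c then (u, b) else (b, u))))"
  have "switch h' d e = (if c then (u, b) else (b, u))"
  proof -
    have "h' u \<longleftrightarrow> (h b \<longleftrightarrow> d e = (if c then (u, b) else (b, u)))" "h' b = h b"
      using \<open>u \<noteq> b\<close> by (auto simp: h'_def)
    then show ?thesis
      using orientation_cases[OF assms(1) c(3,4)] \<open>u \<noteq> b\<close>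
      by (cases c; elim disjE; simp add: switch_def)
  qed
  moreover have "aligned c (switch h' d) p"
    unfolding aligned_def
  proof (clarify)
    fix x f y assume f: "(x, f, y) \<in> set p"
    then have "f \<in> pedges p" by (force simp: pedges_def)
    then have fe: "f \<in> edges G" "ends G f \<subseteq> pverts b p"
      using pedges_subset[OF c(1)] pedge_ends_subset[OF c(1)] by auto
    then have "fst (d f) \<noteq> u" "snd (d f) \<noteq> u" using assms(1) c(2) by (auto simp: orientation_def)
    then have "switch h' d f = switch h d f" by (simp add: switch_def h'_def)
    then show "switch h' d f = (if c then (x, y) else (y, x))" using h f by (auto simp: aligned_def)
  qed
  ultimately show ?case using s c by auto
qed auto

text \<open>\<open>h1\<close> makes the path forward, \<open>h2\<close> makes it backward. The path
  being even, both counts are even, so both switchings treat the pair \<open>u\<close>,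
  \<open>v\<close> alike and give \<open>e\<close> the same direction; this direction suits one of
  the two.\<close>

lemma ex_switch_aligned_odd_cycle:
  assumes "orientation G d" "cycle G u p v e" "even (length p)"
  shows "\<exists>h c. aligned c (switch h d) (p @ [(v, e, u)])"
proof -
  have p: "path G u p v" "e \<in> edges G" "ends G e = {v, u}" using assms(2) by (auto simp: cycle_def)
  obtain h1 where h1: "aligned True (switch h1 d) p" using ex_switch_aligned[OF assms(1) p(1)] by blast
  obtain h2 where h2: "aligned False (switch h2 d) p" using ex_switch_aligned[OF assms(1) p(1)] by blast
  have "h1 u = h1 v \<longleftrightarrow> h2 u = h2 v"
    using even_fw_switch[OF assms(1) p(1), of h1] even_fw_switch[OF assms(1) p(1), of h2]
      fw_aligned[OF p(1) h1] fw_aligned[OF p(1) h2] assms(3) by auto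
  moreover have d: "d e = (v, u) \<or> d e = (u, v)" using orientation_cases[OF assms(1) p(2,3)] .
  ultimately have "switch h1 d e = switch h2 d e" by (auto simp: switch_def)
  moreover have "switch h1 d e = (v, u) \<or> switch h1 d e = (u, v)" using d by (auto simp: switch_def)
  ultimately have "aligned True (switch h1 d) (p @ [(v, e, u)]) \<or> aligned False (switch h2 d) (p @ [(v, e, u)])"
    using h1 h2 by auto
  then show ?thesis by blast
qed

text \<open>For distinct \<open>x\<close> and \<open>y\<close> one of the two arcs of the odd
  circuit is even, and on a directed circuit its count is 0 or its length.\<close>

lemma aligned_odd_cycle_even_path:
  assumes "orientation G d" "cycle G u p v e" "even (length p)" "aligned c d (p @ [(v, e, u)])"
    "x \<in> pverts u p" "y \<in> pverts u p"
  shows "\<exists>q. path G y q x \<and> even (length q) \<and> even (fw d q) \<and> pverts y q \<subseteq> pverts u p"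
proof -
  have p: "path G u p v" "e \<in> edges G" "ends G e = {v, u}" "e \<notin> pedges p" using assms(2) by (auto simp: cycle_def)
  have rev: "\<exists>q. path G y q x \<and> even (length q) \<and> even (fw d q) \<and> pverts y q \<subseteq> pverts u p"
    if "\<exists>q. path G x q y \<and> even (length q) \<and> even (fw d q) \<and> pverts x q \<subseteq> pverts u p" for x y
  proof -
    obtain q where q: "path G x q y" "even (length q)" "even (fw d q)" "pverts x q \<subseteq> pverts u p"
      using \<open>\<exists>q. path G x q y \<and> even (length q) \<and> even (fw d q) \<and> pverts x q \<subseteq> pverts u p\<close> by blast
    then show ?thesis using path_prev[OF q(1)] pverts_prev[OF q(1)] even_fw_prev[OF q(1) assms(1)]
      by (intro exI[of _ "prev q"]) auto
  qed
  \<comment> \<open>Here \<open>x\<close> lies behind \<open>y\<close> on \<open>p\<close>. Either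
    the piece \<open>r1\<close> of \<open>p\<close> is the even arc, or it is the complement through
    \<open>e\<close>, which is found from \<open>x\<close> to \<open>y\<close> and then
    reversed.\<close>
  have main: "\<exists>q. path G y q x \<and> even (length q) \<and> even (fw d q) \<and> pverts y q \<subseteq> pverts u p"
    if pp: "p = p1 @ p2" "path G u p1 y" "path G y p2 v" "pverts u p1 \<inter> pverts y p2 = {y}"
      "pverts u p = pverts u p1 \<union> pverts y p2" and x: "x \<in> pverts y p2" for x y p1 p2
  proof (cases "x = y")
    case True
    then show ?thesis using pp pverts_subset[OF p(1)] by (intro exI[of _ "[]"]) auto
  next
    case False
    obtain r1 r2 where r: "p2 = r1 @ r2" "path G y r1 x" "path G x r2 v" "pverts y r1 \<inter> pverts x r2 = {x}"
      "pverts y p2 = pverts y r1 \<union> pverts x r2"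
      using path_split[OF pp(3) x] .
    have y2: "y \<notin> pverts x r2" using r(4) False by (metis IntI singletonD start_in_pverts)
    show ?thesis
    proof (cases "even (length r1)")
      case True
      then show ?thesis using r pp fw_aligned[OF r(2), of c d] assms(4)
        by (intro exI[of _ r1]) (auto split: if_splits)
    next
      case odd: False
      have "x \<notin> pverts u p1" using pp(4) x False by auto
      then have int: "pverts u p1 \<inter> pverts x r2 = {}" using pp(4) r(5) y2 by auto
      have "v \<notin> pverts u p1" using int path_end_in_pverts[OF r(3)] by auto
      then have 1: "path G v ((v, e, u) # p1) y" using pp(2) p path_end_in_verts[OF p(1)] by auto
      have 2: "path G x (r2 @ (v, e, u) # p1) y"
        by (rule path_appendI[OF r(3) 1]) (use int in auto)
      have al: "aligned c d (r2 @ (v, e, u) # p1)" using assms(4) pp r by auto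
      have len: "even (length (r2 @ (v, e, u) # p1))" using odd assms(3) pp(1) r(1) by auto
      have "even (fw d (r2 @ (v, e, u) # p1))" using fw_aligned[OF 2 al] len by (auto split: if_splits)
      moreover have "pverts x (r2 @ (v, e, u) # p1) \<subseteq> pverts u p"
        using pverts_append[OF r(3), of "(v, e, u) # p1"] pp(5) r(5) path_end_in_pverts[OF r(3)] by auto
      ultimately have "\<exists>q. path G x q y \<and> even (length q) \<and> even (fw d q) \<and> pverts x q \<subseteq> pverts u p"
        using 2 len by blast
      then show ?thesis by (rule rev)
    qed
  qed
  obtain p1 p2 where pp: "p = p1 @ p2" "path G u p1 y" "path G y p2 v" "pverts u p1 \<inter> pverts y p2 = {y}"
      "pverts u p = pverts u p1 \<union> pverts y p2"
    using path_split[OF p(1) assms(6)] .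
  obtain q1 q2 where qq: "p = q1 @ q2" "path G u q1 x" "path G x q2 v" "pverts u q1 \<inter> pverts x q2 = {x}"
      "pverts u p = pverts u q1 \<union> pverts x q2"
    using path_split[OF p(1) assms(5)] .
  show ?thesis
  proof (cases "x \<in> pverts y p2")
    case True
    then show ?thesis using main pp by blast
  next
    case False
    have "y \<in> pverts x q2"
    proof (rule ccontr)
      assume "y \<notin> pverts x q2"
      have "length p1 \<le> length q1 \<or> length q1 \<le> length p1" by auto
      then consider r where "q1 = p1 @ r" | r where "p1 = q1 @ r"
        using pp(1) qq(1) by (metis append_eq_append_conv2)
      then show False
      proof cases
        case 1
        then have "p2 = r @ q2" using pp qq by auto
        then have "x \<in> pverts y p2"
          using pp(3) path_append[of G y r q2 v] qq(3) 1 qq(2) pp(2) path_append[of G u p1 r x]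
          by (metis path_end_in_pverts path_end_unique pverts_append UnI1)
        then show False using False by auto
      next
        case 2
        then have "q2 = r @ p2" using pp qq by auto
        then have "y \<in> pverts x q2"
          using qq(3) path_append[of G x r p2 v] pp(3) 2 pp(2) qq(2) path_append[of G u q1 r y]
          by (metis path_end_in_pverts path_end_unique pverts_append UnI1)
        then show False using \<open>y \<notin> pverts x q2\<close> by auto
      qed
    qed
    then show ?thesis using main qq rev by blast
  qed
qed

lemma even_orientation_contract_circuit:
  assumes "multigraph K" "circuit K vs es" "odd (length es)" "even_orientation K d"
  obtains d' where "even_orientation (contract_circuit K vs es) d'"
proof -
  obtain u0 p0 v0 c0 where c0: "cycle K u0 p0 v0 c0" "length es = Suc (length p0)"
    "set vs = pverts u0 p0" "set es = insert c0 (pedges p0)"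
    by (rule circuit_imp_cycle[OF assms(2)]) blast
  have ev: "even (length p0)" using assms(3) c0(2) by auto
  define A where "A = pverts u0 p0"
  have or0: "orientation K d" using assms(4) by (auto simp: even_orientation_def)
  obtain h c where hc: "aligned c (switch h d) (p0 @ [(v0, c0, u0)])"
    using ex_switch_aligned_odd_cycle[OF or0 c0(1) ev] by blast
  define D where "D = switch h d"
  have D: "even_orientation K D" using even_orientation_switch[OF assms(4)] D_def by auto
  have or: "orientation K D" using D by (auto simp: even_orientation_def)
  have arc: "\<exists>q. path K y q x \<and> even (length q) \<and> even (fw D q) \<and> pverts y q \<subseteq> A" if "x \<in> A" "y \<in> A" for x y
    using aligned_odd_cycle_even_path[OF or c0(1) ev, of c x y] hc that by (auto simp: A_def D_def)
  define cls where "cls = (\<lambda>v. if v \<in> A then A else {v})"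
  define K' where "K' = contract_circuit K vs es"
  have K': "verts K' = cls ` verts K" "edges K' = edges K - set es" "ends K' = (\<lambda>e. cls ` ends K e)"
    using c0(3) by (auto simp: K'_def contract_circuit_def cls_def A_def Let_def)
  define D' where "D' e = (cls (fst (D e)), cls (snd (D e)))" for e
  have or': "orientation K' D'"
    using or unfolding orientation_def K' D'_def by simp
  have cls_single: "cls z = {a} \<longleftrightarrow> z = a" if "a \<notin> A" for z a using that by (auto simp: cls_def)
  have cls_A: "cls z = A \<longleftrightarrow> z \<in> A" for z by (auto simp: cls_def)
  have single: "\<exists>x. U = {x} \<and> x \<notin> A \<and> x \<in> verts K" if "U \<in> verts K'" "U \<noteq> A" for U
    using that unfolding K' by (auto simp: cls_def split: if_splits)
  have card: "ends K e \<subseteq> verts K" "card (ends K e) = 1 \<or> card (ends K e) = 2" if "e \<in> edges K" for e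
    using assms(1) that by (auto simp: multigraph_def)
  have ends2: "ends K e = {a, b}" if "e \<in> edges K" "a \<in> ends K e" "b \<in> ends K e" "a \<noteq> b" for e a b
  proof -
    have "finite (ends K e)" "card (ends K e) \<le> card {a, b}" using card(2)[OF that(1)] that(4) card.infinite by fastforce+
    then show ?thesis using card_seteq[of "ends K e" "{a, b}"] that by auto
  qed
  have end_single: "ends K e = {a, b}" if "e \<in> edges K'" "ends K' e = {{a}, {b}}" "a \<notin> A" "b \<notin> A" for e a b
  proof -
    have "cls ` ends K e = {{a}, {b}}" using that K' by simp
    then have "\<forall>z\<in>ends K e. z = a \<or> z = b" "a \<in> ends K e" "b \<in> ends K e"
      using cls_single that(3,4) by (metis imageI insertE singletonD, (metis imageE insertCI)+)
    then show ?thesis by auto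
  qed
  have end_A: "\<exists>x\<in>A. ends K e = {x, b}" if "e \<in> edges K'" "ends K' e = {A, {b}}" "b \<notin> A" for e b
  proof -
    have "cls ` ends K e = {A, {b}}" using that K' by simp
    then obtain x b' where "x \<in> ends K e" "cls x = A" "b' \<in> ends K e" "cls b' = {b}" by (metis imageE insertCI)
    then have "x \<in> A" "b \<in> ends K e" using cls_A cls_single[OF that(3)] by auto
    then show ?thesis using ends2[of e x b] that K' \<open>x \<in> ends K e\<close> by auto
  qed
  let ?l = "map (\<lambda>(a, e, b). (the_elem a, e, the_elem b))"
  \<comment> \<open>Away from \<open>A\<close> all classes are singletons, so a path of the
    contraction is a path of \<open>K\<close> up to \<open>the_elem\<close>.\<close>
  have lift: "\<exists>x y. U = {x} \<and> V = {y} \<and> path K x (?l p) y \<and> pverts x (?l p) \<inter> A = {} \<and>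
      pverts U p = (\<lambda>z. {z}) ` pverts x (?l p) \<and> fw D (?l p) = fw D' p"
    if "path K' U p V" "A \<notin> pverts U p" for U p V
    using that
  proof (induction p arbitrary: U)
    case Nil
    then obtain x where "U = {x}" "x \<notin> A" "x \<in> verts K" using single[of U] by auto
    then show ?case using Nil by auto
  next
    case (Cons s p)
    obtain a e B where s: "s = (a, e, B)" by (cases s)
    have c: "path K' B p V" "U \<notin> pverts B p" "e \<in> edges K'" "ends K' e = {U, B}" "a = U" "A \<notin> pverts B p"
      "U \<noteq> A" "U \<in> verts K'"
      using Cons.prems s by auto
    obtain b y where b: "B = {b}" "V = {y}" "path K b (?l p) y" "pverts b (?l p) \<inter> A = {}"
      "pverts B p = (\<lambda>z. {z}) ` pverts b (?l p)" "fw D (?l p) = fw D' p"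
      using Cons.IH[OF c(1,6)] by blast
    obtain x where x: "U = {x}" "x \<notin> A" "x \<in> verts K" using single[OF c(8,7)] by auto
    have "b \<notin> A" using b(4) start_in_pverts[of b "?l p"] by blast
    have e: "ends K e = {x, b}" using end_single[OF c(3), of x b] c(4) x b \<open>b \<notin> A\<close> by auto
    have "x \<notin> pverts b (?l p)" using c(2) b(5) x by auto
    moreover have "D' e = ({x}, {b}) \<longleftrightarrow> D e = (x, b)"
      using cls_single[OF x(2)] cls_single[OF \<open>b \<notin> A\<close>] by (cases "D e") (auto simp: D'_def)
    ultimately show ?case using s c b x e K' by auto
  qed
  \<comment> \<open>The two edges of the circuit at the vertex \<open>A\<close> end in
    \<open>x\<close> and \<open>x'\<close> on the contracted circuit. The even arc \<open>r\<close>
    closes the gap without affecting the parity of the length or of the count.\<close>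
  have atA: "even (fw D' (p @ [(V, e, A)]))" if cy: "cycle K' A p V e" and odd: "odd (length p)" for p V e
  proof -
    have p: "path K' A p V" "e \<in> edges K'" "ends K' e = {V, A}" "e \<notin> pedges p" using cy by (auto simp: cycle_def)
    obtain f B q where q: "p = (A, f, B) # q" using odd p(1) by (cases p) auto
    have q': "path K' B q V" "A \<notin> pverts B q" "f \<in> edges K'" "ends K' f = {A, B}" using p(1) q by auto
    obtain b y where b: "B = {b}" "V = {y}" "path K b (?l q) y" "pverts b (?l q) \<inter> A = {}"
      "fw D (?l q) = fw D' q"
      using lift[OF q'(1,2)] by blast
    have bA: "b \<notin> A" "y \<notin> A" using b(4) start_in_pverts[of b "?l q"] path_end_in_pverts[OF b(3)] by blast+
    obtain x where x: "x \<in> A" "ends K f = {x, b}" using end_A[OF q'(3), of b] q'(4) b bA by blast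
    obtain x' where x': "x' \<in> A" "ends K e = {x', y}" using end_A[OF p(2), of y] p(3) b bA by (auto simp: insert_commute)
    obtain r where r: "path K x' r x" "even (length r)" "even (fw D r)" "pverts x' r \<subseteq> A" using arc[OF x(1) x'(1)] by blast
    have ed: "f \<in> edges K" "e \<in> edges K" using q'(3) p(2) K' by auto
    have "x \<in> verts K" using path_end_in_verts[OF r(1)] .
    then have 1: "path K x ((x, f, b) # ?l q) y" using b x ed by auto
    have "path K x' (r @ (x, f, b) # ?l q) y"
      by (rule path_appendI[OF r(1) 1]) (use r(4) b(4) in auto)
    moreover have "e \<notin> pedges r" using pedge_ends_subset[OF r(1), of e] x' r(4) bA by auto
    moreover have "e \<noteq> f" "e \<notin> pedges (?l q)" using p(4) q by (auto simp: pedges_def image_image case_prod_beta)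
    ultimately have "cycle K x' (r @ (x, f, b) # ?l q) y e" using ed x' by (auto simp: cycle_def insert_commute)
    moreover have "odd (length (r @ (x, f, b) # ?l q))" using odd q r(2) by auto
    ultimately have "even (fw D ((r @ (x, f, b) # ?l q) @ [(y, e, x')]))"
      using D unfolding even_orientation_def by blast
    moreover have "D e = (y, x') \<longleftrightarrow> D' e = (V, A)" "D f = (x, b) \<longleftrightarrow> D' f = (A, B)"
    proof -
      have "cls x = A" "cls x' = A" "cls y = V" "cls b = B" using x x' bA b(1,2) by (auto simp: cls_def)
      moreover have "A \<noteq> V" "A \<noteq> B" "x \<noteq> b" "x' \<noteq> y" using bA b(1,2) x(1) x'(1) by auto
      ultimately show "D e = (y, x') \<longleftrightarrow> D' e = (V, A)" "D f = (x, b) \<longleftrightarrow> D' f = (A, B)"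
        using orientation_cases[OF or ed(2) x'(2)] orientation_cases[OF or ed(1) x(2)]
        by (elim disjE; simp add: D'_def)+
    qed
    ultimately show ?thesis using r(3) b(5) q by simp
  qed
  have "even (fw D' (p @ [(V, e, U)]))" if cy: "cycle K' U p V e" and odd: "odd (length p)" for U p V e
  proof (cases "A \<in> pverts U p")
    case False
    have p: "path K' U p V" "e \<in> edges K'" "ends K' e = {V, U}" "e \<notin> pedges p" using cy by (auto simp: cycle_def)
    obtain x y where x: "U = {x}" "V = {y}" "path K x (?l p) y" "pverts x (?l p) \<inter> A = {}"
      "fw D (?l p) = fw D' p"
      using lift[OF p(1) False] by blast
    have xA: "x \<notin> A" "y \<notin> A" using x(4) start_in_pverts[of x "?l p"] path_end_in_pverts[OF x(3)] by blast+
    have "ends K e = {y, x}" using end_single[OF p(2)] p(3) x xA by auto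
    moreover have "e \<notin> pedges (?l p)" using p(4) by (auto simp: pedges_def image_image case_prod_beta)
    ultimately have "cycle K x (?l p) y e" using x p K' by (auto simp: cycle_def)
    then have "even (fw D (?l p @ [(y, e, x)]))" using D odd unfolding even_orientation_def by auto
    moreover have "D e = (y, x) \<longleftrightarrow> D' e = (V, U)"
      using cls_single[OF xA(1)] cls_single[OF xA(2)] x by (cases "D e") (auto simp: D'_def)
    ultimately show ?thesis using x(5) by simp
  next
    case True
    show ?thesis
    proof (cases "U = A")
      case True
      then show ?thesis using atA cy odd by auto
    next
      case False
      have "\<exists>a f. (a, f, A) \<in> set p"
      proof -
        have "path K' U p V" using cy by (simp add: cycle_def)
        then have "set (U # map (snd \<circ> snd) p) = pverts U p" using path_vertex_list by metis
        then have "A \<in> set (map (snd \<circ> snd) p)" using True False by auto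
        then obtain s where "s \<in> set p" "snd (snd s) = A" by auto
        then show ?thesis by (metis prod.collapse)
      qed
      then obtain a f p1 p2 where p: "p = p1 @ (a, f, A) # p2" by (meson split_list)
      have "cycle K' A (p2 @ (V, e, U) # p1) a f" using cycle_rotate cy p by metis
      moreover have "odd (length (p2 @ (V, e, U) # p1))" using odd p by simp
      ultimately have "even (fw D' ((p2 @ (V, e, U) # p1) @ [(a, f, A)]))" by (rule atA)
      moreover have "fw D' ((p2 @ (V, e, U) # p1) @ [(a, f, A)]) = fw D' (p @ [(V, e, U)])"
        unfolding p by simp
      ultimately show ?thesis by metis
    qed
  qed
  then have "even_orientation K' D'" using or' unfolding even_orientation_def by auto
  then show ?thesis using that K'_def by auto
qed

lemma no_even_orientation_if_obstruction:
  assumes "subgraph K G"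
    "even_subdivision E1 K \<or> even_subdivision E3 K \<or>
       (\<exists>vs es. circuit K vs es \<and> odd (length es) \<and>
          (even_subdivision E1 (contract_circuit K vs es) \<or> even_subdivision E3 (contract_circuit K vs es)))"
  shows "\<not> even_orientation G d"
proof
  assume "even_orientation G d"
  then have K: "even_orientation K d" "multigraph K"
    using even_orientation_mono[of G d K] assms(1) by (auto simp: subgraph_def)
  \<comment> \<open>Stated for arbitrary types because \<open>K\<close> and its contraction have
    different vertex types.\<close>
  have E1: "\<not> even_orientation H d'" if "even_subdivision E1 H" for H :: "('x, 'y) mgraph" and d'
    by (rule notI, rule even_orientation_even_subdivision[OF multigraph_E1 that])
      (use E1_no_even_orientation in auto)
  have E3: "\<not> even_orientation H d'" if "even_subdivision E3 H" for H :: "('x, 'y) mgraph" and d'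
    by (rule notI, rule even_orientation_even_subdivision[OF multigraph_E3 that])
      (use E3_no_even_orientation in auto)
  show False using assms(2)
  proof (elim disjE exE conjE)
    fix vs es assume c: "circuit K vs es" "odd (length es)"
    obtain d' where d': "even_orientation (contract_circuit K vs es) d'"
      using even_orientation_contract_circuit[OF K(2) c K(1)] .
    show False if "even_subdivision E1 (contract_circuit K vs es)" using E1[OF that] d' by blast
    show False if "even_subdivision E3 (contract_circuit K vs es)" using E3[OF that] d' by blast
  qed (use E1 E3 K in blast)+
qed

section \<open>Even subdivisions realized by odd paths\<close>

text \<open>The vertices of \<open>F\<close> are placed by \<open>f\<close>, and the edge \<open>i\<close> of \<open>F\<close>, with ends \<open>s i\<close> and \<open>t i\<close>, becomes the
  path \<open>r i\<close>. Since the paths are odd, their union is an even subdivision of \<open>F\<close>.\<close>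

definition realizes :: "('v, 'e) mgraph \<Rightarrow> (nat, nat) mgraph \<Rightarrow> (nat \<Rightarrow> 'v) \<Rightarrow> (nat \<Rightarrow> nat) \<Rightarrow> (nat \<Rightarrow> nat) \<Rightarrow>
    (nat \<Rightarrow> ('v \<times> 'e \<times> 'v) list) \<Rightarrow> bool" where
  "realizes G F f s t r \<longleftrightarrow> finite (verts F) \<and> finite (edges F) \<and> inj_on f (verts F) \<and> f ` verts F \<subseteq> verts G \<and>
     (\<forall>i\<in>edges F. ends F i = {s i, t i} \<and> s i \<in> verts F \<and> t i \<in> verts F \<and> odd (length (r i)) \<and>
        path G (f (s i)) (r i) (f (t i)) \<and> pverts (f (s i)) (r i) \<inter> f ` verts F = {f (s i), f (t i)}) \<and>
     (\<forall>i\<in>edges F. \<forall>j\<in>edges F. i \<noteq> j \<longrightarrow> pedges (r i) \<inter> pedges (r j) = {} \<and>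
        pverts (f (s i)) (r i) \<inter> pverts (f (s j)) (r j) \<subseteq> f ` verts F)"

definition union_of :: "('v, 'e) mgraph \<Rightarrow> (nat, nat) mgraph \<Rightarrow> (nat \<Rightarrow> 'v) \<Rightarrow> (nat \<Rightarrow> nat) \<Rightarrow>
    (nat \<Rightarrow> ('v \<times> 'e \<times> 'v) list) \<Rightarrow> ('v, 'e) mgraph \<Rightarrow> bool" where
  "union_of G F f s r K \<longleftrightarrow> verts K = f ` verts F \<union> (\<Union>i\<in>edges F. pverts (f (s i)) (r i)) \<and>
     edges K = (\<Union>i\<in>edges F. pedges (r i)) \<and> (\<forall>e\<in>edges K. ends K e = ends G e)"

lemma isomorphic_if_realizes_edges:
  assumes "realizes G F f s t r" "union_of G F f s r K" "\<And>i. i \<in> edges F \<Longrightarrow> length (r i) = 1"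
  shows "isomorphic F K"
proof -
  define g where "g i = fst (snd (hd (r i)))" for i
  have r: "r i = [(f (s i), g i, f (t i))] \<and> ends G (g i) = {f (s i), f (t i)}" if "i \<in> edges F" for i
  proof -
    have "path G (f (s i)) (r i) (f (t i))" using assms(1) that by (auto simp: realizes_def)
    moreover have "length (r i) = 1" by (rule assms(3)) fact
    then obtain a e b where "r i = [(a, e, b)]"
      by (metis One_nat_def length_0_conv length_Suc_conv surj_pair)
    ultimately show ?thesis by (auto simp: g_def)
  qed
  have F: "ends F i = {s i, t i}" "s i \<in> verts F" "t i \<in> verts F" if "i \<in> edges F" for i
    using assms(1) that by (auto simp: realizes_def)
  have "verts K = f ` verts F" using assms(2) r F unfolding union_of_def by auto
  then have "bij_betw f (verts F) (verts K)" using assms(1) by (auto simp: realizes_def bij_betw_def)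
  moreover have "edges K = g ` edges F" using assms(2) r unfolding union_of_def by auto
  moreover have "inj_on g (edges F)"
  proof
    fix i j assume ij: "i \<in> edges F" "j \<in> edges F" "g i = g j"
    have "pedges (r i) \<inter> pedges (r j) \<noteq> {}" using r[OF ij(1)] r[OF ij(2)] ij(3) by auto
    then show "i = j" using assms(1) ij unfolding realizes_def by blast
  qed
  moreover have "ends K (g i) = f ` ends F i" if "i \<in> edges F" for i
    using r[OF that] F[OF that] assms(2) that \<open>edges K = g ` edges F\<close> unfolding union_of_def by auto
  ultimately show ?thesis unfolding isomorphic_def
    by (intro exI[of _ f] exI[of _ g] conjI ballI) (auto simp: bij_betw_def)
qed

text \<open>Induction on the number of edges by which the paths exceed single edges. If a path has
  length at least 3, the edge of \<open>F\<close> that it represents is subdivided twice and the new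
  vertices are placed at the first two inner vertices of the path; the union \<open>K\<close> stays
  the same.\<close>

lemma even_subdivision_if_realizes:
  assumes "realizes G F f s t r" "union_of G F f s r K"
  shows "even_subdivision F K"
  using assms
proof (induction "\<Sum>i\<in>edges F. length (r i) - 1" arbitrary: F f s t r rule: less_induct)
  case less
  have fin: "finite (verts F)" "finite (edges F)" and inj: "inj_on f (verts F)"
    and sub: "f ` verts F \<subseteq> verts G"
    using less.prems(1) by (auto simp: realizes_def)
  have R: "ends F i = {s i, t i}" "s i \<in> verts F" "t i \<in> verts F" "odd (length (r i))"
    "path G (f (s i)) (r i) (f (t i))" "pverts (f (s i)) (r i) \<inter> f ` verts F = {f (s i), f (t i)}" if "i \<in> edges F" for i
    using less.prems(1) that unfolding realizes_def by blast+
  have D: "pedges (r i) \<inter> pedges (r j) = {}" "pverts (f (s i)) (r i) \<inter> pverts (f (s j)) (r j) \<subseteq> f ` verts F"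
    if "i \<in> edges F" "j \<in> edges F" "i \<noteq> j" for i j
    using less.prems(1) that unfolding realizes_def by blast+
  show ?case
  proof (cases "\<forall>i\<in>edges F. length (r i) = 1")
    case True
    then show ?thesis using isomorphic_if_realizes_edges[OF less.prems] by (auto simp: even_subdivision_def)
  next
    case False
    then obtain i where i: "i \<in> edges F" "length (r i) \<noteq> 1" by auto
    have "length (r i) \<ge> 3" using R(4)[OF i(1)] i(2) by presburger
    then obtain s1 s2 q where "r i = s1 # s2 # q" "q \<noteq> []"
      by (cases "r i"; cases "tl (r i)"; cases "tl (tl (r i))") auto
    moreover obtain a f1 x' b f2 y' where "s1 = (a, f1, x')" "s2 = (b, f2, y')" by (cases s1, cases s2)
    ultimately have ri: "r i = (f (s i), f1, x') # (x', f2, y') # q" and qn: "q \<noteq> []"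
      using R(5)[OF i(1)] by auto
    let ?a = "f (s i)" and ?z = "f (t i)"
    have p: "path G y' q ?z" "x' \<noteq> y'" "x' \<notin> pverts y' q" "?a \<notin> pverts y' q" "?a \<noteq> x'"
      "f1 \<in> edges G" "f2 \<in> edges G" "ends G f1 = {?a, x'}" "ends G f2 = {x', y'}" "x' \<in> verts G" "?a \<in> verts G"
      using R(5)[OF i(1)] by (auto simp: ri)
    have "y' \<in> verts G" using path_start_in_verts[OF p(1)] .
    have "y' \<noteq> ?z" using path_self p(1) qn by metis
    have "x' \<noteq> ?z" using path_end_in_pverts[OF p(1)] p(3) by auto
    have "?a \<noteq> y'" using p(4) by auto
    have pv: "pverts ?a (r i) = {?a, x'} \<union> pverts y' q" by (auto simp: ri)
    have "x' \<in> pverts ?a (r i)" "y' \<in> pverts ?a (r i)" using pv start_in_pverts[of y' q] by auto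
    then have x'n: "x' \<notin> f ` verts F" and y'n: "y' \<notin> f ` verts F"
      using R(6)[OF i(1)] \<open>?a \<noteq> x'\<close> \<open>x' \<noteq> ?z\<close> \<open>y' \<noteq> ?z\<close> \<open>?a \<noteq> y'\<close> by (metis IntI insertE singletonD)+
    have qint: "pverts y' q \<inter> f ` verts F = {?z}"
    proof -
      have "pverts y' q \<inter> f ` verts F \<subseteq> {?a, ?z}" using R(6)[OF i(1)] pv by auto
      moreover have "?z \<in> f ` verts F" using R(3)[OF i(1)] by simp
      ultimately show ?thesis using p(4) path_end_in_pverts[OF p(1)] by auto
    qed
    obtain x where x: "x \<notin> verts F" using ex_new_if_finite[OF infinite_UNIV_nat fin(1)] by blast
    obtain y where y: "y \<notin> insert x (verts F)" using ex_new_if_finite[OF infinite_UNIV_nat, of "insert x (verts F)"] fin by auto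
    obtain e1 where e1: "e1 \<notin> edges F" using ex_new_if_finite[OF infinite_UNIV_nat fin(2)] by blast
    obtain e2 where e2: "e2 \<notin> insert e1 (edges F)" using ex_new_if_finite[OF infinite_UNIV_nat, of "insert e1 (edges F)"] fin by auto
    obtain e3 where e3: "e3 \<notin> insert e1 (insert e2 (edges F))"
      using ex_new_if_finite[OF infinite_UNIV_nat, of "insert e1 (insert e2 (edges F))"] fin by auto
    define F' where "F' = \<lparr>verts = verts F \<union> {x, y}, edges = (edges F - {i}) \<union> {e1, e2, e3},
           ends = (ends F)(e1 := {s i, x}, e2 := {x, y}, e3 := {y, t i})\<rparr>"
    have sd: "subdivides_twice F F'"
      unfolding subdivides_twice_def
      by (rule exI[of _ i], rule exI[of _ "s i"], rule exI[of _ "t i"], rule exI[of _ x], rule exI[of _ y],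
          rule exI[of _ e1], rule exI[of _ e2], rule exI[of _ e3])
        (use i R x y e1 e2 e3 in \<open>auto simp: F'_def\<close>)
    define f' where "f' = f(x := x', y := y')"
    define s' where "s' = s(e1 := s i, e2 := x, e3 := y)"
    define t' where "t' = t(e1 := x, e2 := y, e3 := t i)"
    define r' where "r' = r(e1 := [(?a, f1, x')], e2 := [(x', f2, y')], e3 := q)"
    have old: "s' j = s j" "t' j = t j" "r' j = r j" "ends F' j = ends F j" if "j \<in> edges F" for j
      using that e1 e2 e3 by (auto simp: s'_def t'_def r'_def F'_def)
    have new: "s' e1 = s i" "s' e2 = x" "s' e3 = y" "t' e1 = x" "t' e2 = y" "t' e3 = t i"
      "r' e1 = [(?a, f1, x')]" "r' e2 = [(x', f2, y')]" "r' e3 = q"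
      using e1 e2 e3 by (auto simp: s'_def t'_def r'_def)
    have f': "f' v = f v" if "v \<in> verts F" for v using that x y by (auto simp: f'_def)
    have f'xy: "f' x = x'" "f' y = y'" using y by (auto simp: f'_def)
    have im: "f' ` verts F' = f ` verts F \<union> {x', y'}" using f' f'xy by (auto simp: F'_def)
    have E': "edges F' = (edges F - {i}) \<union> {e1, e2, e3}" and V': "verts F' = verts F \<union> {x, y}"
      by (simp_all add: F'_def)
    define pv' where "pv' j = pverts (f' (s' j)) (r' j)" for j
    have pvold: "pv' j = pverts (f (s j)) (r j)" if "j \<in> edges F" for j
      using old[OF that] f' R(2)[OF that] by (simp add: pv'_def)
    have pvnew: "pv' e1 = {?a, x'}" "pv' e2 = {x', y'}" "pv' e3 = pverts y' q"
      using new f'[OF R(2)[OF i(1)]] f'xy by (auto simp: pv'_def)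
    have sub_old: "pv' j \<subseteq> pverts ?a (r i)" "pedges (r' j) \<subseteq> pedges (r i)" if "j \<in> {e1, e2, e3}" for j
      using that pvnew pv new ri start_in_pverts[of y' q] by auto
    have oldnew: "pedges (r' j) \<inter> pedges (r' k) = {} \<and> pv' j \<inter> pv' k \<subseteq> f' ` verts F'"
      if "j \<in> edges F - {i}" "k \<in> {e1, e2, e3}" for j k
    proof -
      have "j \<in> edges F" "j \<noteq> i" using that by auto
      note j = this
      have "pedges (r' j) \<inter> pedges (r i) = {}" using D(1)[OF j(1) i(1) j(2)] old(3)[OF j(1)] by simp
      moreover have "pv' j \<inter> pverts ?a (r i) \<subseteq> f ` verts F" using D(2)[OF j(1) i(1) j(2)] pvold[OF j(1)] by simp
      ultimately show ?thesis using sub_old[OF that(2)] im by auto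
    qed
    have dq: "f1 \<notin> pedges q" "f2 \<notin> pedges q" "f1 \<noteq> f2"
      using path_distinct_pedges[OF R(5)[OF i(1)]] by (auto simp: ri pedges_def)
    have newnew: "pedges (r' j) \<inter> pedges (r' k) = {} \<and> pv' j \<inter> pv' k \<subseteq> f' ` verts F'"
      if "j \<in> {e1, e2, e3}" "k \<in> {e1, e2, e3}" "j \<noteq> k" for j k
    proof -
      have "pv' e1 \<inter> pv' e2 \<subseteq> f' ` verts F'" "pv' e1 \<inter> pv' e3 \<subseteq> f' ` verts F'" "pv' e2 \<inter> pv' e3 \<subseteq> f' ` verts F'"
        unfolding pvnew im using p by auto
      moreover have "pedges (r' e1) \<inter> pedges (r' e2) = {}" "pedges (r' e1) \<inter> pedges (r' e3) = {}"
        "pedges (r' e2) \<inter> pedges (r' e3) = {}" unfolding new using dq by auto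
      ultimately show ?thesis using that by (elim insertE emptyE; simp add: Int_commute)
    qed
    have real: "realizes G F' f' s' t' r'"
      unfolding realizes_def
    proof (intro conjI ballI impI)
      show "finite (verts F')" "finite (edges F')" using fin E' V' by auto
      show "f' ` verts F' \<subseteq> verts G" using im sub \<open>x' \<in> verts G\<close> \<open>y' \<in> verts G\<close> by auto
      show "inj_on f' (verts F')"
      proof -
        have "inj_on f' (verts F)" using inj f' by (simp add: inj_on_def)
        moreover have "x' \<notin> f' ` verts F" "y' \<notin> f' ` verts F" using x'n y'n f' by auto
        ultimately have "inj_on f' (insert x (insert y (verts F)))"
          unfolding inj_on_insert f'xy using p(2) f'xy by auto
        then show ?thesis using V' by simp
      qed
    next
      fix j assume j: "j \<in> edges F'"
      have "ends F' j = {s' j, t' j} \<and> s' j \<in> verts F' \<and> t' j \<in> verts F' \<and> odd (length (r' j)) \<and>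
        path G (f' (s' j)) (r' j) (f' (t' j)) \<and> pv' j \<inter> f' ` verts F' = {f' (s' j), f' (t' j)}"
      proof (cases "j \<in> edges F")
        case True
        then have ji: "j \<noteq> i" using j E' e1 e2 e3 by auto
        have "pv' j \<inter> {x', y'} \<subseteq> f ` verts F"
          using D(2)[OF True i(1) ji] pvold[OF True] pv start_in_pverts[of y' q] by auto
        then have "pv' j \<inter> {x', y'} = {}" using x'n y'n by auto
        then have "pv' j \<inter> f' ` verts F' = {f (s j), f (t j)}" using im R(6)[OF True] pvold[OF True] by auto
        then show ?thesis using R[OF True] old[OF True] f' V' by auto
      next
        case False
        then have "j \<in> {e1, e2, e3}" using j E' by auto
        then show ?thesis
        proof (elim insertE emptyE)
          assume "j = e1"
          then show ?thesis using new f'[OF R(2)[OF i(1)]] f'xy R(2)[OF i(1)] V' p im pvnew e1 e2 e3 \<open>?a \<noteq> y'\<close> R(2)[OF i(1)]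
            by (auto simp: F'_def)
        next
          assume "j = e2"
          then show ?thesis using new f'xy V' p im pvnew e1 e2 e3 \<open>y' \<in> verts G\<close> by (auto simp: F'_def)
        next
          assume "j = e3"
          moreover have "pverts y' q \<inter> f' ` verts F' = {y', ?z}" using qint im p(3) by auto
          moreover have "odd (length q)" using R(4)[OF i(1)] ri by auto
          ultimately show ?thesis using new f'[OF R(3)[OF i(1)]] f'xy R(3)[OF i(1)] V' p(1) pvnew e1 e2 e3
            by (auto simp: F'_def)
        qed
      qed
      then show "ends F' j = {s' j, t' j}" "s' j \<in> verts F'" "t' j \<in> verts F'" "odd (length (r' j))"
        "path G (f' (s' j)) (r' j) (f' (t' j))" "pverts (f' (s' j)) (r' j) \<inter> f' ` verts F' = {f' (s' j), f' (t' j)}"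
        unfolding pv'_def by blast+
    next
      fix j k assume jk: "j \<in> edges F'" "k \<in> edges F'" "j \<noteq> k"
      have "pedges (r' j) \<inter> pedges (r' k) = {} \<and> pv' j \<inter> pv' k \<subseteq> f' ` verts F'"
      proof (cases "j \<in> {e1, e2, e3}"; cases "k \<in> {e1, e2, e3}")
        assume a: "j \<notin> {e1, e2, e3}" "k \<notin> {e1, e2, e3}"
        then have "j \<in> edges F" "k \<in> edges F" using jk E' by auto
        then show ?thesis using D[of j k] old(3) pvold jk(3) im by auto
      next
        assume a: "j \<in> {e1, e2, e3}" "k \<notin> {e1, e2, e3}"
        then have "k \<in> edges F - {i}" using jk E' by auto
        then show ?thesis using oldnew[of k j] a by blast
      next
        assume a: "j \<notin> {e1, e2, e3}" "k \<in> {e1, e2, e3}"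
        then have "j \<in> edges F - {i}" using jk E' by auto
        then show ?thesis using oldnew[of j k] a by blast
      next
        assume "j \<in> {e1, e2, e3}" "k \<in> {e1, e2, e3}"
        then show ?thesis using newnew jk(3) by blast
      qed
      then show "pedges (r' j) \<inter> pedges (r' k) = {}"
        "pverts (f' (s' j)) (r' j) \<inter> pverts (f' (s' k)) (r' k) \<subseteq> f' ` verts F'"
        unfolding pv'_def by auto
    qed
    have un: "union_of G F' f' s' r' K"
    proof -
      have "(\<Union>j\<in>edges F'. pedges (r' j)) = (\<Union>j\<in>edges F - {i}. pedges (r' j)) \<union> (pedges (r' e1) \<union> pedges (r' e2) \<union> pedges (r' e3))"
        unfolding E' by auto
      also have "(\<Union>j\<in>edges F - {i}. pedges (r' j)) = (\<Union>j\<in>edges F - {i}. pedges (r j))" using old(3) by auto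
      also have "pedges (r' e1) \<union> pedges (r' e2) \<union> pedges (r' e3) = pedges (r i)" using new ri by auto
      also have "(\<Union>j\<in>edges F - {i}. pedges (r j)) \<union> pedges (r i) = (\<Union>j\<in>edges F. pedges (r j))" using i(1) by auto
      finally have e: "(\<Union>j\<in>edges F'. pedges (r' j)) = (\<Union>j\<in>edges F. pedges (r j))" .
      have "f' ` verts F' \<union> (\<Union>j\<in>edges F'. pv' j) =
          f ` verts F \<union> (\<Union>j\<in>edges F - {i}. pv' j) \<union> ({x', y'} \<union> pv' e1 \<union> pv' e2 \<union> pv' e3)"
        unfolding E' im by auto
      also have "(\<Union>j\<in>edges F - {i}. pv' j) = (\<Union>j\<in>edges F - {i}. pverts (f (s j)) (r j))" using pvold by auto
      also have "{x', y'} \<union> pv' e1 \<union> pv' e2 \<union> pv' e3 = pverts ?a (r i)" using pvnew pv start_in_pverts[of y' q] by auto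
      also have "f ` verts F \<union> (\<Union>j\<in>edges F - {i}. pverts (f (s j)) (r j)) \<union> pverts ?a (r i) =
        f ` verts F \<union> (\<Union>j\<in>edges F. pverts (f (s j)) (r j))" using i(1) by auto
      finally show ?thesis using e less.prems(2) unfolding union_of_def pv'_def by metis
    qed
    have "(\<Sum>j\<in>edges F'. length (r' j) - 1) < (\<Sum>j\<in>edges F. length (r j) - 1)"
    proof -
      have "(\<Sum>j\<in>edges F'. length (r' j) - 1) =
          (\<Sum>j\<in>edges F - {i}. length (r' j) - 1) + (\<Sum>j\<in>{e1, e2, e3}. length (r' j) - 1)"
        unfolding E' by (rule sum.union_disjoint) (use fin e1 e2 e3 in auto)
      also have "(\<Sum>j\<in>edges F - {i}. length (r' j) - 1) = (\<Sum>j\<in>edges F - {i}. length (r j) - 1)"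
        using old(3) by (intro sum.cong) auto
      also have "(\<Sum>j\<in>{e1, e2, e3}. length (r' j) - 1) = length q - 1" using new e2 e3 by auto
      also have "(\<Sum>j\<in>edges F - {i}. length (r j) - 1) + (length q - 1) < (\<Sum>j\<in>edges F. length (r j) - 1)"
        using sum.remove[OF fin(2) i(1), of "\<lambda>j. length (r j) - 1"] ri qn by auto
      finally show ?thesis .
    qed
    then have "even_subdivision F' K" using less.hyps real un by blast
    then show ?thesis using sd unfolding even_subdivision_def by (meson converse_rtranclp_into_rtranclp)
  qed
qed

lemma subgraph_trans: "subgraph K H \<Longrightarrow> subgraph H G \<Longrightarrow> subgraph K G"
  unfolding subgraph_def by (metis order_trans subsetD)

definition obstructed :: "('v, 'e) mgraph \<Rightarrow> bool" where
  "obstructed G \<longleftrightarrow> (\<exists>K. subgraph K G \<and>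
            (even_subdivision E1 K \<or> even_subdivision E3 K \<or>
             (\<exists>vs es. circuit K vs es \<and> odd (length es) \<and>
                (even_subdivision E1 (contract_circuit K vs es) \<or>
                 even_subdivision E3 (contract_circuit K vs es)))))"

lemma subgraph_restrict:
  assumes "multigraph G" "S \<subseteq> verts G" "X \<subseteq> edges G" "\<And>e. e \<in> X \<Longrightarrow> ends G e \<subseteq> S"
  shows "subgraph \<lparr>verts = S, edges = X, ends = ends G\<rparr> G"
  using assms finite_subset unfolding subgraph_def multigraph_def by (auto simp: subset_iff intro: finite_subset)

lemma realizes_subgraph:
  assumes "multigraph G" "realizes G F f s t r"
  obtains K where "subgraph K G" "even_subdivision F K"
proof -
  define K where "K = \<lparr>verts = f ` verts F \<union> (\<Union>i\<in>edges F. pverts (f (s i)) (r i)),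
    edges = (\<Union>i\<in>edges F. pedges (r i)), ends = ends G\<rparr>"
  have p: "path G (f (s i)) (r i) (f (t i))" if "i \<in> edges F" for i using assms(2) that by (auto simp: realizes_def)
  have "subgraph K G"
    unfolding K_def
  proof (rule subgraph_restrict[OF assms(1)])
    show "f ` verts F \<union> (\<Union>i\<in>edges F. pverts (f (s i)) (r i)) \<subseteq> verts G"
      using assms(2) pverts_subset[OF p] by (auto simp: realizes_def)
    show "(\<Union>i\<in>edges F. pedges (r i)) \<subseteq> edges G" using pedges_subset[OF p] by auto
    show "ends G e \<subseteq> f ` verts F \<union> (\<Union>i\<in>edges F. pverts (f (s i)) (r i))" if "e \<in> (\<Union>i\<in>edges F. pedges (r i))" for e
      using that pedge_ends_subset[OF p] by blast
  qed
  moreover have "union_of G F f s r K" by (simp add: union_of_def K_def)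
  ultimately show ?thesis using that even_subdivision_if_realizes assms(2) by blast
qed

lemma realizes_E1:
  assumes "a \<noteq> b" "path G a p1 b" "path G a p2 b" "path G a p3 b"
    "odd (length p1)" "odd (length p2)" "odd (length p3)"
    "pverts a p1 \<inter> pverts a p2 = {a, b}" "pverts a p1 \<inter> pverts a p3 = {a, b}" "pverts a p2 \<inter> pverts a p3 = {a, b}"
    "pedges p1 \<inter> pedges p2 = {}" "pedges p1 \<inter> pedges p3 = {}" "pedges p2 \<inter> pedges p3 = {}"
  shows "realizes G E1 (\<lambda>n. if n = 0 then a else b) (\<lambda>_. 0) (\<lambda>_. 1) (\<lambda>i. [p1, p2, p3] ! i)"
proof -
  have im: "(\<lambda>n::nat. if n = 0 then a else b) ` {0, 1} = {a, b}" by auto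
  show ?thesis unfolding realizes_def
  proof (intro conjI ballI impI)
    show "inj_on (\<lambda>n. if n = 0 then a else b) (verts E1)" using assms(1) by (auto simp: E1_def inj_on_def)
    show "(\<lambda>n. if n = 0 then a else b) ` verts E1 \<subseteq> verts G"
      using path_start_in_verts[OF assms(2)] path_end_in_verts[OF assms(2)] by auto
  qed (use assms path_end_in_pverts[OF assms(2)] path_end_in_pverts[OF assms(3)] path_end_in_pverts[OF assms(4)]
      in \<open>auto simp: E1_def numeral_2_eq_2\<close>)
qed

lemma theta_obstructed:
  assumes "multigraph G" "a \<noteq> b" "path G a p1 b" "path G a p2 b" "path G a p3 b"
    "odd (length p1)" "odd (length p2)" "odd (length p3)"
    "pverts a p1 \<inter> pverts a p2 = {a, b}" "pverts a p1 \<inter> pverts a p3 = {a, b}" "pverts a p2 \<inter> pverts a p3 = {a, b}"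
    "pedges p1 \<inter> pedges p2 = {}" "pedges p1 \<inter> pedges p3 = {}" "pedges p2 \<inter> pedges p3 = {}"
  shows "obstructed G"
  using realizes_subgraph[OF assms(1) realizes_E1[OF assms(2-)]] unfolding obstructed_def by metis

section \<open>Tetrahedra\<close>

text \<open>A subdivision of \<open>K4\<close>: \<open>x\<close> is joined by \<open>P1\<close>, \<open>P2\<close>, \<open>P3\<close> to the vertices \<open>c\<close>, \<open>w\<close>, \<open>y\<close> of a circuit with the
  arcs \<open>g1\<close>, \<open>g2\<close>, \<open>g3\<close>.\<close>

definition apex :: "('v, 'e) mgraph \<Rightarrow> 'v \<Rightarrow> 'v \<Rightarrow> 'v \<Rightarrow> 'v \<Rightarrow> ('v \<times> 'e \<times> 'v) list \<Rightarrow> ('v \<times> 'e \<times> 'v) list \<Rightarrow>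
    ('v \<times> 'e \<times> 'v) list \<Rightarrow> ('v \<times> 'e \<times> 'v) list \<Rightarrow> ('v \<times> 'e \<times> 'v) list \<Rightarrow> ('v \<times> 'e \<times> 'v) list \<Rightarrow> bool" where
  "apex G x c w y P1 P2 P3 g1 g2 g3 \<longleftrightarrow> path G x P1 c \<and> path G x P2 w \<and> path G x P3 y \<and>
     path G c g1 w \<and> path G w g2 y \<and> path G y g3 c \<and> distinct [x, c, w, y] \<and>
     pverts x P1 \<inter> pverts x P2 = {x} \<and> pverts x P2 \<inter> pverts x P3 = {x} \<and> pverts x P3 \<inter> pverts x P1 = {x} \<and>
     pverts c g1 \<inter> pverts w g2 = {w} \<and> pverts w g2 \<inter> pverts y g3 = {y} \<and> pverts y g3 \<inter> pverts c g1 = {c} \<and>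
     pverts x P1 \<inter> (pverts c g1 \<union> pverts w g2 \<union> pverts y g3) = {c} \<and>
     pverts x P2 \<inter> (pverts c g1 \<union> pverts w g2 \<union> pverts y g3) = {w} \<and>
     pverts x P3 \<inter> (pverts c g1 \<union> pverts w g2 \<union> pverts y g3) = {y}"

text \<open>The parity lemmas below single out the vertex \<open>c\<close>; rotation supplies them
  for \<open>w\<close> and \<open>y\<close>.\<close>

lemma apex_rotate: "apex G x c w y P1 P2 P3 g1 g2 g3 \<Longrightarrow> apex G x w y c P2 P3 P1 g2 g3 g1"
  unfolding apex_def by (simp add: Un_ac; blast)

lemma apexD:
  assumes "apex G x c w y P1 P2 P3 g1 g2 g3"
  shows "path G x P1 c" "path G x P2 w" "path G x P3 y" "path G c g1 w" "path G w g2 y" "path G y g3 c"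
    "x \<noteq> c" "x \<noteq> w" "x \<noteq> y" "c \<noteq> w" "c \<noteq> y" "w \<noteq> y"
    "pverts x P1 \<inter> pverts x P2 = {x}" "pverts x P2 \<inter> pverts x P3 = {x}" "pverts x P1 \<inter> pverts x P3 = {x}"
    "pverts c g1 \<inter> pverts w g2 = {w}" "pverts w g2 \<inter> pverts y g3 = {y}" "pverts c g1 \<inter> pverts y g3 = {c}"
    "pverts x P1 \<inter> pverts c g1 = {c}" "pverts x P1 \<inter> pverts w g2 = {}" "pverts x P1 \<inter> pverts y g3 = {c}"
    "pverts x P2 \<inter> pverts c g1 = {w}" "pverts x P2 \<inter> pverts w g2 = {w}" "pverts x P2 \<inter> pverts y g3 = {}"
    "pverts x P3 \<inter> pverts c g1 = {}" "pverts x P3 \<inter> pverts w g2 = {y}" "pverts x P3 \<inter> pverts y g3 = {y}"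
proof -
  show p: "path G x P1 c" "path G x P2 w" "path G x P3 y" "path G c g1 w" "path G w g2 y" "path G y g3 c"
    and d: "x \<noteq> c" "x \<noteq> w" "x \<noteq> y" "c \<noteq> w" "c \<noteq> y" "w \<noteq> y"
    and "pverts x P1 \<inter> pverts x P2 = {x}" "pverts x P2 \<inter> pverts x P3 = {x}" "pverts x P1 \<inter> pverts x P3 = {x}"
    and s: "pverts c g1 \<inter> pverts w g2 = {w}" "pverts w g2 \<inter> pverts y g3 = {y}" "pverts c g1 \<inter> pverts y g3 = {c}"
    using assms unfolding apex_def by (simp_all add: Int_commute)
  have t: "pverts x P1 \<inter> (pverts c g1 \<union> pverts w g2 \<union> pverts y g3) = {c}"
     "pverts x P2 \<inter> (pverts c g1 \<union> pverts w g2 \<union> pverts y g3) = {w}"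
     "pverts x P3 \<inter> (pverts c g1 \<union> pverts w g2 \<union> pverts y g3) = {y}"
    using assms unfolding apex_def by simp_all
  have m: "c \<in> pverts c g1" "w \<in> pverts c g1" "w \<in> pverts w g2" "y \<in> pverts w g2" "y \<in> pverts y g3" "c \<in> pverts y g3"
    using p path_end_in_pverts start_in_pverts by metis+
  have n: "c \<notin> pverts w g2" "w \<notin> pverts y g3" "y \<notin> pverts c g1"
    using s m d by (metis IntI singletonD)+
  have sel: "X \<inter> Y = (if z \<in> Y then {z} else {})" if "X \<inter> Z = {z}" "Y \<subseteq> Z" for X Y Z :: "'a set" and z
    using that by auto
  show "pverts x P1 \<inter> pverts c g1 = {c}" "pverts x P1 \<inter> pverts w g2 = {}" "pverts x P1 \<inter> pverts y g3 = {c}"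
    by (subst sel[OF t(1)]; use m n in auto)+
  show "pverts x P2 \<inter> pverts c g1 = {w}" "pverts x P2 \<inter> pverts w g2 = {w}" "pverts x P2 \<inter> pverts y g3 = {}"
    by (subst sel[OF t(2)]; use m n in auto)+
  show "pverts x P3 \<inter> pverts c g1 = {}" "pverts x P3 \<inter> pverts w g2 = {y}" "pverts x P3 \<inter> pverts y g3 = {y}"
    by (subst sel[OF t(3)]; use m n in auto)+
qed

text \<open>Without the arc \<open>g2\<close> there remain three odd paths from \<open>x\<close> to
  \<open>c\<close>: \<open>P1\<close>, \<open>P2\<close> followed by \<open>g1\<close> backwards,
  and \<open>P3\<close> followed by \<open>g3\<close>.\<close>

lemma apex_theta:
  assumes "multigraph G" "apex G x c w y P1 P2 P3 g1 g2 g3"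
    "odd (length P1)" "odd (length P2 + length g1)" "odd (length P3 + length g3)"
  shows "obstructed G"
proof -
  note D = apexD[OF assms(2)]
  note p = D(1-6) and d = D(7-12) and s = D(13-)
  note pg1 = path_prev[OF p(4)] pverts_prev[OF p(4)]
  have ew: "w \<in> pverts c g1" using path_end_in_pverts[OF p(4)] .
  have ec: "c \<in> pverts y g3" using path_end_in_pverts[OF p(6)] .
  have 2: "path G x (P2 @ prev g1) c" by (rule path_appendI[OF p(2) pg1(1)]) (use pg1 s in auto)
  have 3: "path G x (P3 @ g3) c" by (rule path_appendI[OF p(3) p(6)]) (use s in auto)
  have v2: "pverts x (P2 @ prev g1) = pverts x P2 \<union> pverts c g1" using pverts_append[OF p(2)] pg1 by auto
  have v3: "pverts x (P3 @ g3) = pverts x P3 \<union> pverts y g3" using pverts_append[OF p(3)] by auto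
  have i12: "pverts x P1 \<inter> pverts x (P2 @ prev g1) = {x, c}" and i13: "pverts x P1 \<inter> pverts x (P3 @ g3) = {x, c}"
    and i23: "pverts x (P2 @ prev g1) \<inter> pverts x (P3 @ g3) = {x, c}"
    unfolding v2 v3 Int_Un_distrib Int_Un_distrib2 using s by (auto simp: Int_commute)
  have w1: "w \<notin> pverts x P1" using s(7) ew d by (metis IntI singletonD)
  have w2: "w \<notin> pverts x (P3 @ g3)" unfolding v3 using s(6,13) ew d by (metis IntI UnE singletonD empty_iff)
  have y1: "y \<notin> pverts x P1" using s(9) start_in_pverts[of y g3] d by (metis IntI singletonD)
  have n: "P1 \<noteq> P2 @ prev g1" "P1 \<noteq> P3 @ g3" "P2 @ prev g1 \<noteq> P3 @ g3"
    using v2 v3 w1 w2 y1 ew start_in_pverts[of y g3] by (metis UnCI)+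
  show ?thesis
    by (rule theta_obstructed[OF assms(1) d(1) p(1) 2 3])
      (use assms i12 i13 i23 parallel_paths_edge_disjoint[OF p(1) 2 i12 n(1)]
        parallel_paths_edge_disjoint[OF p(1) 3 i13 n(2)] parallel_paths_edge_disjoint[OF 2 3 i23 n(3)] in auto)
qed

text \<open>The even paths \<open>P2\<close>, \<open>g1\<close>, \<open>g3\<close>,
  \<open>P3\<close> form the circuit through \<open>x\<close>, \<open>w\<close>, \<open>c\<close>,
  \<open>y\<close> whose edges are subdivided in \<open>E3\<close>; the odd paths \<open>P1\<close>
  and \<open>g2\<close> are its diagonals. An even path is one edge followed by an odd path, and the
  vertex in between is the subdividing one.\<close>

lemma apex_E3:
  assumes "multigraph G" "apex G x c w y P1 P2 P3 g1 g2 g3"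
    "odd (length P1)" "even (length P2)" "even (length P3)" "even (length g1)" "odd (length g2)" "even (length g3)"
  shows "obstructed G"
proof -
  note D = apexD[OF assms(2)]
  note p = D(1-6) and d = D(7-12) and s = D(13-)
  define A where "A = pverts x P1"
  define B where "B = pverts w g2"
  define C0 where "C0 = pverts x P2"
  define C1 where "C1 = pverts c g1"
  define C2 where "C2 = pverts y g3"
  define C3 where "C3 = pverts x P3"
  note defs = A_def B_def C0_def C1_def C2_def C3_def
  have mem: "x \<in> A" "c \<in> A" "w \<in> B" "y \<in> B" "x \<in> C0" "w \<in> C0" "c \<in> C1" "w \<in> C1" "y \<in> C2" "c \<in> C2" "x \<in> C3" "y \<in> C3"
    unfolding defs using p path_end_in_pverts start_in_pverts by metis+
  have int: "A \<inter> B = {}" "A \<inter> C0 = {x}" "A \<inter> C1 = {c}" "A \<inter> C2 = {c}" "A \<inter> C3 = {x}"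
    "B \<inter> C0 = {w}" "B \<inter> C1 = {w}" "B \<inter> C2 = {y}" "B \<inter> C3 = {y}"
    "C0 \<inter> C1 = {w}" "C0 \<inter> C2 = {}" "C0 \<inter> C3 = {x}" "C1 \<inter> C2 = {c}" "C1 \<inter> C3 = {}" "C2 \<inter> C3 = {y}"
    unfolding defs using s by (simp_all add: Int_commute)
  note int_comm = int[THEN trans[OF Int_commute]]
  have split: "\<exists>f m r. q = (a, f, m) # r \<and> odd (length r) \<and> path G m r b \<and> f \<in> edges G \<and> ends G f = {a, m} \<and> a \<in> verts G \<and> m \<in> verts G \<and>
      m \<noteq> a \<and> m \<noteq> b \<and> a \<notin> pverts m r \<and> pverts a q = insert a (pverts m r) \<and> m \<in> pverts a q \<and> f \<notin> pedges r"
    if qq: "path G a q b" "a \<noteq> b" "even (length q)" for a q b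
  proof -
    obtain f m r where q: "q = (a, f, m) # r" using qq by (cases q) auto
    have r: "path G m r b" "a \<notin> pverts m r" using qq(1) q by auto
    have "m \<noteq> b" using path_self[of G m r] r(1) qq(3) q by auto
    moreover have "f \<notin> pedges r" using path_distinct_pedges[OF qq(1)] by (auto simp: q pedges_def)
    moreover have "m \<noteq> a" using r(2) by auto
    ultimately show ?thesis using q r qq path_start_in_verts[OF r(1)] by auto
  qed
  obtain f0 m0 q0 where q0: "P2 = (x, f0, m0) # q0" "odd (length q0)" "path G m0 q0 w" "f0 \<in> edges G" "ends G f0 = {x, m0}"
    "x \<in> verts G" "m0 \<in> verts G" "m0 \<noteq> x" "m0 \<noteq> w" "x \<notin> pverts m0 q0" "C0 = insert x (pverts m0 q0)" "m0 \<in> C0" "f0 \<notin> pedges q0"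
    using split[OF p(2) d(2) assms(4)] unfolding defs[symmetric] by blast
  have g1: "path G w (prev g1) c" "even (length (prev g1))" "pverts w (prev g1) = C1"
    using path_prev[OF p(4)] assms pverts_prev[OF p(4)] by (auto simp: defs)
  obtain f1 m1 q1 where q1: "prev g1 = (w, f1, m1) # q1" "odd (length q1)" "path G m1 q1 c" "f1 \<in> edges G" "ends G f1 = {w, m1}"
    "w \<in> verts G" "m1 \<in> verts G" "m1 \<noteq> w" "m1 \<noteq> c" "w \<notin> pverts m1 q1" "C1 = insert w (pverts m1 q1)" "m1 \<in> C1" "f1 \<notin> pedges q1"
    using split[OF g1(1) d(4)[symmetric] g1(2)] unfolding g1(3) by blast
  have g3: "path G c (prev g3) y" "even (length (prev g3))" "pverts c (prev g3) = C2"
    using path_prev[OF p(6)] assms pverts_prev[OF p(6)] by (auto simp: defs)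
  obtain f2 m2 q2 where q2: "prev g3 = (c, f2, m2) # q2" "odd (length q2)" "path G m2 q2 y" "f2 \<in> edges G" "ends G f2 = {c, m2}"
    "c \<in> verts G" "m2 \<in> verts G" "m2 \<noteq> c" "m2 \<noteq> y" "c \<notin> pverts m2 q2" "C2 = insert c (pverts m2 q2)" "m2 \<in> C2" "f2 \<notin> pedges q2"
    using split[OF g3(1) d(5) g3(2)] unfolding g3(3) by blast
  have P3: "path G y (prev P3) x" "even (length (prev P3))" "pverts y (prev P3) = C3"
    using path_prev[OF p(3)] assms pverts_prev[OF p(3)] by (auto simp: defs)
  obtain f3 m3 q3 where q3: "prev P3 = (y, f3, m3) # q3" "odd (length q3)" "path G m3 q3 x" "f3 \<in> edges G" "ends G f3 = {y, m3}"
    "y \<in> verts G" "m3 \<in> verts G" "m3 \<noteq> y" "m3 \<noteq> x" "y \<notin> pverts m3 q3" "C3 = insert y (pverts m3 q3)" "m3 \<in> C3" "f3 \<notin> pedges q3"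
    using split[OF P3(1) d(3)[symmetric] P3(2)] unfolding P3(3) by blast
  define f :: "nat \<Rightarrow> _" where "f i = [x, w, c, y, m0, m1, m2, m3] ! i" for i
  define ss :: "nat \<Rightarrow> nat" where "ss i = [0, 4, 1, 5, 2, 6, 3, 7, 0, 1] ! i" for i
  define tt :: "nat \<Rightarrow> nat" where "tt i = [4, 1, 5, 2, 6, 3, 7, 0, 2, 3] ! i" for i
  define r :: "nat \<Rightarrow> _" where "r i = [[(x, f0, m0)], q0, [(w, f1, m1)], q1, [(c, f2, m2)], q2, [(y, f3, m3)], q3, P1, g2] ! i" for i
  \<comment> \<open>The ten paths \<open>r i\<close> lie in the six paths of the tetrahedron,
    \<open>big i\<close> being the index; \<open>S\<close> and \<open>E\<close> list the vertex and
    edge sets of the six. Disjointness is inherited from these, except between the two pieces of one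
    split path.\<close>
  define big :: "nat \<Rightarrow> nat" where "big i = [0, 0, 1, 1, 2, 2, 3, 3, 4, 5] ! i" for i
  define S :: "nat \<Rightarrow> _" where "S k = [C0, C1, C2, C3, A, B] ! k" for k
  define E :: "nat \<Rightarrow> _" where "E k = [pedges P2, pedges g1, pedges g3, pedges P3, pedges P1, pedges g2] ! k" for k
  have eE3: "edges E3 = {0, 1, 2, 3, 4, 5, 6, 7, 8, 9}" by (auto simp: E3_def)
  have vE3: "verts E3 = {0, 1, 2, 3, 4, 5, 6, 7}" by (auto simp: E3_def)
  have im: "f ` verts E3 = {x, w, c, y, m0, m1, m2, m3}" unfolding vE3 by (simp add: f_def)
  have n: "w \<notin> A" "y \<notin> A" "x \<notin> B" "c \<notin> B" "c \<notin> C0" "y \<notin> C0" "x \<notin> C1" "y \<notin> C1" "x \<notin> C2" "w \<notin> C2"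
    "w \<notin> C3" "c \<notin> C3"
    using int mem d by (metis IntI singletonD empty_iff)+
  have m: "m0 \<notin> {x, w, c, y}" "m1 \<notin> {x, w, c, y}" "m2 \<notin> {x, w, c, y}" "m3 \<notin> {x, w, c, y}"
    using n q0(8,9,12) q1(8,9,12) q2(8,9,12) q3(8,9,12) by (metis insertE emptyE)+
  have mS: "m0 \<notin> A \<union> B \<union> C1 \<union> C2 \<union> C3" "m1 \<notin> A \<union> B \<union> C0 \<union> C2 \<union> C3"
    "m2 \<notin> A \<union> B \<union> C0 \<union> C1 \<union> C3" "m3 \<notin> A \<union> B \<union> C0 \<union> C1 \<union> C2"
  proof -
    have *: "z \<notin> Y" if "X \<inter> Y \<subseteq> {x, w, c, y}" "z \<in> X" "z \<notin> {x, w, c, y}" for X Y z using that by blast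
    show "m0 \<notin> A \<union> B \<union> C1 \<union> C2 \<union> C3"
      unfolding Un_iff de_Morgan_disj by (intro conjI; rule *[OF _ q0(12) m(1)]; simp add: int int_comm)
    show "m1 \<notin> A \<union> B \<union> C0 \<union> C2 \<union> C3"
      unfolding Un_iff de_Morgan_disj by (intro conjI; rule *[OF _ q1(12) m(2)]; simp add: int int_comm)
    show "m2 \<notin> A \<union> B \<union> C0 \<union> C1 \<union> C3"
      unfolding Un_iff de_Morgan_disj by (intro conjI; rule *[OF _ q2(12) m(3)]; simp add: int int_comm)
    show "m3 \<notin> A \<union> B \<union> C0 \<union> C1 \<union> C2"
      unfolding Un_iff de_Morgan_disj by (intro conjI; rule *[OF _ q3(12) m(4)]; simp add: int int_comm)
  qed
  have end_in: "w \<in> pverts m0 q0" "c \<in> pverts m1 q1" "y \<in> pverts m2 q2" "x \<in> pverts m3 q3"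
    using path_end_in_pverts q0(3) q1(3) q2(3) q3(3) by metis+
  define pv where "pv i = pverts (f (ss i)) (r i)" for i
  have pv: "pv 0 = {x, m0}" "pv 1 = pverts m0 q0" "pv 2 = {w, m1}" "pv 3 = pverts m1 q1" "pv 4 = {c, m2}" "pv 5 = pverts m2 q2"
    "pv 6 = {y, m3}" "pv 7 = pverts m3 q3" "pv 8 = A" "pv 9 = B"
    by (simp_all add: pv_def f_def ss_def r_def defs)
  have pvS: "pv i \<subseteq> S (big i)" if "i \<in> edges E3" for i
    using that unfolding eE3 by (elim insertE emptyE; simp only: pv)
      (use q0(11,12) q1(11,12) q2(11,12) q3(11,12) in \<open>auto simp: S_def big_def\<close>)
  have pE: "pedges g1 = pedges (prev g1)" "pedges g3 = pedges (prev g3)" "pedges P3 = pedges (prev P3)" by simp_all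
  have rE: "pedges (r i) \<subseteq> E (big i)" if "i \<in> edges E3" for i
    using that unfolding eE3 E_def pE q0(1) q1(1) q2(1) q3(1) by (elim insertE emptyE) (auto simp: big_def r_def)
  have SS: "S k \<inter> S l \<subseteq> {x, w, c, y}" if "k \<in> {0,1,2,3,4,5}" "l \<in> {0,1,2,3,4,5}" "k \<noteq> l" for k l
    using that by (elim insertE emptyE; simp add: S_def int int_comm)
  have S1: "\<exists>z. S k \<inter> S l \<subseteq> {z}" if "k \<in> {0,1,2,3,4,5}" "l \<in> {0,1,2,3,4,5}" "k \<noteq> l" for k l
    using that by (elim insertE emptyE; simp add: S_def int int_comm)
  have SE: "\<exists>u q v. path G u q v \<and> pedges q = E k \<and> pverts u q = S k" if "k \<in> {0,1,2,3,4,5}" for k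
    using that p by (elim insertE emptyE; simp add: S_def E_def defs; blast)
  have EE: "E k \<inter> E l = {}" if "k \<in> {0,1,2,3,4,5}" "l \<in> {0,1,2,3,4,5}" "k \<noteq> l" for k l
    using SE[OF that(1)] SE[OF that(2)] S1[OF that] pedges_disjoint by metis
  have bigr: "big i \<in> {0,1,2,3,4,5}" if "i \<in> edges E3" for i
    using that unfolding eE3 by (elim insertE emptyE) (auto simp: big_def)
  have same: "pedges (r i) \<inter> pedges (r j) = {} \<and> pv i \<inter> pv j \<subseteq> f ` verts E3"
    if "i \<in> edges E3" "j \<in> edges E3" "i \<noteq> j" "big i = big j" for i j
  proof -
    have "pedges (r i) \<inter> pedges (r (Suc i)) = {} \<and> pv i \<inter> pv (Suc i) \<subseteq> f ` verts E3" if "i \<in> {0, 2, 4, 6}" for i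
      using that pv[simplified] q0(10,13) q1(10,13) q2(10,13) q3(10,13) unfolding im
      by (elim insertE emptyE; simp add: r_def; auto)
    moreover have "(i \<in> {0, 2, 4, 6} \<and> j = Suc i) \<or> (j \<in> {0, 2, 4, 6} \<and> i = Suc j)"
      using that unfolding eE3 by (elim insertE emptyE) (simp_all add: big_def)
    ultimately show ?thesis by blast
  qed
  have pvint: "pv i \<inter> f ` verts E3 = {f (ss i), f (tt i)}" if "i \<in> edges E3" for i
  proof -
    have "pv i \<inter> {x, w, c, y, m0, m1, m2, m3} = {f (ss i), f (tt i)}"
      using that unfolding eE3
      by (elim insertE emptyE; simp only: pv[simplified] pv)
        (use m mS n mem end_in q0(8-12) q1(8-12) q2(8-12) q3(8-12) in \<open>auto simp: f_def ss_def tt_def\<close>)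
    then show ?thesis unfolding im .
  qed
  have dist: "distinct [x, w, c, y, m0, m1, m2, m3]"
    using d m mS q0(12) q1(12) q2(12) q3(12) by auto
  have "realizes G E3 f ss tt r"
    unfolding realizes_def
  proof (intro conjI ballI impI)
    show "finite (verts E3)" "finite (edges E3)" unfolding vE3 eE3 by auto
    show "inj_on f (verts E3)" unfolding f_def vE3 by (rule inj_on_nth[OF dist]) auto
    show "f ` verts E3 \<subseteq> verts G" unfolding im using q0(6,7) q1(6,7) q2(6,7) q3(6,7) by auto
  next
    fix i assume i: "i \<in> edges E3"
    show "ends E3 i = {ss i, tt i}" "ss i \<in> verts E3" "tt i \<in> verts E3"
      using i unfolding eE3 vE3 by (elim insertE emptyE; simp add: E3_def ss_def tt_def)+
    show "odd (length (r i))"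
      using i q0(2) q1(2) q2(2) q3(2) assms(3,7) unfolding eE3 by (elim insertE emptyE; simp add: r_def)
    show "path G (f (ss i)) (r i) (f (tt i))"
      using i q0(3-8) q1(3-8) q2(3-8) q3(3-8) p(1,5) unfolding eE3
      by (elim insertE emptyE; simp add: r_def f_def ss_def tt_def)
    show "pverts (f (ss i)) (r i) \<inter> f ` verts E3 = {f (ss i), f (tt i)}" using pvint[OF i] unfolding pv_def .
  next
    fix i j assume ij: "i \<in> edges E3" "j \<in> edges E3" "i \<noteq> j"
    have "pedges (r i) \<inter> pedges (r j) = {} \<and> pv i \<inter> pv j \<subseteq> f ` verts E3"
    proof (cases "big i = big j")
      case True
      then show ?thesis using same ij by blast
    next
      case False
      have "S (big i) \<inter> S (big j) \<subseteq> f ` verts E3"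
        using SS[OF bigr[OF ij(1)] bigr[OF ij(2)] False] unfolding im by auto
      moreover have "E (big i) \<inter> E (big j) = {}" using EE[OF bigr[OF ij(1)] bigr[OF ij(2)] False] .
      ultimately show ?thesis using rE[OF ij(1)] rE[OF ij(2)] pvS[OF ij(1)] pvS[OF ij(2)] by blast
    qed
    then show "pedges (r i) \<inter> pedges (r j) = {}"
      "pverts (f (ss i)) (r i) \<inter> pverts (f (ss j)) (r j) \<subseteq> f ` verts E3" unfolding pv_def by auto
  qed
  then show ?thesis using realizes_subgraph[OF assms(1)] unfolding obstructed_def by metis
qed

lemma path_restrict:
  "path G u p v \<Longrightarrow> pverts u p \<subseteq> S \<Longrightarrow> pedges p \<subseteq> X \<Longrightarrow> path \<lparr>verts = S, edges = X, ends = ends G\<rparr> u p v"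
  by (induction p arbitrary: u) auto

text \<open>Contracting the odd circuit \<open>g1 @ g2 @ g3\<close> identifies \<open>c\<close>,
  \<open>w\<close> and \<open>y\<close> and leaves three odd paths from \<open>x\<close> to the new
  vertex. \<open>K\<close> consists of the tetrahedron alone, so no chord of the circuit survives as
  a loop.\<close>

lemma apex_K4:
  assumes "multigraph G" "apex G x c w y P1 P2 P3 g1 g2 g3"
    "odd (length P1)" "odd (length P2)" "odd (length P3)" "odd (length g1 + length g2 + length g3)"
  shows "obstructed G"
proof -
  note D = apexD[OF assms(2)]
  note p = D(1-6) and d = D(7-12) and s = D(13-)
  define A where "A = pverts c g1 \<union> pverts w g2 \<union> pverts y g3"
  define S where "S = pverts x P1 \<union> pverts x P2 \<union> pverts x P3 \<union> A"
  define L where "L = g1 @ g2 @ g3"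
  define X where "X = pedges P1 \<union> pedges P2 \<union> pedges P3 \<union> pedges L"
  define K where "K = \<lparr>verts = S, edges = X, ends = ends G\<rparr>"
  have KG: "subgraph K G"
    unfolding K_def
  proof (rule subgraph_restrict[OF assms(1)])
    show "S \<subseteq> verts G" unfolding S_def A_def using pverts_subset p by (intro Un_least) fast+
    show "X \<subseteq> edges G" unfolding X_def L_def using pedges_subset p by (simp, intro conjI) fast+
    show "ends G e \<subseteq> S" if "e \<in> X" for e
      using that pedge_ends_subset[OF p(1)] pedge_ends_subset[OF p(2)] pedge_ends_subset[OF p(3)]
        pedge_ends_subset[OF p(4)] pedge_ends_subset[OF p(5)] pedge_ends_subset[OF p(6)]
      unfolding X_def L_def S_def A_def pedges_simps by (elim UnE) fast+
  qed
  have PA: "pverts x P1 \<inter> A = {c}" "pverts x P2 \<inter> A = {w}" "pverts x P3 \<inter> A = {y}"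
    unfolding A_def Int_Un_distrib s by auto
  have xA: "x \<notin> A" using PA(1) d start_in_pverts[of x P1] by (metis IntI singletonD)
  have cwyA: "c \<in> A" "w \<in> A" "y \<in> A" by (auto simp: A_def)
  \<comment> \<open>The last edge of \<open>g3\<close> is singled out as the closing edge that
    \<open>cycle\<close> requires.\<close>
  obtain g3' m e where g3: "g3 = g3' @ [(m, e, c)]" "path G y g3' m" "e \<in> edges G" "ends G e = {m, c}" "c \<notin> pverts y g3'"
    "e \<notin> pedges g3'"
  proof -
    obtain g3' t where g: "g3 = g3' @ [t]" using p(6) d(5) by (metis path.simps(1) rev_exhaust)
    obtain m where m: "path G y g3' m" "path G m [t] c" "pverts y g3' \<inter> pverts m [t] = {m}"
      using p(6) unfolding g path_append by blast
    obtain m' e c' where t: "t = (m', e, c')" by (cases t)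
    then have t': "t = (m, e, c)" "m \<noteq> c" using m(2) by auto
    moreover have "c \<notin> pverts y g3'" using m(3) t' by auto
    moreover have "e \<notin> pedges g3'" using path_distinct_pedges[OF p(6)] unfolding g t'(1) by (auto simp: pedges_def)
    ultimately show ?thesis using that[OF _ m(1)] g m(2) by auto
  qed
  have g3v: "pverts y g3 = insert c (pverts y g3')" using pverts_append[OF g3(2), of "[(m, e, c)]"] g3(1) 
    path_end_in_pverts[OF g3(2)] by auto
  have g12: "path G c (g1 @ g2) y" "pverts c (g1 @ g2) = pverts c g1 \<union> pverts w g2"
    using path_appendI[OF p(4,5)] pverts_append[OF p(4)] s(4) by auto
  have "pverts y g3' \<subseteq> pverts y g3 - {c}" using g3(5) g3v by auto
  then have "pverts c (g1 @ g2) \<inter> pverts y g3' \<subseteq> {y}" unfolding g12(2) using s(5,6) by blast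
  then have cp: "path G c ((g1 @ g2) @ g3') m" by (rule path_appendI[OF g12(1) g3(2)])
  have vL: "pverts c ((g1 @ g2) @ g3') = A"
    using pverts_append[OF g12(1), of g3'] g12(2) g3v by (auto simp: A_def)
  have LL: "L = ((g1 @ g2) @ g3') @ [(m, e, c)]" by (simp add: L_def g3(1))
  have enot: "e \<notin> pedges ((g1 @ g2) @ g3')"
  proof -
    have "pedges g3 \<inter> pedges g1 = {}" using pedges_disjoint[OF p(6) p(4)] s(6) by (metis Int_commute order_refl)
    moreover have "pedges g3 \<inter> pedges g2 = {}" using pedges_disjoint[OF p(6) p(5)] s(5) by (metis Int_commute order_refl)
    moreover have "e \<in> pedges g3" using g3(1) by simp
    ultimately show ?thesis using g3(6) by auto
  qed
  have "path K c ((g1 @ g2) @ g3') m"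
    unfolding K_def by (rule path_restrict[OF cp]) (use vL in \<open>auto simp: S_def X_def LL\<close>)
  then have cyc: "cycle K c ((g1 @ g2) @ g3') m e"
    using enot g3(4) by (auto simp: cycle_def K_def X_def LL)
  define vs where "vs = map fst L"
  define es where "es = map (fst \<circ> snd) L"
  have circ: "circuit K vs es" using cycle_imp_circuit(1)[OF cyc] unfolding vs_def es_def LL .
  have vsA: "set vs = A"
    using path_vertex_list[OF cp] vL unfolding vs_def LL by (metis list.simps(8,9) fst_conv map_append)
  have esL: "set es = pedges L" by (auto simp: es_def pedges_def)
  have lenes: "length es = length g1 + length g2 + length g3" by (simp add: es_def L_def)
  define cls where "cls = (\<lambda>v. if v \<in> A then A else {v})"
  define K' where "K' = contract_circuit K vs es"
  have K': "verts K' = cls ` S" "edges K' = X - pedges L" "ends K' = (\<lambda>e. cls ` ends G e)"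
    using vsA esL by (simp_all add: K'_def contract_circuit_def cls_def Let_def K_def)
  have PX: "pedges P1 \<inter> pedges L = {}" "pedges P2 \<inter> pedges L = {}" "pedges P3 \<inter> pedges L = {}"
    using pedges_disjoint[OF p(1) p(4), of c] pedges_disjoint[OF p(1) p(5), of c] pedges_disjoint[OF p(1) p(6), of c]
      pedges_disjoint[OF p(2) p(4), of w] pedges_disjoint[OF p(2) p(5), of w] pedges_disjoint[OF p(2) p(6), of w]
      pedges_disjoint[OF p(3) p(4), of y] pedges_disjoint[OF p(3) p(5), of y] pedges_disjoint[OF p(3) p(6), of y]
    unfolding s L_def by auto
  let ?m = "map (\<lambda>(a, e, b). (cls a, e, cls b))"
  \<comment> \<open>Each \<open>P\<close> meets the circuit in its end only, so \<open>cls\<close>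
    is injective on it and carries it to a path of the contraction.\<close>
  have lift: "path K' {x} (?m P) A \<and> pverts {x} (?m P) = cls ` pverts x P"
    if "path G x P z" "pverts x P \<inter> A = {z}" "pverts x P \<subseteq> S" "pedges P \<subseteq> X" "pedges P \<inter> pedges L = {}" for P z
  proof -
    let ?H = "\<lparr>verts = pverts x P, edges = pedges P, ends = ends G\<rparr>"
    have "path ?H x P z" by (rule path_restrict[OF that(1)]) auto
    moreover have "inj_on cls (verts ?H)"
    proof (rule inj_onI)
      fix u v assume u: "u \<in> verts ?H" and v: "v \<in> verts ?H" and e: "cls u = cls v"
      have z: "t = z" if "t \<in> pverts x P" "t \<in> A" for t using \<open>pverts x P \<inter> A = {z}\<close> that by auto
      show "u = v"
      proof (cases "u \<in> A \<and> v \<in> A")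
        case True
        then show ?thesis using z[of u] z[of v] u v by simp
      next
        case False
        then show ?thesis using e by (auto simp: cls_def split: if_splits)
      qed
    qed
    moreover have "cls ` verts ?H \<subseteq> verts K'" "(\<lambda>e. e) ` edges ?H \<subseteq> edges K'" using that K' by auto
    moreover have "ends K' ((\<lambda>e. e) e) = cls ` ends ?H e" for e using K' by simp
    ultimately have "path K' (cls x) (map (\<lambda>(a, e, b). (cls a, (\<lambda>e. e) e, cls b)) P) (cls z) \<and>
      pverts (cls x) (map (\<lambda>(a, e, b). (cls a, (\<lambda>e. e) e, cls b)) P) = cls ` pverts x P"
      using path_map[of cls ?H K' "\<lambda>e. e" x P z] by blast
    moreover have "cls x = {x}" "cls z = A" using xA that(2) by (auto simp: cls_def)
    ultimately show ?thesis by simp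
  qed
  have P1: "path K' {x} (?m P1) A" "pverts {x} (?m P1) = cls ` pverts x P1"
    using lift[OF p(1) PA(1)] PX(1) by (auto simp: S_def X_def)
  have P2: "path K' {x} (?m P2) A" "pverts {x} (?m P2) = cls ` pverts x P2"
    using lift[OF p(2) PA(2)] PX(2) by (auto simp: S_def X_def)
  have P3: "path K' {x} (?m P3) A" "pverts {x} (?m P3) = cls ` pverts x P3"
    using lift[OF p(3) PA(3)] PX(3) by (auto simp: S_def X_def)
  have pm: "pedges (?m P) = pedges P" for P by (auto simp: pedges_def image_image case_prod_beta)
  have clsint: "cls ` U \<inter> cls ` V = {{x}, A}" if "U \<inter> V = {x}" "U \<inter> A = {a}" "V \<inter> A = {b}" for U V a b
  proof -
    have "cls ` U = insert A ((\<lambda>z. {z}) ` (U - A))" "cls ` V = insert A ((\<lambda>z. {z}) ` (V - A))"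
      using that by (auto simp: cls_def image_iff)
    moreover have "A \<notin> (\<lambda>z. {z}) ` (U - A)" "A \<notin> (\<lambda>z. {z}) ` (V - A)" by auto
    ultimately show ?thesis using that(1) xA by auto
  qed
  have xA': "{x} \<noteq> A" using xA by auto
  have "realizes K' E1 (\<lambda>n. if n = 0 then {x} else A) (\<lambda>_. 0) (\<lambda>_. 1) (\<lambda>i. [?m P1, ?m P2, ?m P3] ! i)"
  proof (rule realizes_E1[OF xA' P1(1) P2(1) P3(1)])
    show "pverts {x} (?m P1) \<inter> pverts {x} (?m P2) = {{x}, A}" unfolding P1 P2 by (rule clsint[OF s(1) PA(1,2)])
    show "pverts {x} (?m P1) \<inter> pverts {x} (?m P3) = {{x}, A}" unfolding P1 P3 by (rule clsint[OF s(3) PA(1,3)])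
    show "pverts {x} (?m P2) \<inter> pverts {x} (?m P3) = {{x}, A}" unfolding P2 P3 by (rule clsint[OF s(2) PA(2,3)])
    show "pedges (?m P1) \<inter> pedges (?m P2) = {}" unfolding pm using pedges_disjoint[OF p(1,2)] s(1) by blast
    show "pedges (?m P1) \<inter> pedges (?m P3) = {}" unfolding pm using pedges_disjoint[OF p(1,3)] s(3) by blast
    show "pedges (?m P2) \<inter> pedges (?m P3) = {}" unfolding pm using pedges_disjoint[OF p(2,3)] s(2) by blast
  qed (use assms in auto)
  moreover have "union_of K' E1 (\<lambda>n. if n = 0 then {x} else A) (\<lambda>_. 0) (\<lambda>i. [?m P1, ?m P2, ?m P3] ! i) K'"
  proof -
    have E: "edges E1 = {0, 1, 2}" "verts E1 = {0, 1}" by (auto simp: E1_def)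
    have "cls ` A = {A}" using cwyA by (auto simp: cls_def)
    then have "verts K' = {{x}, A} \<union> (cls ` pverts x P1 \<union> cls ` pverts x P2 \<union> cls ` pverts x P3)"
    proof -
      have "{x} \<in> cls ` pverts x P1" by (rule image_eqI[of _ _ x]) (use xA in \<open>simp_all add: cls_def\<close>)
      then show ?thesis unfolding K'(1) S_def image_Un \<open>cls ` A = {A}\<close> by auto
    qed
    moreover have "edges K' = pedges P1 \<union> pedges P2 \<union> pedges P3" using K'(2) PX by (auto simp: X_def)
    ultimately show ?thesis unfolding union_of_def E using P1(2) P2(2) P3(2) pm[of P1] pm[of P2] pm[of P3] by (auto simp: numeral_2_eq_2)
  qed
  ultimately have "even_subdivision E1 K'" by (rule even_subdivision_if_realizes)
  then show ?thesis unfolding obstructed_def K'_def using KG circ lenes assms(6) by metis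
qed

text \<open>With all arcs odd, exactly one odd path among \<open>P1\<close>, \<open>P2\<close>,
  \<open>P3\<close> gives an \<open>E1\<close>, and three odd ones give an \<open>E1\<close> after
  contraction. With only \<open>g2\<close> odd, an odd \<open>P1\<close> gives an \<open>E1\<close>
  as soon as \<open>P2\<close> or \<open>P3\<close> is odd, and an \<open>E3\<close> otherwise. Here
  \<open>c\<close> is the vertex opposite to the odd arc.\<close>

lemma apex_parity:
  assumes "multigraph G" "\<not> obstructed G" "apex G x c w y P1 P2 P3 g1 g2 g3"
  shows "odd (length g1) \<Longrightarrow> odd (length g2) \<Longrightarrow> odd (length g3) \<Longrightarrow>
      even (length P1 + length P2 + length P3)"
    and "even (length g1) \<Longrightarrow> odd (length g2) \<Longrightarrow> even (length g3) \<Longrightarrow> even (length P1)"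
proof -
  note r1 = apex_rotate[OF assms(3)]
  note r2 = apex_rotate[OF r1]
  note t = apex_theta[OF assms(1)]
  show "even (length P1 + length P2 + length P3)" if "odd (length g1)" "odd (length g2)" "odd (length g3)"
    using t[OF assms(3)] t[OF r1] t[OF r2] apex_K4[OF assms(1,3)] that assms(2) unfolding even_add by argo
  show "even (length P1)" if "even (length g1)" "odd (length g2)" "even (length g3)"
    using t[OF assms(3)] t[OF r1] t[OF r2] apex_E3[OF assms(1,3)] that assms(2) unfolding even_add by argo
qed

section \<open>Conflicting paths\<close>

text \<open>Turns inclusions between unions and intersections into first-order statements about
  elements, which \<open>metis\<close> then settles.\<close>

lemmas set_logic = Un_iff Int_iff subset_iff insert_iff empty_iff

text \<open>Naming the vertex set by a variable makes all disjointness conditions statements about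
  plain sets, fit for \<open>set_logic\<close>.\<close>

definition pth :: "('v, 'e) mgraph \<Rightarrow> 'v \<Rightarrow> ('v \<times> 'e \<times> 'v) list \<Rightarrow> 'v \<Rightarrow> 'v set \<Rightarrow> bool" where
  "pth G u p v V \<longleftrightarrow> path G u p v \<and> pverts u p = V"

lemma pthD: "pth G u p v V \<Longrightarrow> path G u p v" "pth G u p v V \<Longrightarrow> pverts u p = V"
  by (auto simp: pth_def)

lemma pth_mem: "pth G u p v V \<Longrightarrow> u \<in> V" "pth G u p v V \<Longrightarrow> v \<in> V"
  by (auto simp: pth_def path_end_in_pverts)

lemma pth_append: "pth G u p m V \<Longrightarrow> pth G m q v W \<Longrightarrow> V \<inter> W \<subseteq> {m} \<Longrightarrow> pth G u (p @ q) v (V \<union> W)"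
  unfolding pth_def using path_appendI pverts_append by metis

lemma pth_prev: "pth G u p v V \<Longrightarrow> pth G v (prev p) u V"
  unfolding pth_def using path_prev pverts_prev by metis

lemma pth_split:
  assumes "pth G u p v V" "m \<in> V"
  obtains p1 p2 V1 V2 where "p = p1 @ p2" "pth G u p1 m V1" "pth G m p2 v V2" "V1 \<inter> V2 \<subseteq> {m}" "V = V1 \<union> V2"
  using assms unfolding pth_def by (metis path_split order_refl)

lemma apexI:
  assumes "pth G x P1 c V1" "pth G x P2 w V2" "pth G x P3 y V3"
    "pth G c g1 w U1" "pth G w g2 y U2" "pth G y g3 c U3" "distinct [x, c, w, y]"
    "V1 \<inter> V2 \<subseteq> {x}" "V2 \<inter> V3 \<subseteq> {x}" "V1 \<inter> V3 \<subseteq> {x}"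
    "U1 \<inter> U2 \<subseteq> {w}" "U2 \<inter> U3 \<subseteq> {y}" "U1 \<inter> U3 \<subseteq> {c}"
    "V1 \<inter> (U1 \<union> U2 \<union> U3) \<subseteq> {c}" "V2 \<inter> (U1 \<union> U2 \<union> U3) \<subseteq> {w}" "V3 \<inter> (U1 \<union> U2 \<union> U3) \<subseteq> {y}"
  shows "apex G x c w y P1 P2 P3 g1 g2 g3"
proof -
  note m = pth_mem[OF assms(1)] pth_mem[OF assms(2)] pth_mem[OF assms(3)] pth_mem[OF assms(4)]
    pth_mem[OF assms(5)] pth_mem[OF assms(6)]
  have eq: "X \<inter> Y = {z}" if "X \<inter> Y \<subseteq> {z}" "z \<in> X" "z \<in> Y" for X Y :: "'a set" and z using that by auto
  have "V1 \<inter> V2 = {x}" "V2 \<inter> V3 = {x}" "V3 \<inter> V1 = {x}" "U1 \<inter> U2 = {w}" "U2 \<inter> U3 = {y}" "U3 \<inter> U1 = {c}"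
    "V1 \<inter> (U1 \<union> U2 \<union> U3) = {c}" "V2 \<inter> (U1 \<union> U2 \<union> U3) = {w}" "V3 \<inter> (U1 \<union> U2 \<union> U3) = {y}"
    by (rule eq; use assms(8-) m in \<open>simp add: Int_commute\<close>)+
  then show ?thesis
    unfolding apex_def assms(1-6)[THEN pthD(2)] using assms(1-6)[THEN pthD(1)] assms(7) by simp
qed

text \<open>Nothing is assumed about \<open>d e\<close>, hence the conditions
  \<open>e \<notin> pedges p\<close> in the parity facts.\<close>

locale critical =
  fixes G :: "('v, 'e) mgraph" and e u v d
  assumes multigraph: "multigraph G"
    and not_obstructed: "\<not> obstructed G"
    and e: "e \<in> edges G" "ends G e = {u, v}" "u \<noteq> v"
    and even_orientation: "even_orientation (del G {e}) d"
begin

lemma critical_sym: "critical G e v u d"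
  using multigraph not_obstructed e even_orientation by unfold_locales auto

lemma even_fw_prev':
  "pth G a p b V \<Longrightarrow> e \<notin> pedges p \<Longrightarrow> even (fw d (prev p)) \<longleftrightarrow> (even (fw d p) \<longleftrightarrow> even (length p))"
  using even_fw_prev[of "del G {e}" a p b d] even_orientation path_del[of G "{e}" a p b]
  by (auto simp: even_orientation_def pth_def)

lemma parallel_parity:
  assumes "pth G a p b V" "pth G a q b W" "e \<notin> pedges p" "e \<notin> pedges q" "V \<inter> W \<subseteq> {a, b}" "p \<noteq> q" "a \<noteq> b"
    "even (length p + length q)"
  shows "even (fw d p + fw d q + length p)"
proof -
  have "pverts a p \<inter> pverts a q = {a, b}"
    using assms pth_mem[OF assms(1)] pth_mem[OF assms(2)] by (auto simp: pth_def)
  then show ?thesis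
    using even_orientation_parallel[OF even_orientation, of a p b q] assms by (auto simp: path_del pth_def)
qed

text \<open>Together with \<open>z\<close>, parallel paths of odd length would be an even subdivision of \<open>E1\<close>; parallel paths of
  even length agree.\<close>

lemma swap_parity:
  assumes "pth G a p b V" "pth G a q b W" "e \<notin> pedges p" "e \<notin> pedges q" "pth G b z a Z" "e \<in> pedges z"
    "V \<inter> W \<subseteq> {a, b}" "V \<inter> Z \<subseteq> {a, b}" "W \<inter> Z \<subseteq> {a, b}" "a \<noteq> b"
    "even (length p + length q)" "even (length p + length z)"
  shows "even (fw d p + fw d q)"
proof (cases "p = q")
  case False
  have par: "even (fw d p + fw d q + length p)" using parallel_parity assms False by blast
  have z: "pth G a (prev z) b Z" using pth_prev assms(5) .
  note m = pth_mem[OF assms(1)] pth_mem[OF assms(2)] pth_mem[OF assms(5)]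
  have i: "pverts a p \<inter> pverts a q = {a, b}" "pverts a p \<inter> pverts a (prev z) = {a, b}"
     "pverts a q \<inter> pverts a (prev z) = {a, b}"
    using assms m z by (auto simp: pth_def)
  note P = pthD(1)[OF assms(1)] pthD(1)[OF assms(2)] pthD(1)[OF z]
  have n: "p \<noteq> prev z" "q \<noteq> prev z" using assms by auto
  have "even (length p)"
  proof (rule ccontr)
    assume "odd (length p)"
    then have "obstructed G"
      using theta_obstructed[OF multigraph assms(10) P] assms i
        parallel_paths_edge_disjoint[OF P(1,2) i(1) False] parallel_paths_edge_disjoint[OF P(1,3) i(2) n(1)]
        parallel_paths_edge_disjoint[OF P(2,3) i(3) n(2)] by auto
    then show False using not_obstructed by simp
  qed
  then show ?thesis using par by simp
qed simp

text \<open>Two odd circuits, made up of \<open>\<alpha>0\<close>, \<open>\<alpha>1\<close> and of \<open>\<beta>0\<close>, \<open>\<beta>1\<close>, which are joined by \<open>\<sigma>\<close> and \<open>\<omega>\<close>. They may share a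
  vertex, in which case \<open>\<sigma>\<close> is empty. Two of the four closed walks through \<open>\<sigma>\<close> and \<open>\<omega>\<close> are even.\<close>

definition ring where
  "ring a b c w \<alpha>0 \<alpha>1 \<sigma> \<beta>0 \<beta>1 \<omega> A0 A1 S B0 B1 \<Omega> \<longleftrightarrow>
     pth G a \<alpha>0 b A0 \<and> pth G a \<alpha>1 b A1 \<and> pth G b \<sigma> c S \<and> pth G c \<beta>0 w B0 \<and> pth G c \<beta>1 w B1 \<and> pth G w \<omega> a \<Omega> \<and>
     a \<noteq> b \<and> c \<noteq> w \<and> A0 \<inter> A1 \<subseteq> {a, b} \<and> B0 \<inter> B1 \<subseteq> {c, w} \<and> (A0 \<union> A1) \<inter> S \<subseteq> {b} \<and> S \<inter> (B0 \<union> B1) \<subseteq> {c} \<and>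
     (A0 \<union> A1) \<inter> (B0 \<union> B1) \<subseteq> S \<and> \<Omega> \<inter> (A0 \<union> A1) \<subseteq> {a} \<and> \<Omega> \<inter> (B0 \<union> B1) \<subseteq> {w} \<and> \<Omega> \<inter> S \<subseteq> {} \<and>
     odd (length \<alpha>0 + length \<alpha>1) \<and> odd (length \<beta>0 + length \<beta>1)"

text \<open>Exchanging both arcs preserves the parity of a closed walk, so the even ones come as a
  pair that uses every arc once. Adding their two conditions cancels \<open>\<sigma>\<close> and
  \<open>\<omega>\<close>.\<close>

lemma ring_even:
  assumes R: "ring a b c w \<alpha>0 \<alpha>1 \<sigma> \<beta>0 \<beta>1 \<omega> A0 A1 S B0 B1 \<Omega>"
    and "e \<notin> pedges \<alpha>0" "e \<notin> pedges \<alpha>1" "e \<notin> pedges \<sigma>" "e \<notin> pedges \<beta>0" "e \<notin> pedges \<beta>1" "e \<notin> pedges \<omega>"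
  shows "even (fw d \<alpha>0 + fw d \<alpha>1 + fw d \<beta>0 + fw d \<beta>1)"
proof -
  have p: "pth G a \<alpha>0 b A0" "pth G a \<alpha>1 b A1" "pth G b \<sigma> c S" "pth G c \<beta>0 w B0" "pth G c \<beta>1 w B1" "pth G w \<omega> a \<Omega>"
    and s: "a \<noteq> b" "c \<noteq> w" "A0 \<inter> A1 \<subseteq> {a, b}" "B0 \<inter> B1 \<subseteq> {c, w}" "(A0 \<union> A1) \<inter> S \<subseteq> {b}" "S \<inter> (B0 \<union> B1) \<subseteq> {c}"
     "(A0 \<union> A1) \<inter> (B0 \<union> B1) \<subseteq> S" "\<Omega> \<inter> (A0 \<union> A1) \<subseteq> {a}" "\<Omega> \<inter> (B0 \<union> B1) \<subseteq> {w}" "\<Omega> \<inter> S \<subseteq> {}"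
    and l: "odd (length \<alpha>0 + length \<alpha>1)" "odd (length \<beta>0 + length \<beta>1)"
    using R[unfolded ring_def] by blast+
  have "a \<noteq> w"
    using pth_mem[OF p(1)] pth_mem[OF p(4)] s(7,10) pth_mem[OF p(6)] by (simp only: set_logic; metis)
  have *: "even (fw d (prev \<omega>) + fw d (\<alpha> @ \<sigma> @ \<beta>) + length \<omega>)"
    if "\<alpha> = \<alpha>0 \<and> A = A0 \<or> \<alpha> = \<alpha>1 \<and> A = A1" "\<beta> = \<beta>0 \<and> B = B0 \<or> \<beta> = \<beta>1 \<and> B = B1"
      "even (length \<omega> + (length \<alpha> + (length \<sigma> + length \<beta>)))" for \<alpha> \<beta> A B
  proof -
    have ab: "pth G a \<alpha> b A" "pth G c \<beta> w B" "e \<notin> pedges \<alpha>" "e \<notin> pedges \<beta>" using that p assms by auto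
    have AB: "A \<subseteq> A0 \<union> A1" "B \<subseteq> B0 \<union> B1" using that by auto
    have 1: "pth G b (\<sigma> @ \<beta>) w (S \<union> B)" by (rule pth_append[OF p(3) ab(2)]) (use s AB in \<open>simp only: set_logic; metis\<close>)
    have 2: "pth G a (\<alpha> @ \<sigma> @ \<beta>) w (A \<union> (S \<union> B))" by (rule pth_append[OF ab(1) 1]) (use s AB in \<open>simp only: set_logic; metis\<close>)
    have "b \<notin> \<Omega>" using s(10) pth_mem[OF p(3)] by blast
    then have "prev \<omega> \<noteq> \<alpha> @ \<sigma> @ \<beta>" using 2 pth_prev[OF p(6)] pth_mem[OF p(3)] unfolding pth_def by (metis UnCI)
    moreover have "\<Omega> \<inter> (A \<union> (S \<union> B)) \<subseteq> {a, w}" using s(8-10) AB by (simp only: set_logic; metis)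
    ultimately have "even (fw d (prev \<omega>) + fw d (\<alpha> @ \<sigma> @ \<beta>) + length (prev \<omega>))"
      by (intro parallel_parity[OF pth_prev[OF p(6)] 2]) (use that(3) ab assms(4,7) \<open>a \<noteq> w\<close> in simp_all)
    then show ?thesis by simp
  qed
  show ?thesis
  proof (cases "even (length \<omega> + (length \<alpha>0 + (length \<sigma> + length \<beta>0)))")
    case True
    then have "even (length \<omega> + (length \<alpha>1 + (length \<sigma> + length \<beta>1)))" using l by auto
    then show ?thesis using *[of \<alpha>0 A0 \<beta>0 B0] *[of \<alpha>1 A1 \<beta>1 B1] True unfolding fw_simps(3) even_add by blast
  next
    case False
    then have "even (length \<omega> + (length \<alpha>0 + (length \<sigma> + length \<beta>1)))" "even (length \<omega> + (length \<alpha>1 + (length \<sigma> + length \<beta>0)))"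
      using l by auto
    then show ?thesis using *[of \<alpha>0 A0 \<beta>1 B1] *[of \<alpha>1 A1 \<beta>0 B0] unfolding fw_simps(3) even_add by blast
  qed
qed

text \<open>A ring through \<open>e\<close> whose two even circuits make contradictory demands on the direction of \<open>e\<close>; by the
  last condition this does not depend on the parities of \<open>\<sigma>\<close>, \<open>\<upsilon>\<close> and \<open>\<tau>\<close>.\<close>

definition conf where
  "conf a b c w \<alpha>0 \<alpha>1 \<sigma> \<beta>0 \<beta>1 \<upsilon> \<tau> A0 A1 S B0 B1 Y T \<longleftrightarrow>
     ring a b c w \<alpha>0 \<alpha>1 \<sigma> \<beta>0 \<beta>1 (\<upsilon> @ [(v, e, u)] @ \<tau>) A0 A1 S B0 B1 (Y \<union> T) \<and>
     pth G w \<upsilon> v Y \<and> pth G u \<tau> a T \<and> Y \<inter> T \<subseteq> {} \<and>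
     e \<notin> pedges \<alpha>0 \<and> e \<notin> pedges \<alpha>1 \<and> e \<notin> pedges \<sigma> \<and> e \<notin> pedges \<beta>0 \<and> e \<notin> pedges \<beta>1 \<and> e \<notin> pedges \<upsilon> \<and> e \<notin> pedges \<tau> \<and>
     odd (fw d \<alpha>0 + fw d \<alpha>1 + fw d \<beta>0 + fw d \<beta>1)"

lemma pth_e: 
  assumes "pth G w \<upsilon> v Y" "pth G u \<tau> a T" "Y \<inter> T \<subseteq> {}"
  shows "pth G w (\<upsilon> @ [(v, e, u)] @ \<tau>) a (Y \<union> T)"
proof -
  have "v \<notin> T" "v \<in> verts G" using assms pth_mem[OF assms(1)] path_end_in_verts by (auto simp: pth_def)
  then have "pth G v ([(v, e, u)] @ \<tau>) a (insert v T)" using assms(2) e by (auto simp: pth_def)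
  then have "pth G w (\<upsilon> @ [(v, e, u)] @ \<tau>) a (Y \<union> insert v T)"
    by (rule pth_append[OF assms(1)]) (use assms(3) in blast)
  then show ?thesis using pth_mem[OF assms(1)] by (simp add: insert_absorb)
qed

text \<open>The conditions of \<open>ring\<close> on \<open>Y \<union> T\<close> appear separately
  for the two tails, since connecting paths attach to one of them at a time.\<close>

lemma confI:
  assumes "pth G a \<alpha>0 b A0" "pth G a \<alpha>1 b A1" "pth G b \<sigma> c S" "pth G c \<beta>0 w B0" "pth G c \<beta>1 w B1"
    "pth G w \<upsilon> v Y" "pth G u \<tau> a T"
    "e \<notin> pedges \<alpha>0" "e \<notin> pedges \<alpha>1" "e \<notin> pedges \<sigma>" "e \<notin> pedges \<beta>0" "e \<notin> pedges \<beta>1" "e \<notin> pedges \<upsilon>" "e \<notin> pedges \<tau>"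
    "a \<noteq> b" "c \<noteq> w" "A0 \<inter> A1 \<subseteq> {a, b}" "B0 \<inter> B1 \<subseteq> {c, w}" "(A0 \<union> A1) \<inter> S \<subseteq> {b}" "S \<inter> (B0 \<union> B1) \<subseteq> {c}"
    "(A0 \<union> A1) \<inter> (B0 \<union> B1) \<subseteq> S" "T \<inter> (A0 \<union> A1) \<subseteq> {a}" "Y \<inter> (B0 \<union> B1) \<subseteq> {w}"
    "Y \<inter> (A0 \<union> A1 \<union> S \<union> T) \<subseteq> {}" "T \<inter> (S \<union> B0 \<union> B1) \<subseteq> {}"
    "odd (length \<alpha>0 + length \<alpha>1)" "odd (length \<beta>0 + length \<beta>1)" "odd (fw d \<alpha>0 + fw d \<alpha>1 + fw d \<beta>0 + fw d \<beta>1)"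
  shows "conf a b c w \<alpha>0 \<alpha>1 \<sigma> \<beta>0 \<beta>1 \<upsilon> \<tau> A0 A1 S B0 B1 Y T"
proof -
  have YT: "Y \<inter> T \<subseteq> {}" using assms(24) by blast
  have 1: "(Y \<union> T) \<inter> (A0 \<union> A1) \<subseteq> {a}" using assms(22,24) by blast
  have 2: "(Y \<union> T) \<inter> (B0 \<union> B1) \<subseteq> {w}" using assms(23,25) by blast
  have 3: "(Y \<union> T) \<inter> S \<subseteq> {}" using assms(24,25) by blast
  show ?thesis unfolding conf_def ring_def using assms YT 1 2 3 pth_e[OF assms(6,7) YT] by (intro conjI)
qed

lemma confD:
  assumes "conf a b c w \<alpha>0 \<alpha>1 \<sigma> \<beta>0 \<beta>1 \<upsilon> \<tau> A0 A1 S B0 B1 Y T"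
  shows "pth G a \<alpha>0 b A0" "pth G a \<alpha>1 b A1" "pth G b \<sigma> c S" "pth G c \<beta>0 w B0" "pth G c \<beta>1 w B1"
    "pth G w \<upsilon> v Y" "pth G u \<tau> a T"
    "e \<notin> pedges \<alpha>0" "e \<notin> pedges \<alpha>1" "e \<notin> pedges \<sigma>" "e \<notin> pedges \<beta>0" "e \<notin> pedges \<beta>1" "e \<notin> pedges \<upsilon>" "e \<notin> pedges \<tau>"
    "a \<noteq> b" "c \<noteq> w" "A0 \<inter> A1 \<subseteq> {a, b}" "B0 \<inter> B1 \<subseteq> {c, w}" "(A0 \<union> A1) \<inter> S \<subseteq> {b}" "S \<inter> (B0 \<union> B1) \<subseteq> {c}"
    "(A0 \<union> A1) \<inter> (B0 \<union> B1) \<subseteq> S" "T \<inter> (A0 \<union> A1) \<subseteq> {a}" "Y \<inter> (B0 \<union> B1) \<subseteq> {w}"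
    "Y \<inter> (A0 \<union> A1 \<union> S \<union> T) \<subseteq> {}" "T \<inter> (S \<union> B0 \<union> B1) \<subseteq> {}"
    "odd (length \<alpha>0 + length \<alpha>1)" "odd (length \<beta>0 + length \<beta>1)" "odd (fw d \<alpha>0 + fw d \<alpha>1 + fw d \<beta>0 + fw d \<beta>1)"
proof -
  show p: "pth G a \<alpha>0 b A0" "pth G a \<alpha>1 b A1" "pth G b \<sigma> c S" "pth G c \<beta>0 w B0" "pth G c \<beta>1 w B1"
    "pth G w \<upsilon> v Y" "pth G u \<tau> a T"
    "e \<notin> pedges \<alpha>0" "e \<notin> pedges \<alpha>1" "e \<notin> pedges \<sigma>" "e \<notin> pedges \<beta>0" "e \<notin> pedges \<beta>1" "e \<notin> pedges \<upsilon>" "e \<notin> pedges \<tau>"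
    "a \<noteq> b" "c \<noteq> w" "A0 \<inter> A1 \<subseteq> {a, b}" "B0 \<inter> B1 \<subseteq> {c, w}" and q: "(A0 \<union> A1) \<inter> S \<subseteq> {b}" "S \<inter> (B0 \<union> B1) \<subseteq> {c}"
    "(A0 \<union> A1) \<inter> (B0 \<union> B1) \<subseteq> S"
    "odd (length \<alpha>0 + length \<alpha>1)" "odd (length \<beta>0 + length \<beta>1)" "odd (fw d \<alpha>0 + fw d \<alpha>1 + fw d \<beta>0 + fw d \<beta>1)"
    using assms[unfolded conf_def ring_def] by blast+
  have r: "(Y \<union> T) \<inter> (A0 \<union> A1) \<subseteq> {a}" "(Y \<union> T) \<inter> (B0 \<union> B1) \<subseteq> {w}" "(Y \<union> T) \<inter> S \<subseteq> {}" "Y \<inter> T \<subseteq> {}"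
    using assms[unfolded conf_def ring_def] by blast+
  show "T \<inter> (A0 \<union> A1) \<subseteq> {a}" "Y \<inter> (B0 \<union> B1) \<subseteq> {w}" using r by blast+
  show "Y \<inter> (A0 \<union> A1 \<union> S \<union> T) \<subseteq> {}" using r pth_mem[OF p(7)] by blast
  show "T \<inter> (S \<union> B0 \<union> B1) \<subseteq> {}" using r pth_mem[OF p(6)] by blast
qed

lemma conf_swap_\<alpha>: "conf a b c w \<alpha>0 \<alpha>1 \<sigma> \<beta>0 \<beta>1 \<upsilon> \<tau> A0 A1 S B0 B1 Y T \<Longrightarrow> conf a b c w \<alpha>1 \<alpha>0 \<sigma> \<beta>0 \<beta>1 \<upsilon> \<tau> A1 A0 S B0 B1 Y T"
  unfolding conf_def ring_def by (simp add: Un_ac Int_ac add_ac)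

lemma conf_swap_\<beta>: "conf a b c w \<alpha>0 \<alpha>1 \<sigma> \<beta>0 \<beta>1 \<upsilon> \<tau> A0 A1 S B0 B1 Y T \<Longrightarrow> conf a b c w \<alpha>0 \<alpha>1 \<sigma> \<beta>1 \<beta>0 \<upsilon> \<tau> A0 A1 S B1 B0 Y T"
  unfolding conf_def ring_def by (simp add: Un_ac Int_ac add_ac)

text \<open>Read backwards, a configuration is again one, with the two odd circuits and the two ends
  of \<open>e\<close> interchanged. This saves the mirror images of later cases.\<close>

lemma conf_reverse:
  assumes "conf a b c w \<alpha>0 \<alpha>1 \<sigma> \<beta>0 \<beta>1 \<upsilon> \<tau> A0 A1 S B0 B1 Y T"
  shows "critical.conf G e v u d w c b a (prev \<beta>0) (prev \<beta>1) (prev \<sigma>) (prev \<alpha>0) (prev \<alpha>1) (prev \<tau>) (prev \<upsilon>) B0 B1 S A0 A1 T Y"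
proof -
  interpret R: critical G e v u d by (rule critical_sym)
  note C = confD[OF assms]
  show ?thesis
  proof (rule R.confI)
    \<comment> \<open>Modulo 2 the four reversals contribute the total length of the arcs, which is
      even because both circuits are odd.\<close>
    show "odd (fw d (prev \<beta>0) + fw d (prev \<beta>1) + fw d (prev \<alpha>0) + fw d (prev \<alpha>1))"
      using C(26-28) even_fw_prev'[OF C(1,8)] even_fw_prev'[OF C(2,9)] even_fw_prev'[OF C(4,11)] even_fw_prev'[OF C(5,12)]
      unfolding even_add by argo
    show "(B0 \<union> B1) \<inter> S \<subseteq> {c}" "S \<inter> (A0 \<union> A1) \<subseteq> {b}" "(B0 \<union> B1) \<inter> (A0 \<union> A1) \<subseteq> S"
      "T \<inter> (B0 \<union> B1 \<union> S \<union> Y) \<subseteq> {}" "Y \<inter> (S \<union> A0 \<union> A1) \<subseteq> {}" "B0 \<inter> B1 \<subseteq> {w, c}" "A0 \<inter> A1 \<subseteq> {b, a}"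
      using C(17-25) by (simp only: set_logic; metis)+
  qed (use C(1-7)[THEN pth_prev] C in simp_all)
qed


text \<open>Only the length of the joining path is kept, as it is the measure of the descent in
  \<open>no_conf_if_linked\<close>.\<close>

definition has_conf :: "nat \<Rightarrow> bool" where
  "has_conf n \<longleftrightarrow> (\<exists>a b c w \<alpha>0 \<alpha>1 \<sigma> \<beta>0 \<beta>1 \<upsilon> \<tau> A0 A1 S B0 B1 Y T.
     conf a b c w \<alpha>0 \<alpha>1 \<sigma> \<beta>0 \<beta>1 \<upsilon> \<tau> A0 A1 S B0 B1 Y T \<and> length \<sigma> = n)"

text \<open>\<open>swap_parity\<close> asks for a return path through \<open>e\<close> of prescribed
  parity. The two arcs of an odd circuit differ in parity, so one of them fits.\<close>

lemma choose_\<beta>: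
  assumes "conf a b c w \<alpha>0 \<alpha>1 \<sigma> \<beta>0 \<beta>1 \<upsilon> \<tau> A0 A1 S B0 B1 Y T"
  obtains \<beta> B where "pth G c \<beta> w B" "e \<notin> pedges \<beta>" "B \<subseteq> B0 \<union> B1" "even (n + length \<beta>)"
  using confD(4,5,11,12,27)[OF assms] that[of \<beta>0 B0] that[of \<beta>1 B1] by (cases "even (n + length \<beta>0)") auto

text \<open>In the next three lemmas \<open>W\<close> has the parity of one of the two routes from its start to \<open>y\<close>. Replacing
  that route by \<open>W\<close> keeps the conflict, and the resulting odd circuit meets the joining path in \<open>y\<close> only.\<close>

lemma shorten_tail:
  assumes C: "conf a b c w \<alpha>0 \<alpha>1 (\<sigma>1 @ \<sigma>2) \<beta>0 \<beta>1 \<upsilon> (\<tau>1 @ \<tau>2) A0 A1 (S1 \<union> S2) B0 B1 Y (T1 \<union> T2)"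
    and t: "pth G u \<tau>1 x T1" "pth G x \<tau>2 a T2" "T1 \<inter> T2 \<subseteq> {x}"
    and s: "pth G b \<sigma>1 y S1" "pth G y \<sigma>2 c S2" "S1 \<inter> S2 \<subseteq> {y}" "y \<noteq> b"
    and W: "pth G x W y V" "e \<notin> pedges W" "V \<inter> (A0 \<union> A1 \<union> (S1 \<union> S2) \<union> B0 \<union> B1 \<union> Y \<union> (T1 \<union> T2)) \<subseteq> {x, y}"
    and ev: "even (length W + length \<tau>2 + length \<alpha>0 + length \<sigma>1)"
  shows "has_conf (length \<sigma>2)"
proof -
  note c = confD[OF C]
  \<comment> \<open>The return path \<open>z\<close> below runs along \<open>\<sigma>2\<close> and
    \<open>\<beta>\<close> and through \<open>e\<close>, which is the summand 1, back to
    \<open>x\<close>; \<open>\<beta>\<close> gives it the parity of \<open>W\<close>.\<close>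
  obtain \<beta> B where \<beta>: "pth G c \<beta> w B" "e \<notin> pedges \<beta>" "B \<subseteq> B0 \<union> B1"
    "even ((length W + length \<sigma>2 + length \<upsilon> + 1 + length \<tau>1) + length \<beta>)"
    using choose_\<beta>[OF C] .
  note m = pth_mem[OF c(1)] pth_mem[OF c(2)] pth_mem[OF c(4)] pth_mem[OF c(5)] pth_mem[OF c(6)]
    pth_mem[OF t(1)] pth_mem[OF t(2)] pth_mem[OF s(1)] pth_mem[OF s(2)]
  note F = c(15-25) t(3) s(3,4) W(3) \<beta>(3) m
  note E = c(8-14)[simplified]
  have xy: "x \<noteq> y" using F by (simp only: set_logic; metis)
  have q: "pth G x (\<tau>2 @ \<alpha>0 @ \<sigma>1) y (T2 \<union> (A0 \<union> S1))"
    by (rule pth_append[OF t(2) pth_append[OF c(1) s(1)]]) (use F in \<open>simp only: set_logic; metis\<close>)+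
  have q': "pth G x (\<tau>2 @ \<alpha>1 @ \<sigma>1) y (T2 \<union> (A1 \<union> S1))"
    by (rule pth_append[OF t(2) pth_append[OF c(2) s(1)]]) (use F in \<open>simp only: set_logic; metis\<close>)+
  have z0: "pth G w (\<upsilon> @ [(v, e, u)] @ \<tau>1) x (Y \<union> T1)"
    by (rule pth_e[OF c(6) t(1)]) (use F in \<open>simp only: set_logic; metis\<close>)
  have z: "pth G y (\<sigma>2 @ \<beta> @ (\<upsilon> @ [(v, e, u)] @ \<tau>1)) x (S2 \<union> (B \<union> (Y \<union> T1)))"
    by (rule pth_append[OF s(2) pth_append[OF \<beta>(1) z0]]) (use F in \<open>simp only: set_logic; metis\<close>)+
  have sw: "even (fw d W + fw d (\<tau>2 @ \<alpha>0 @ \<sigma>1))"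
  proof (rule swap_parity[OF W(1) q W(2) _ z _ _ _ _ xy])
    show "V \<inter> (T2 \<union> (A0 \<union> S1)) \<subseteq> {x, y}" "V \<inter> (S2 \<union> (B \<union> (Y \<union> T1))) \<subseteq> {x, y}"
      "(T2 \<union> (A0 \<union> S1)) \<inter> (S2 \<union> (B \<union> (Y \<union> T1))) \<subseteq> {x, y}"
      using F by (simp only: set_logic; metis)+
    show "even (length W + length (\<tau>2 @ \<alpha>0 @ \<sigma>1))" using ev unfolding length_append even_add by argo
    show "even (length W + length (\<sigma>2 @ \<beta> @ (\<upsilon> @ [(v, e, u)] @ \<tau>1)))" using \<beta>(4) by simp argo
  qed (use E in simp_all)
  \<comment> \<open>The route along \<open>\<alpha>0\<close> is given up; \<open>W\<close> takes its
    place opposite the route along \<open>\<alpha>1\<close>.\<close>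
  have "conf x y c w W (\<tau>2 @ \<alpha>1 @ \<sigma>1) \<sigma>2 \<beta>0 \<beta>1 \<upsilon> \<tau>1 V (T2 \<union> (A1 \<union> S1)) S2 B0 B1 Y T1"
  proof (rule confI[OF W(1) q' s(2) c(4,5,6) t(1) W(2)])
    show "V \<inter> (T2 \<union> (A1 \<union> S1)) \<subseteq> {x, y}" "(V \<union> (T2 \<union> (A1 \<union> S1))) \<inter> S2 \<subseteq> {y}" "S2 \<inter> (B0 \<union> B1) \<subseteq> {c}"
      "(V \<union> (T2 \<union> (A1 \<union> S1))) \<inter> (B0 \<union> B1) \<subseteq> S2" "T1 \<inter> (V \<union> (T2 \<union> (A1 \<union> S1))) \<subseteq> {x}"
      "Y \<inter> (V \<union> (T2 \<union> (A1 \<union> S1)) \<union> S2 \<union> T1) \<subseteq> {}" "T1 \<inter> (S2 \<union> B0 \<union> B1) \<subseteq> {}"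
      using F by (simp only: set_logic; metis)+
    show "odd (length W + length (\<tau>2 @ \<alpha>1 @ \<sigma>1))" using ev c(26) by simp argo
    show "odd (fw d W + fw d (\<tau>2 @ \<alpha>1 @ \<sigma>1) + fw d \<beta>0 + fw d \<beta>1)"
      using sw c(28) unfolding fw_simps(3) even_add by argo
  qed (use E c xy in simp_all)
  then show ?thesis unfolding has_conf_def by blast
qed

lemma shorten_arc1:
  assumes C: "conf a b c w (\<xi>1 @ \<xi>2) \<alpha>1 (\<sigma>1 @ \<sigma>2) \<beta>0 \<beta>1 \<upsilon> \<tau> (X1 \<union> X2) A1 (S1 \<union> S2) B0 B1 Y T"
    and t: "pth G a \<xi>1 x X1" "pth G x \<xi>2 b X2" "X1 \<inter> X2 \<subseteq> {x}" "x \<noteq> a" "x \<noteq> b"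
    and s: "pth G b \<sigma>1 y S1" "pth G y \<sigma>2 c S2" "S1 \<inter> S2 \<subseteq> {y}" "y \<noteq> b"
    and W: "pth G x W y V" "e \<notin> pedges W" "V \<inter> ((X1 \<union> X2) \<union> A1 \<union> (S1 \<union> S2) \<union> B0 \<union> B1 \<union> Y \<union> T) \<subseteq> {x, y}"
    and ev: "even (length \<xi>1 + length W + length \<alpha>1 + length \<sigma>1)"
  shows "has_conf (length \<sigma>2)"
proof -
  note c = confD[OF C]
  obtain \<beta> B where \<beta>: "pth G c \<beta> w B" "e \<notin> pedges \<beta>" "B \<subseteq> B0 \<union> B1"
    "even ((length \<xi>1 + length W + length \<sigma>2 + length \<upsilon> + 1 + length \<tau>) + length \<beta>)"
    using choose_\<beta>[OF C] .
  note m = pth_mem[OF t(1)] pth_mem[OF t(2)] pth_mem[OF c(2)] pth_mem[OF c(4)] pth_mem[OF c(5)] pth_mem[OF c(6)]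
    pth_mem[OF c(7)] pth_mem[OF s(1)] pth_mem[OF s(2)]
  note F = c(15-25) t(3-5) s(3,4) W(3) \<beta>(3) m
  note E = c(8-14)[simplified]
  have xy: "x \<noteq> y" "a \<noteq> y" using F by (simp only: set_logic; metis)+
  have p: "pth G a (\<xi>1 @ W) y (X1 \<union> V)"
    by (rule pth_append[OF t(1) W(1)]) (use F in \<open>simp only: set_logic; metis\<close>)
  have q: "pth G a (\<alpha>1 @ \<sigma>1) y (A1 \<union> S1)"
    by (rule pth_append[OF c(2) s(1)]) (use F in \<open>simp only: set_logic; metis\<close>)
  have z: "pth G y (\<sigma>2 @ \<beta> @ (\<upsilon> @ [(v, e, u)] @ \<tau>)) a (S2 \<union> (B \<union> (Y \<union> T)))"
    by (rule pth_append[OF s(2) pth_append[OF \<beta>(1) pth_e[OF c(6,7)]]]) (use F in \<open>simp only: set_logic; metis\<close>)+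
  have sw: "even (fw d (\<xi>1 @ W) + fw d (\<alpha>1 @ \<sigma>1))"
  proof (rule swap_parity[OF p q _ _ z _ _ _ _ xy(2)])
    show "(X1 \<union> V) \<inter> (A1 \<union> S1) \<subseteq> {a, y}" "(X1 \<union> V) \<inter> (S2 \<union> (B \<union> (Y \<union> T))) \<subseteq> {a, y}"
      "(A1 \<union> S1) \<inter> (S2 \<union> (B \<union> (Y \<union> T))) \<subseteq> {a, y}"
      using F by (simp only: set_logic; metis)+
    show "even (length (\<xi>1 @ W) + length (\<alpha>1 @ \<sigma>1))" using ev unfolding length_append even_add by argo
    show "even (length (\<xi>1 @ W) + length (\<sigma>2 @ \<beta> @ (\<upsilon> @ [(v, e, u)] @ \<tau>)))" using \<beta>(4) by simp argo
  qed (use E W(2) in simp_all)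
  have r: "pth G x (\<xi>2 @ \<sigma>1) y (X2 \<union> S1)"
    by (rule pth_append[OF t(2) s(1)]) (use F in \<open>simp only: set_logic; metis\<close>)
  have T': "pth G u (\<tau> @ \<xi>1) x (T \<union> X1)"
    by (rule pth_append[OF c(7) t(1)]) (use F in \<open>simp only: set_logic; metis\<close>)
  \<comment> \<open>\<open>\<xi>1\<close> moves from the circuit to the tail. The conflict persists
    because \<open>\<xi>1 @ W\<close> and \<open>\<alpha>1 @ \<sigma>1\<close> have equal counts
    modulo 2.\<close>
  have "conf x y c w W (\<xi>2 @ \<sigma>1) \<sigma>2 \<beta>0 \<beta>1 \<upsilon> (\<tau> @ \<xi>1) V (X2 \<union> S1) S2 B0 B1 Y (T \<union> X1)"
  proof (rule confI[OF W(1) r s(2) c(4,5,6) T' W(2)])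
    show "V \<inter> (X2 \<union> S1) \<subseteq> {x, y}" "(V \<union> (X2 \<union> S1)) \<inter> S2 \<subseteq> {y}" "S2 \<inter> (B0 \<union> B1) \<subseteq> {c}"
      "(V \<union> (X2 \<union> S1)) \<inter> (B0 \<union> B1) \<subseteq> S2" "(T \<union> X1) \<inter> (V \<union> (X2 \<union> S1)) \<subseteq> {x}"
      "Y \<inter> (V \<union> (X2 \<union> S1) \<union> S2 \<union> (T \<union> X1)) \<subseteq> {}" "(T \<union> X1) \<inter> (S2 \<union> B0 \<union> B1) \<subseteq> {}"
      using F by (simp only: set_logic; metis)+
    show "odd (length W + length (\<xi>2 @ \<sigma>1))" using ev c(26) by simp presburger
    show "odd (fw d W + fw d (\<xi>2 @ \<sigma>1) + fw d \<beta>0 + fw d \<beta>1)"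
      using sw c(28) unfolding fw_simps(3) even_add by argo
  qed (use E c xy in simp_all)
  then show ?thesis unfolding has_conf_def by blast
qed

lemma shorten_arc2:
  assumes C: "conf a b c w (\<xi>1 @ \<xi>2) \<alpha>1 (\<sigma>1 @ \<sigma>2) \<beta>0 \<beta>1 \<upsilon> \<tau> (X1 \<union> X2) A1 (S1 \<union> S2) B0 B1 Y T"
    and t: "pth G a \<xi>1 x X1" "pth G x \<xi>2 b X2" "X1 \<inter> X2 \<subseteq> {x}" "x \<noteq> a" "x \<noteq> b"
    and s: "pth G b \<sigma>1 y S1" "pth G y \<sigma>2 c S2" "S1 \<inter> S2 \<subseteq> {y}" "y \<noteq> b"
    and W: "pth G x W y V" "e \<notin> pedges W" "V \<inter> ((X1 \<union> X2) \<union> A1 \<union> (S1 \<union> S2) \<union> B0 \<union> B1 \<union> Y \<union> T) \<subseteq> {x, y}"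
    and ev: "even (length W + length \<xi>2 + length \<sigma>1)"
  shows "has_conf (length \<sigma>2)"
proof -
  note c = confD[OF C]
  obtain \<beta> B where \<beta>: "pth G c \<beta> w B" "e \<notin> pedges \<beta>" "B \<subseteq> B0 \<union> B1"
    "even ((length \<xi>1 + length W + length \<sigma>2 + length \<upsilon> + 1 + length \<tau>) + length \<beta>)"
    using choose_\<beta>[OF C] .
  note m = pth_mem[OF t(1)] pth_mem[OF t(2)] pth_mem[OF c(2)] pth_mem[OF c(4)] pth_mem[OF c(5)] pth_mem[OF c(6)]
    pth_mem[OF c(7)] pth_mem[OF s(1)] pth_mem[OF s(2)]
  note F = c(15-25) t(3-5) s(3,4) W(3) \<beta>(3) m
  note E = c(8-14)[simplified]
  have xy: "x \<noteq> y" "a \<noteq> y" using F by (simp only: set_logic; metis)+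
  have p: "pth G a (\<xi>1 @ W) y (X1 \<union> V)"
    by (rule pth_append[OF t(1) W(1)]) (use F in \<open>simp only: set_logic; metis\<close>)
  have q: "pth G x (\<xi>2 @ \<sigma>1) y (X2 \<union> S1)"
    by (rule pth_append[OF t(2) s(1)]) (use F in \<open>simp only: set_logic; metis\<close>)
  have z: "pth G y (\<sigma>2 @ \<beta> @ (\<upsilon> @ [(v, e, u)] @ \<tau>) @ \<xi>1) x (S2 \<union> (B \<union> ((Y \<union> T) \<union> X1)))"
    by (rule pth_append[OF s(2) pth_append[OF \<beta>(1) pth_append[OF pth_e[OF c(6,7)] t(1)]]])
      (use F in \<open>simp only: set_logic; metis\<close>)+
  have sw: "even (fw d W + fw d (\<xi>2 @ \<sigma>1))"
  proof (rule swap_parity[OF W(1) q W(2) _ z _ _ _ _ xy(1)])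
    show "V \<inter> (X2 \<union> S1) \<subseteq> {x, y}" "V \<inter> (S2 \<union> (B \<union> ((Y \<union> T) \<union> X1))) \<subseteq> {x, y}"
      "(X2 \<union> S1) \<inter> (S2 \<union> (B \<union> ((Y \<union> T) \<union> X1))) \<subseteq> {x, y}"
      using F by (simp only: set_logic; metis)+
    show "even (length W + length (\<xi>2 @ \<sigma>1))" using ev unfolding length_append even_add by argo
    show "even (length W + length (\<sigma>2 @ \<beta> @ (\<upsilon> @ [(v, e, u)] @ \<tau>) @ \<xi>1))" using \<beta>(4) by simp presburger
  qed (use E W(2) in simp_all)
  have r: "pth G a (\<alpha>1 @ \<sigma>1) y (A1 \<union> S1)"
    by (rule pth_append[OF c(2) s(1)]) (use F in \<open>simp only: set_logic; metis\<close>)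
  \<comment> \<open>Here \<open>W\<close> replaces \<open>\<xi>2 @ \<sigma>1\<close>, and the tail
    is kept.\<close>
  have "conf a y c w (\<xi>1 @ W) (\<alpha>1 @ \<sigma>1) \<sigma>2 \<beta>0 \<beta>1 \<upsilon> \<tau> (X1 \<union> V) (A1 \<union> S1) S2 B0 B1 Y T"
  proof (rule confI[OF p r s(2) c(4-7)])
    show "(X1 \<union> V) \<inter> (A1 \<union> S1) \<subseteq> {a, y}" "((X1 \<union> V) \<union> (A1 \<union> S1)) \<inter> S2 \<subseteq> {y}" "S2 \<inter> (B0 \<union> B1) \<subseteq> {c}"
      "((X1 \<union> V) \<union> (A1 \<union> S1)) \<inter> (B0 \<union> B1) \<subseteq> S2" "T \<inter> ((X1 \<union> V) \<union> (A1 \<union> S1)) \<subseteq> {a}"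
      "Y \<inter> ((X1 \<union> V) \<union> (A1 \<union> S1) \<union> S2 \<union> T) \<subseteq> {}" "T \<inter> (S2 \<union> B0 \<union> B1) \<subseteq> {}"
      using F by (simp only: set_logic; metis)+
    show "odd (length (\<xi>1 @ W) + length (\<alpha>1 @ \<sigma>1))" using ev c(26) by simp presburger
    show "odd (fw d (\<xi>1 @ W) + fw d (\<alpha>1 @ \<sigma>1) + fw d \<beta>0 + fw d \<beta>1)"
      using sw c(28) unfolding fw_simps(3) even_add by argo
  qed (use E c xy W(2) in simp_all)
  then show ?thesis unfolding has_conf_def by blast
qed

text \<open>\<open>W\<close> joins the two tails and so takes the place of \<open>e\<close>. The
  resulting ring avoids \<open>e\<close>, and \<open>ring_even\<close> contradicts the
  conflict.\<close>

lemma conf_no_bypass: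
  assumes C: "conf a b c w \<alpha>0 \<alpha>1 \<sigma> \<beta>0 \<beta>1 (\<upsilon>1 @ \<upsilon>2) (\<tau>1 @ \<tau>2) A0 A1 S B0 B1 (Y1 \<union> Y2) (T1 \<union> T2)"
    and t: "pth G u \<tau>1 x T1" "pth G x \<tau>2 a T2" "T1 \<inter> T2 \<subseteq> {x}"
    and s: "pth G w \<upsilon>1 y Y1" "pth G y \<upsilon>2 v Y2" "Y1 \<inter> Y2 \<subseteq> {y}"
    and W: "pth G x W y V" "e \<notin> pedges W" "V \<inter> (A0 \<union> A1 \<union> S \<union> B0 \<union> B1 \<union> (Y1 \<union> Y2) \<union> (T1 \<union> T2)) \<subseteq> {x, y}"
  shows False
proof -
  note c = confD[OF C]
  note m = pth_mem[OF c(1)] pth_mem[OF c(2)] pth_mem[OF c(3)] pth_mem[OF c(4)] pth_mem[OF c(5)] 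
    pth_mem[OF t(1)] pth_mem[OF t(2)] pth_mem[OF s(1)] pth_mem[OF s(2)]
  note F = c(15-25) t(3) s(3) W(3) m
  note E = c(8-14)[simplified]
  have o: "pth G w (\<upsilon>1 @ prev W @ \<tau>2) a (Y1 \<union> (V \<union> T2))"
    by (rule pth_append[OF s(1) pth_append[OF pth_prev[OF W(1)] t(2)]]) (use F in \<open>simp only: set_logic; metis\<close>)+
  have "ring a b c w \<alpha>0 \<alpha>1 \<sigma> \<beta>0 \<beta>1 (\<upsilon>1 @ prev W @ \<tau>2) A0 A1 S B0 B1 (Y1 \<union> (V \<union> T2))"
    unfolding ring_def
  proof (intro conjI)
    show "(Y1 \<union> (V \<union> T2)) \<inter> (A0 \<union> A1) \<subseteq> {a}" "(Y1 \<union> (V \<union> T2)) \<inter> (B0 \<union> B1) \<subseteq> {w}" "(Y1 \<union> (V \<union> T2)) \<inter> S \<subseteq> {}"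
      using F by (simp only: set_logic; metis)+
  qed (use c o in simp_all)
  then have "even (fw d \<alpha>0 + fw d \<alpha>1 + fw d \<beta>0 + fw d \<beta>1)" by (rule ring_even) (use E W(2) in simp_all)
  then show False using c(28) by simp
qed

text \<open>The even circuits of the ring on \<open>A\<close> and on the part of \<open>B\<close> up to \<open>y\<close> avoid \<open>e\<close>; comparing them
  with the configuration shows that the arc of \<open>B\<close> from \<open>y\<close> to \<open>w\<close> is odd. One of the two tetrahedra obtained
  by routing through either arc of \<open>A\<close> then has the wrong parity.\<close>

lemma conf_no_tail_to_arc:
  assumes C: "conf a b c w \<alpha>0 \<alpha>1 \<sigma> (\<gamma>1 @ \<gamma>2) \<beta>1 \<upsilon> (\<tau>1 @ \<tau>2) A0 A1 S (C1 \<union> C2) B1 Y (T1 \<union> T2)"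
    and t: "pth G u \<tau>1 x T1" "pth G x \<tau>2 a T2" "T1 \<inter> T2 \<subseteq> {x}"
    and s: "pth G c \<gamma>1 y C1" "pth G y \<gamma>2 w C2" "C1 \<inter> C2 \<subseteq> {y}" "y \<noteq> c" "y \<noteq> w"
    and W: "pth G x W y V" "e \<notin> pedges W" "V \<inter> (A0 \<union> A1 \<union> S \<union> (C1 \<union> C2) \<union> B1 \<union> Y \<union> (T1 \<union> T2)) \<subseteq> {x, y}"
  shows False
proof -
  note c = confD[OF C]
  note m = pth_mem[OF c(1)] pth_mem[OF c(2)] pth_mem[OF c(3)] pth_mem[OF c(5)] pth_mem[OF c(6)]
    pth_mem[OF t(1)] pth_mem[OF t(2)] pth_mem[OF s(1)] pth_mem[OF s(2)]
  note F = c(15-25) t(3) s(3-5) W(3) m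
  note E = c(8-14)[simplified]
  have o: "pth G y (prev W @ \<tau>2) a (V \<union> T2)"
    by (rule pth_append[OF pth_prev[OF W(1)] t(2)]) (use F in \<open>simp only: set_logic; metis\<close>)
  have b: "pth G c (\<beta>1 @ prev \<gamma>2) y (B1 \<union> C2)"
    by (rule pth_append[OF c(5) pth_prev[OF s(2)]]) (use F in \<open>simp only: set_logic; metis\<close>)
  have "ring a b c y \<alpha>0 \<alpha>1 \<sigma> \<gamma>1 (\<beta>1 @ prev \<gamma>2) (prev W @ \<tau>2) A0 A1 S C1 (B1 \<union> C2) (V \<union> T2)"
    unfolding ring_def
  proof (intro conjI)
    show "C1 \<inter> (B1 \<union> C2) \<subseteq> {c, y}" "S \<inter> (C1 \<union> (B1 \<union> C2)) \<subseteq> {c}" "(A0 \<union> A1) \<inter> (C1 \<union> (B1 \<union> C2)) \<subseteq> S"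
      "(V \<union> T2) \<inter> (A0 \<union> A1) \<subseteq> {a}" "(V \<union> T2) \<inter> (C1 \<union> (B1 \<union> C2)) \<subseteq> {y}" "(V \<union> T2) \<inter> S \<subseteq> {}"
      using F by (simp only: set_logic; metis)+
    show "odd (length \<gamma>1 + length (\<beta>1 @ prev \<gamma>2))"
      using c(27) unfolding length_append even_add prev_simps by argo
  qed (use c o b s in simp_all)
  then have "even (fw d \<alpha>0 + fw d \<alpha>1 + fw d \<gamma>1 + fw d (\<beta>1 @ prev \<gamma>2))" by (rule ring_even) (use E W(2) in simp_all)
  \<comment> \<open>The ring traverses \<open>\<gamma>2\<close> backwards and the configuration
    forwards, so the two demands differ by the length of \<open>\<gamma>2\<close>.\<close>
  then have odd: "odd (length \<gamma>2)"
    using c(28) even_fw_prev'[OF s(2)] E unfolding fw_simps(3) even_add by auto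
  have p2: "pth G x (prev (\<upsilon> @ [(v, e, u)] @ \<tau>1)) w (Y \<union> T1)"
    by (rule pth_prev, rule pth_e[OF c(6) t(1)]) (use F in \<open>simp only: set_logic; metis\<close>)
  have ap: "apex G x c w y (\<tau>2 @ \<alpha> @ \<sigma>) (prev (\<upsilon> @ [(v, e, u)] @ \<tau>1)) W \<beta>1 (prev \<gamma>2) (prev \<gamma>1)"
    if "pth G a \<alpha> b A" "A \<subseteq> A0 \<union> A1" for \<alpha> A
  proof -
    have p1: "pth G x (\<tau>2 @ \<alpha> @ \<sigma>) c (T2 \<union> (A \<union> S))"
      by (rule pth_append[OF t(2) pth_append[OF that(1) c(3)]]) (use F that(2) in \<open>simp only: set_logic; metis\<close>)+
    show ?thesis
    proof (rule apexI[OF p1 p2 W(1) c(5) pth_prev[OF s(2)] pth_prev[OF s(1)]])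
      have "x \<noteq> c" "x \<noteq> w" "x \<noteq> y" "c \<noteq> w" using F by (simp only: set_logic; metis)+
      then show "distinct [x, c, w, y]" using s(4,5) by simp
    qed (use F that(2) in \<open>simp only: set_logic; metis\<close>)+
  qed
  show False
  proof (cases "odd (length \<beta>1)")
    case True
    then have "odd (length \<gamma>1)" using odd c(27) by simp
    then have "even (length (\<tau>2 @ \<alpha> @ \<sigma>) + length (prev (\<upsilon> @ [(v, e, u)] @ \<tau>1)) + length W)"
      if "pth G a \<alpha> b A" "A \<subseteq> A0 \<union> A1" for \<alpha> A
      using apex_parity(1)[OF multigraph not_obstructed ap[OF that]] odd True by simp
    \<comment> \<open>\<open>\<alpha>0\<close> and \<open>\<alpha>1\<close> differ in parity, while
      everything else in the two tetrahedra is the same.\<close>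
    from this[OF c(1)] this[OF c(2)] show False using c(26) by simp argo
  next
    case False
    then have "even (length \<gamma>1)" using odd c(27) by simp
    then have "even (length (\<tau>2 @ \<alpha> @ \<sigma>))"
      if "pth G a \<alpha> b A" "A \<subseteq> A0 \<union> A1" for \<alpha> A
      using apex_parity(2)[OF multigraph not_obstructed ap[OF that]] odd False by simp
    from this[OF c(1)] this[OF c(2)] show False using c(26) by simp argo
  qed
qed

text \<open>Deleting the arc of \<open>A\<close> from \<open>a\<close> to \<open>b\<close> or the one from \<open>x\<close> to \<open>b\<close> leaves a tetrahedron over \<open>B\<close> with
  apex \<open>x\<close> or \<open>a\<close>. As \<open>\<xi>1\<close> is odd, one of the two has the wrong parity.\<close>

lemma conf_no_arc_to_arc_odd:
  assumes C: "conf a b c w (\<xi>1 @ \<xi>2) \<alpha>1 \<sigma> (\<gamma>1 @ \<gamma>2) \<beta>1 \<upsilon> \<tau> (X1 \<union> X2) A1 S (C1 \<union> C2) B1 Y T"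
    and t: "pth G a \<xi>1 x X1" "pth G x \<xi>2 b X2" "X1 \<inter> X2 \<subseteq> {x}" "x \<noteq> a" "x \<noteq> b"
    and s: "pth G c \<gamma>1 y C1" "pth G y \<gamma>2 w C2" "C1 \<inter> C2 \<subseteq> {y}" "y \<noteq> c" "y \<noteq> w"
    and W: "pth G x W y V" "e \<notin> pedges W" "V \<inter> ((X1 \<union> X2) \<union> A1 \<union> S \<union> (C1 \<union> C2) \<union> B1 \<union> Y \<union> T) \<subseteq> {x, y}"
    and odd: "odd (length \<xi>1)" "even (length \<gamma>2)"
  shows False
proof -
  note c = confD[OF C]
  note m = pth_mem[OF t(1)] pth_mem[OF t(2)] pth_mem[OF c(2)] pth_mem[OF c(3)] pth_mem[OF c(5)] pth_mem[OF c(6)]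
    pth_mem[OF c(7)] pth_mem[OF s(1)] pth_mem[OF s(2)]
  note F = c(15-25) t(3-5) s(3-5) W(3) m
  note E = c(8-14)[simplified]
  have rho: "pth G a (prev (\<upsilon> @ [(v, e, u)] @ \<tau>)) w (Y \<union> T)"
    by (rule pth_prev, rule pth_e[OF c(6,7)]) (use F in \<open>simp only: set_logic; metis\<close>)
  have x1: "pth G x (\<xi>2 @ \<sigma>) c (X2 \<union> S)"
    by (rule pth_append[OF t(2) c(3)]) (use F in \<open>simp only: set_logic; metis\<close>)
  have x2: "pth G x (prev \<xi>1 @ prev (\<upsilon> @ [(v, e, u)] @ \<tau>)) w (X1 \<union> (Y \<union> T))"
    by (rule pth_append[OF pth_prev[OF t(1)] rho]) (use F in \<open>simp only: set_logic; metis\<close>)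
  have a1: "pth G a (\<alpha>1 @ \<sigma>) c (A1 \<union> S)"
    by (rule pth_append[OF c(2) c(3)]) (use F in \<open>simp only: set_logic; metis\<close>)
  have a3: "pth G a (\<xi>1 @ W) y (X1 \<union> V)"
    by (rule pth_append[OF t(1) W(1)]) (use F in \<open>simp only: set_logic; metis\<close>)
  have apx: "apex G x c w y (\<xi>2 @ \<sigma>) (prev \<xi>1 @ prev (\<upsilon> @ [(v, e, u)] @ \<tau>)) W \<beta>1 (prev \<gamma>2) (prev \<gamma>1)"
  proof (rule apexI[OF x1 x2 W(1) c(5) pth_prev[OF s(2)] pth_prev[OF s(1)]])
    have "x \<noteq> c" "x \<noteq> w" "x \<noteq> y" "c \<noteq> w" using F by (simp only: set_logic; metis)+
      then show "distinct [x, c, w, y]" using s(4,5) by simp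
  qed (use F in \<open>simp only: set_logic; metis\<close>)+
  have apa: "apex G a c w y (\<alpha>1 @ \<sigma>) (prev (\<upsilon> @ [(v, e, u)] @ \<tau>)) (\<xi>1 @ W) \<beta>1 (prev \<gamma>2) (prev \<gamma>1)"
  proof (rule apexI[OF a1 rho a3 c(5) pth_prev[OF s(2)] pth_prev[OF s(1)]])
    have "a \<noteq> c" "a \<noteq> w" "a \<noteq> y" "c \<noteq> w" using F by (simp only: set_logic; metis)+
      then show "distinct [a, c, w, y]" using s(4,5) by simp
  qed (use F in \<open>simp only: set_logic; metis\<close>)+
  note AP = apex_parity(2)[OF multigraph not_obstructed]
  \<comment> \<open>\<open>apex_parity\<close> applies at the vertex opposite to the odd arc. If
    this is \<open>\<beta>1\<close>, the vertex is \<open>y\<close>, and the paths \<open>W\<close>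
    and \<open>\<xi>1 @ W\<close> leading to it cannot both be even. If it is
    \<open>\<gamma>1\<close>, the vertex is \<open>w\<close>, and again the two paths differ by the
    odd \<open>\<xi>1\<close>.\<close>
  show False
  proof (cases "odd (length \<beta>1)")
    case True
    then have "even (length \<gamma>1)" using odd c(27) by simp
    then show False
      using AP[OF apex_rotate[OF apex_rotate[OF apx]]] AP[OF apex_rotate[OF apex_rotate[OF apa]]] True odd by simp
  next
    case False
    then have "odd (length \<gamma>1)" using odd c(27) by simp
    then show False using AP[OF apex_rotate[OF apx]] AP[OF apex_rotate[OF apa]] False odd by simp
  qed
qed

end

section \<open>From two disagreeing paths to a configuration\<close>

lemma path_append_edges: "path G u (p @ q) v \<Longrightarrow> pedges p \<inter> pedges q = {}"
  using path_distinct_pedges[of G u "p @ q" v] by (auto simp: pedges_def)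

text \<open>\<open>q\<close> follows \<open>p\<close> along \<open>\<sigma>\<close>, leaves it at
  \<open>c\<close> and first meets it again at \<open>w\<close>; \<open>R\<close> is this excursion
  and \<open>\<beta>\<close> the bypassed part of \<open>p\<close>. The first edge of
  \<open>\<beta>\<close> is not on \<open>q\<close>, which passes \<open>c\<close> only once; this
  edge makes rerouting a descent.\<close>

lemma deviation:
  assumes "path G b p v" "path G b q v" "p \<noteq> q"
  shows "\<exists>\<sigma> c \<beta> R p' q' w. p = \<sigma> @ \<beta> @ p' \<and> q = \<sigma> @ R @ q' \<and> path G b \<sigma> c \<and> path G c \<beta> w \<and> path G w p' v \<and>
     path G c R w \<and> path G w q' v \<and> c \<noteq> w \<and> pverts c R \<inter> pverts b p \<subseteq> {c, w} \<and>
     (\<exists>g\<in>pedges \<beta>. g \<notin> pedges q)"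
  using assms
proof (induction p arbitrary: b q)
  case Nil
  then have "b = v" by simp
  then have "q = []" using Nil path_self by metis
  then show ?case using Nil by simp
next
  case (Cons s p1)
  obtain a e m where s: "s = (a, e, m)" by (cases s)
  have p: "path G m p1 v" "b \<notin> pverts m p1" "e \<in> edges G" "ends G e = {b, m}" "a = b" "b \<in> verts G"
    using Cons.prems s by auto
  have "b \<noteq> v" using p path_end_in_pverts by metis
  then obtain f m' q1 where q: "q = (b, f, m') # q1" using Cons.prems(2) by (cases q) auto
  have q1: "path G m' q1 v" "b \<notin> pverts m' q1" "ends G f = {b, m'}" using Cons.prems(2) q by auto
  have "m \<noteq> b" "m' \<noteq> b" using p(2) q1(2) by auto
  have eq1: "e \<notin> pedges q1" using pedge_ends_subset[OF q1(1), of e] p(4) q1(2) by auto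
  show ?case
  proof (cases "e = f")
    case True
    then have "m = m'" using p(4) q1(3) \<open>m \<noteq> b\<close> \<open>m' \<noteq> b\<close> by (auto simp: doubleton_eq_iff)
    then have ne: "p1 \<noteq> q1" using Cons.prems(3) s q p True by auto
    obtain \<sigma> c \<beta> R p' q' w where D: "p1 = \<sigma> @ \<beta> @ p'" "q1 = \<sigma> @ R @ q'" "path G m \<sigma> c" "path G c \<beta> w" "path G w p' v"
     "path G c R w" "path G w q' v" "c \<noteq> w" "pverts c R \<inter> pverts m p1 \<subseteq> {c, w}" "\<exists>g\<in>pedges \<beta>. g \<notin> pedges q1"
      using Cons.IH[OF p(1) _ ne] q1(1) \<open>m = m'\<close> by blast
    obtain g where g: "g \<in> pedges \<beta>" "g \<notin> pedges q1" using D(10) by blast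
    have "g \<noteq> f" using g(1) D(1) pedge_ends_subset[OF p(1), of g] p(2) q1(3) by auto
    have "pverts m (\<sigma> @ R @ q') = pverts m q1" using D by simp
    have bR: "b \<notin> pverts c R"
    proof -
      have "pverts c R \<subseteq> pverts c (R @ q')" using pverts_append[OF D(6)] by auto
      also have "\<dots> \<subseteq> pverts m q1" using pverts_append[OF D(3), of "R @ q'"] D(2) by auto
      finally show ?thesis using q1(2) \<open>m = m'\<close> by auto
    qed
    have b\<sigma>: "b \<notin> pverts m \<sigma>" using pverts_append[OF D(3), of "\<beta> @ p'"] D(1) p(2) by auto
    show ?thesis
    proof (rule exI[where x = "s # \<sigma>"], rule exI[where x = c], rule exI[where x = \<beta>], rule exI[where x = R],
        rule exI[where x = p'], rule exI[where x = q'], rule exI[where x = w], intro conjI)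
      show "path G b (s # \<sigma>) c" using D(3) s p b\<sigma> by simp
      show "pverts c R \<inter> pverts b (s # p1) \<subseteq> {c, w}" using D(9) bR s by auto
      show "\<exists>g\<in>pedges \<beta>. g \<notin> pedges q" using g \<open>g \<noteq> f\<close> q by auto
      show "q = (s # \<sigma>) @ R @ q'" using D(2) q s True \<open>m = m'\<close> p by simp
    qed (use D in simp_all)
  next
    case False
    have hit: "v \<in> pverts m' q1" "v \<in> pverts m p1" using path_end_in_pverts[OF q1(1)] path_end_in_pverts[OF p(1)] by auto
    obtain r1 q' w where R: "q1 = r1 @ q'" "path G m' r1 w" "path G w q' v" "w \<in> pverts m p1" "pverts m' r1 \<inter> pverts m p1 = {w}"
      "pverts m' q1 = pverts m' r1 \<union> pverts w q'"
      by (rule path_first_hit[OF q1(1) hit(2,1)]) blast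
    obtain b1 p' where B: "p1 = b1 @ p'" "path G m b1 w" "path G w p' v" "pverts m p1 = pverts m b1 \<union> pverts w p'"
      by (rule path_split[OF p(1) R(4)]) blast
    have "b \<noteq> w" using R(4) p(2) by auto
    moreover have "path G b ((b, f, m') # r1) w" using R(2,6) q1 Cons.prems(2) q by auto
    moreover have "path G b ((b, e, m) # b1) w" using B p by auto
    moreover have "pverts b ((b, f, m') # r1) \<inter> pverts b (s # p1) \<subseteq> {b, w}" using R(5,6) q1(2) s p by auto
    moreover have "e \<notin> pedges q" using False eq1 q by auto
    moreover have "s # p1 = [] @ ((b, e, m) # b1) @ p'" "q = [] @ ((b, f, m') # r1) @ q'" "path G b [] b"
      using B(1) R(1) s q p by simp_all
    moreover have "\<exists>g\<in>pedges ((b, e, m) # b1). g \<notin> pedges q" using \<open>e \<notin> pedges q\<close> by simp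
    moreover note B(3) R(3)
    ultimately show ?thesis
      by - (rule exI[where x = "[]"], rule exI[where x = b], rule exI[where x = "(b, e, m) # b1"],
          rule exI[where x = "(b, f, m') # r1"], rule exI[where x = p'], rule exI[where x = q'],
          rule exI[where x = w], intro conjI)
  qed
qed

context critical
begin

lemma less_edges:
  assumes "g \<in> pedges Q1" "g \<notin> pedges Q'" "g \<notin> pedges Q2" "pedges Q' \<subseteq> pedges Q1 \<union> pedges Q2"
  shows "card (pedges Q' \<union> pedges Q2) < card (pedges Q1 \<union> pedges Q2)"
  using assms by (intro psubset_card_mono) auto

text \<open>Reroute \<open>Q1\<close> along \<open>Q2\<close> wherever this keeps the conflict with \<open>Q2\<close>. The first two excursions of \<open>Q2\<close> that
  cannot be used in this way close odd circuits with \<open>Q1\<close>: either in series, which is a configuration, or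
  crossing, which is a tetrahedron excluded by \<open>apex_parity\<close>.\<close>

lemma has_conf_if_conflict:
  assumes "pth G u Q1 v V1" "pth G u Q2 v V2" "e \<notin> pedges Q1" "e \<notin> pedges Q2" "odd (length Q1)" "odd (length Q2)"
    "odd (fw d Q1 + fw d Q2)"
  shows "\<exists>n. has_conf n"
  using assms
proof (induction "card (pedges Q1 \<union> pedges Q2)" arbitrary: Q1 V1 rule: less_induct)
  case less
  \<comment> \<open>A rerouted path may replace \<open>Q1\<close> if it keeps both parities, stays
    within the union and drops an edge that \<open>Q2\<close> does not use either.\<close>
  have IH: "\<exists>n. has_conf n" if "g \<in> pedges Q1" "g \<notin> pedges Q'" "g \<notin> pedges Q2" "pedges Q' \<subseteq> pedges Q1 \<union> pedges Q2"
    "pth G u Q' v V'" "odd (length Q')" "even (fw d Q1 + fw d Q')" for g Q' V'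
    using less.hyps[of Q' V'] less_edges[OF that(1-4)] less.prems that by auto
  have ne: "Q1 \<noteq> Q2" using less.prems(7) by auto
  obtain \<tau> a \<alpha> R p' q' b where D: "Q1 = \<tau> @ \<alpha> @ p'" "Q2 = \<tau> @ R @ q'" "path G u \<tau> a" "path G a \<alpha> b" "path G b p' v"
     "path G a R b" "path G b q' v" "a \<noteq> b" "pverts a R \<inter> pverts u Q1 \<subseteq> {a, b}" "\<exists>g\<in>pedges \<alpha>. g \<notin> pedges Q2"
    using deviation[OF pthD(1)[OF less.prems(1)] pthD(1)[OF less.prems(2)] ne] by blast
  obtain g where g: "g \<in> pedges \<alpha>" "g \<notin> pedges Q2" using D(10) by blast
  define T A P R' Q where sets: "T = pverts u \<tau>" "A = pverts a \<alpha>" "P = pverts b p'" "R' = pverts a R" "Q = pverts b q'"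
  have t: "pth G u \<tau> a T" "pth G a \<alpha> b A" "pth G b p' v P" "pth G a R b R'" "pth G b q' v Q"
    using D sets by (simp_all add: pth_def)
  have e: "e \<notin> pedges \<tau>" "e \<notin> pedges \<alpha>" "e \<notin> pedges p'" "e \<notin> pedges R" "e \<notin> pedges q'"
    using less.prems(3,4) D by auto
  have pv: "pverts b p' \<subseteq> pverts u Q1" "pverts a \<alpha> \<subseteq> pverts u Q1"
    using pverts_append[OF D(3), of "\<alpha> @ p'"] pverts_append[OF D(4), of p'] D(1) by auto
  have i1: "T \<inter> (A \<union> P) \<subseteq> {a}" "A \<inter> P \<subseteq> {b}"
  proof -
    obtain m where "path G u \<tau> m" "path G m (\<alpha> @ p') v" "T \<inter> pverts m (\<alpha> @ p') = {m}"
      using less.prems(1) unfolding pth_def D(1) path_append[of G u \<tau>] sets by blast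
    then have "path G a (\<alpha> @ p') v" "T \<inter> pverts a (\<alpha> @ p') = {a}" using path_end_unique[OF D(3)] by auto
    moreover from this obtain m where "path G a \<alpha> m" "A \<inter> pverts m p' = {m}" unfolding path_append sets by blast
    ultimately show "T \<inter> (A \<union> P) \<subseteq> {a}" "A \<inter> P \<subseteq> {b}"
      using path_end_unique[OF D(4)] pverts_append[OF D(4), of p'] by (auto simp: sets)
  qed
  have i2: "T \<inter> (R' \<union> Q) \<subseteq> {a}" "R' \<inter> Q \<subseteq> {b}"
  proof -
    obtain m where "path G u \<tau> m" "path G m (R @ q') v" "T \<inter> pverts m (R @ q') = {m}"
      using less.prems(2) unfolding pth_def D(2) path_append[of G u \<tau>] sets by blast
    then have "path G a (R @ q') v" "T \<inter> pverts a (R @ q') = {a}" using path_end_unique[OF D(3)] by auto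
    moreover from this obtain m where "path G a R m" "R' \<inter> pverts m q' = {m}" unfolding path_append sets by blast
    ultimately show "T \<inter> (R' \<union> Q) \<subseteq> {a}" "R' \<inter> Q \<subseteq> {b}"
      using path_end_unique[OF D(6)] pverts_append[OF D(6), of q'] by (auto simp: sets)
  qed
  have i3: "R' \<inter> (A \<union> P) \<subseteq> {a, b}" using D(9) pv unfolding sets by auto
  note m = pth_mem[OF t(1)] pth_mem[OF t(2)] pth_mem[OF t(3)] pth_mem[OF t(4)] pth_mem[OF t(5)]
  note F = i1 i2 i3 D(8) m
  have gQ1: "g \<in> pedges Q1" "g \<notin> pedges \<tau>" "g \<notin> pedges p'"
    using path_append_edges[of G u \<tau> "\<alpha> @ p'" v] path_append_edges[of G u "\<tau> @ \<alpha>" p' v] less.prems(1) g(1)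
    by (auto simp: pth_def D(1))
  have l: "odd (length \<tau> + length \<alpha> + length p')" "odd (length \<tau> + length R + length q')"
    using less.prems(5,6) unfolding D(1,2) length_append even_add by argo+
  have cf: "odd ((fw d \<alpha> + fw d p') + (fw d R + fw d q'))" using less.prems(7) unfolding D(1,2) fw_simps(3) even_add by argo
  show ?case
  proof (cases "even (length \<alpha> + length R)")
    case True
    have z: "pth G b (p' @ [(v, e, u)] @ \<tau>) a (P \<union> T)"
      by (rule pth_e[OF t(3,1)]) (use F in \<open>simp only: set_logic; metis\<close>)
    have "even (fw d \<alpha> + fw d R)"
    proof (rule swap_parity[OF t(2,4) e(2,4) z _ _ _ _ D(8) True])
      show "A \<inter> R' \<subseteq> {a, b}" "A \<inter> (P \<union> T) \<subseteq> {a, b}" "R' \<inter> (P \<union> T) \<subseteq> {a, b}" using F by (simp only: set_logic; metis)+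
      show "even (length \<alpha> + length (p' @ [(v, e, u)] @ \<tau>))" using l by simp argo
    qed simp
    moreover have "pth G u (\<tau> @ R @ p') v (T \<union> (R' \<union> P))"
      by (rule pth_append[OF t(1) pth_append[OF t(4,3)]]) (use F in \<open>simp only: set_logic; metis\<close>)+
    ultimately show ?thesis
      by (intro IH[of g "\<tau> @ R @ p'"]) (use g gQ1 True l D(1,2) in simp_all, (argo | blast)+)
  next
    case False
    note False_al = False
    \<comment> \<open>Now \<open>\<alpha>\<close> and \<open>R\<close> close an odd circuit. As
      \<open>Q1\<close> and \<open>Q2\<close> are both odd, the remainders differ in parity and so
      must part once more.\<close>
    have "p' \<noteq> q'" using l False by auto
    then obtain \<sigma> c \<beta> R2 p'' q'' w where D2: "p' = \<sigma> @ \<beta> @ p''" "q' = \<sigma> @ R2 @ q''" "path G b \<sigma> c" "path G c \<beta> w" "path G w p'' v"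
      "path G c R2 w" "path G w q'' v" "c \<noteq> w" "pverts c R2 \<inter> pverts b p' \<subseteq> {c, w}" "\<exists>g\<in>pedges \<beta>. g \<notin> pedges q'"
      using deviation[OF D(5,7)] by blast
    obtain h where h: "h \<in> pedges \<beta>" "h \<notin> pedges q'" using D2(10) by blast
    define S B Y R2' where sets2: "S = pverts b \<sigma>" "B = pverts c \<beta>" "Y = pverts w p''" "R2' = pverts c R2"
    have t2: "pth G b \<sigma> c S" "pth G c \<beta> w B" "pth G w p'' v Y" "pth G c R2 w R2'"
      using D2 sets2 by (simp_all add: pth_def)
    have e2: "e \<notin> pedges \<sigma>" "e \<notin> pedges \<beta>" "e \<notin> pedges p''" "e \<notin> pedges R2" using e D2 by auto
    have P: "P = S \<union> (B \<union> Y)" using pverts_append[OF D2(3), of "\<beta> @ p''"] pverts_append[OF D2(4), of p''] D2(1)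
      by (simp add: sets sets2)
    have Q: "S \<union> R2' \<subseteq> Q" using pverts_append[OF D2(3), of "R2 @ q''"] pverts_append[OF D2(6), of q''] D2(2)
      by (auto simp: sets sets2)
    have j1: "S \<inter> (B \<union> Y) \<subseteq> {c}" "B \<inter> Y \<subseteq> {w}"
    proof -
      obtain m where "path G b \<sigma> m" "path G m (\<beta> @ p'') v" "S \<inter> pverts m (\<beta> @ p'') = {m}"
        using D(5) unfolding D2(1) path_append[of G b \<sigma>] sets2 by blast
      then have "path G c (\<beta> @ p'') v" "S \<inter> pverts c (\<beta> @ p'') = {c}" using path_end_unique[OF D2(3)] by auto
      moreover from this obtain m where "path G c \<beta> m" "B \<inter> pverts m p'' = {m}" unfolding path_append sets2 by blast
      ultimately show "S \<inter> (B \<union> Y) \<subseteq> {c}" "B \<inter> Y \<subseteq> {w}"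
        using path_end_unique[OF D2(4)] pverts_append[OF D2(4), of p''] by (auto simp: sets2)
    qed
    have j2: "R2' \<inter> P \<subseteq> {c, w}" using D2(9) by (simp add: sets sets2)
    note m2 = pth_mem[OF t2(1)] pth_mem[OF t2(2)] pth_mem[OF t2(3)] pth_mem[OF t2(4)]
    have Sin: "S \<subseteq> P" "B \<subseteq> P" "Y \<subseteq> P" using P by auto
    note F2 = F j1 j2 m2 Q Sin D2(8)
    have hQ: "h \<in> pedges Q1" "h \<notin> pedges \<tau>" "h \<notin> pedges \<alpha>" "h \<notin> pedges \<sigma>" "h \<notin> pedges p''" "h \<notin> pedges R" "h \<notin> pedges R2"
    proof -
      have "path G u Q1 v" using less.prems(1) by (simp add: pth_def)
      then show "h \<in> pedges Q1" "h \<notin> pedges \<tau>" "h \<notin> pedges \<alpha>"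
        using path_append_edges[of G u \<tau> "\<alpha> @ p'" v] path_append_edges[of G u "\<tau> @ \<alpha>" p' v] h(1) by (auto simp: D(1) D2(1))
      show "h \<notin> pedges \<sigma>" "h \<notin> pedges p''"
        using path_append_edges[of G b \<sigma> "\<beta> @ p''" v] path_append_edges[of G b "\<sigma> @ \<beta>" p'' v] D(5) h(1) by (auto simp: D2(1))
      have "R' \<inter> P \<subseteq> {b}" using F by (simp only: set_logic; metis)
      then have "pedges R \<inter> pedges p' = {}" using pedges_disjoint[OF D(6,5)] unfolding sets by blast
      then show "h \<notin> pedges R" using h(1) D2(1) by auto
      show "h \<notin> pedges R2" using h(2) D2(2) by auto
    qed
    have hQ2: "h \<notin> pedges Q2" using hQ h(2) D(2) by auto
    have l2: "odd (length \<tau> + length \<alpha> + (length \<sigma> + length \<beta> + length p''))" using l(1) unfolding D2(1) length_append even_add by argo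
    show ?thesis
    proof (cases "R2' \<inter> A \<subseteq> {b}")
      case serial: True
      note F3 = F2 serial
      show ?thesis
      proof (cases "even (length \<beta> + length R2)")
        case ev: True
        have z: "pth G w ((p'' @ [(v, e, u)] @ \<tau>) @ \<alpha> @ \<sigma>) c ((Y \<union> T) \<union> (A \<union> S))"
          by (rule pth_append[OF pth_e[OF t2(3) t(1)] pth_append[OF t(2) t2(1)]]) (use F3 in \<open>simp only: set_logic; metis\<close>)+
        have "even (fw d \<beta> + fw d R2)"
        proof (rule swap_parity[OF t2(2,4) e2(2,4) z _ _ _ _ D2(8) ev])
          show "B \<inter> R2' \<subseteq> {c, w}" "B \<inter> ((Y \<union> T) \<union> (A \<union> S)) \<subseteq> {c, w}" "R2' \<inter> ((Y \<union> T) \<union> (A \<union> S)) \<subseteq> {c, w}"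
            using F3 by (simp only: set_logic; metis)+
          show "even (length \<beta> + length ((p'' @ [(v, e, u)] @ \<tau>) @ \<alpha> @ \<sigma>))" using l2 by simp argo
        qed simp
        moreover have "pth G u (\<tau> @ \<alpha> @ \<sigma> @ R2 @ p'') v (T \<union> (A \<union> (S \<union> (R2' \<union> Y))))"
          by (rule pth_append[OF t(1) pth_append[OF t(2) pth_append[OF t2(1) pth_append[OF t2(4,3)]]]])
            (use F3 in \<open>simp only: set_logic; metis\<close>)+
        ultimately show ?thesis
          by (intro IH[of h "\<tau> @ \<alpha> @ \<sigma> @ R2 @ p''"]) (use hQ hQ2 D(1,2) D2(1,2) ev l2 in simp_all, (argo | blast)+)
      next
        case odd: False
        show ?thesis
        proof (cases "odd (fw d \<alpha> + fw d R + fw d \<beta> + fw d R2)")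
          case True
          have "conf a b c w \<alpha> R \<sigma> \<beta> R2 p'' \<tau> A R' S B R2' Y T"
          proof (rule confI[OF t(2,4) t2(1,2,4,3) t(1) e(2,4) e2(1,2,4,3) e(1) D(8) D2(8)])
            show "A \<inter> R' \<subseteq> {a, b}" "B \<inter> R2' \<subseteq> {c, w}" "(A \<union> R') \<inter> S \<subseteq> {b}" "S \<inter> (B \<union> R2') \<subseteq> {c}"
              "(A \<union> R') \<inter> (B \<union> R2') \<subseteq> S" "T \<inter> (A \<union> R') \<subseteq> {a}" "Y \<inter> (B \<union> R2') \<subseteq> {w}"
              "Y \<inter> (A \<union> R' \<union> S \<union> T) \<subseteq> {}" "T \<inter> (S \<union> B \<union> R2') \<subseteq> {}"
              using F3 by (simp only: set_logic; metis)+
          qed (use False odd True in auto)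
          then show ?thesis unfolding has_conf_def by blast
        next
          case ev: False
          \<comment> \<open>Following both excursions makes two odd changes, which preserves the
            parity of the length; without a conflict between the two circuits the count is preserved
            as well.\<close>
          have "pth G u (\<tau> @ R @ \<sigma> @ R2 @ p'') v (T \<union> (R' \<union> (S \<union> (R2' \<union> Y))))"
            by (rule pth_append[OF t(1) pth_append[OF t(4) pth_append[OF t2(1) pth_append[OF t2(4,3)]]]])
              (use F3 in \<open>simp only: set_logic; metis\<close>)+
          then show ?thesis
            by (intro IH[of h "\<tau> @ R @ \<sigma> @ R2 @ p''"]) (use hQ hQ2 D(1,2) D2(1,2) ev odd False l2 in simp_all, (argo | blast)+)
        qed
      qed
    next
      case False
      then obtain k where k: "k \<in> R2'" "k \<in> A" "k \<noteq> b" by blast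
      \<comment> \<open>\<open>m\<close> is the last vertex of the second excursion on
        \<open>\<alpha>\<close> other than \<open>b\<close>. From \<open>m\<close> on, the excursion
        meets \<open>Q1\<close> in \<open>m\<close> and \<open>w\<close> only.\<close>
      obtain R2a R2b m where R2: "R2 = R2a @ R2b" "path G c R2a m" "path G m R2b w" "m \<in> A - {b}" "pverts m R2b \<inter> (A - {b}) = {m}"
        "pverts c R2a \<inter> pverts m R2b = {m}" "pverts c R2 = pverts c R2a \<union> pverts m R2b"
        by (rule path_last_hit[OF D2(6), of k "A - {b}"]) (use k sets2 in auto)
      obtain \<alpha>1 \<alpha>2 M1 M2 where M: "\<alpha> = \<alpha>1 @ \<alpha>2" "pth G a \<alpha>1 m M1" "pth G m \<alpha>2 b M2" "M1 \<inter> M2 \<subseteq> {m}" "A = M1 \<union> M2"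
        using pth_split[OF t(2), of m] R2(4) by blast
      define RB where "RB = pverts m R2b"
      have rb: "pth G m R2b w RB" using R2 by (simp add: pth_def RB_def)
      have e3: "e \<notin> pedges R2b" "e \<notin> pedges \<alpha>1" "e \<notin> pedges \<alpha>2" using e(2) e2(4) R2(1) M(1) by auto
      have k1: "RB \<subseteq> R2'" "RB \<inter> A \<subseteq> {m, b}" "m \<in> R2'" "m \<in> A" "m \<noteq> b"
      proof -
        show "RB \<subseteq> R2'" using R2(7) by (simp add: RB_def sets2)
        show "m \<in> R2'" using R2(7) start_in_pverts[of m R2b] by (simp add: sets2)
        show "m \<in> A" "m \<noteq> b" using R2(4) by simp_all
        show "RB \<inter> A \<subseteq> {m, b}"
        proof
          fix z assume "z \<in> RB \<inter> A"
          then have "z \<noteq> b \<Longrightarrow> z \<in> pverts m R2b \<inter> (A - {b})" by (simp add: RB_def)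
          then show "z \<in> {m, b}" unfolding R2(5) by auto
        qed
      qed
      have k2: "c \<in> RB \<longrightarrow> c = m"
        using R2(6) start_in_pverts[of c R2a] unfolding RB_def by (metis IntI singletonD)
      note F2' = F2 k1 k2
      have k3: "b \<notin> RB" using F2' by (simp only: set_logic; metis)
      have k4: "m \<noteq> a" using F2' by (simp only: set_logic; metis)
      note F3 = F2 k1 k2 k3 k4 M(4,5) pth_mem[OF rb] pth_mem[OF M(2)] pth_mem[OF M(3)]
      have sb: "pth G b (\<sigma> @ \<beta>) w (S \<union> B)"
        by (rule pth_append[OF t2(1,2)]) (use F3 in \<open>simp only: set_logic; metis\<close>)
      have mw: "m \<noteq> w" "a \<noteq> w" "b \<noteq> w" using F3 by (simp only: set_logic; metis)+
      have hm: "h \<notin> pedges \<alpha>1" "h \<notin> pedges \<alpha>2" "h \<notin> pedges R2b" using hQ(3,7) M(1) R2(1) by auto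
      have l3: "odd (length \<tau> + (length \<alpha>1 + length \<alpha>2) + (length \<sigma> + length \<beta> + length p''))" using l2 unfolding M(1) length_append even_add by argo
      show ?thesis
      proof (cases "even (length R2b + (length \<alpha>2 + (length \<sigma> + length \<beta>)))")
        case ev: True
        have q: "pth G m (\<alpha>2 @ \<sigma> @ \<beta>) w (M2 \<union> (S \<union> B))"
          by (rule pth_append[OF M(3) sb]) (use F3 in \<open>simp only: set_logic; metis\<close>)
        have z: "pth G w ((p'' @ [(v, e, u)] @ \<tau>) @ \<alpha>1) m ((Y \<union> T) \<union> M1)"
          by (rule pth_append[OF pth_e[OF t2(3) t(1)] M(2)]) (use F3 in \<open>simp only: set_logic; metis\<close>)+
        have "even (fw d R2b + fw d (\<alpha>2 @ \<sigma> @ \<beta>))"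
        proof (rule swap_parity[OF rb q e3(1) _ z _ _ _ _ mw(1)])
          show "RB \<inter> (M2 \<union> (S \<union> B)) \<subseteq> {m, w}" "RB \<inter> ((Y \<union> T) \<union> M1) \<subseteq> {m, w}"
            "(M2 \<union> (S \<union> B)) \<inter> ((Y \<union> T) \<union> M1) \<subseteq> {m, w}"
            using F3 by (simp only: set_logic; metis)+
          show "even (length R2b + length (\<alpha>2 @ \<sigma> @ \<beta>))" using ev by simp
          show "even (length R2b + length ((p'' @ [(v, e, u)] @ \<tau>) @ \<alpha>1))" using ev l3 by simp argo
        qed (use e2 e3 in simp_all)
        moreover have "pth G u (\<tau> @ \<alpha>1 @ R2b @ p'') v (T \<union> (M1 \<union> (RB \<union> Y)))"
          by (rule pth_append[OF t(1) pth_append[OF M(2) pth_append[OF rb t2(3)]]])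
            (use F3 in \<open>simp only: set_logic; metis\<close>)+
        ultimately show ?thesis
          by (intro IH[of h "\<tau> @ \<alpha>1 @ R2b @ p''"]) (use hQ hQ2 hm D(1,2) D2(1,2) M(1) R2(1) ev l3 in simp_all, (argo | blast)+)
      next
        case odd: False
        \<comment> \<open>The other way around the circuit: along \<open>R\<close> to
          \<open>b\<close>, back along \<open>\<alpha>2\<close> to \<open>m\<close>, and on along
          \<open>R2b\<close>. The parity of the length is kept because \<open>\<alpha>\<close> and
          \<open>R\<close> form an odd circuit and so do \<open>R2b\<close> and
          \<open>\<alpha>2 @ \<sigma> @ \<beta>\<close>.\<close>
        have Q': "pth G u (\<tau> @ R @ prev \<alpha>2 @ R2b @ p'') v (T \<union> (R' \<union> (M2 \<union> (RB \<union> Y))))"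
          by (rule pth_append[OF t(1) pth_append[OF t(4) pth_append[OF pth_prev[OF M(3)] pth_append[OF rb t2(3)]]]])
            (use F3 in \<open>simp only: set_logic; metis\<close>)+
        have lR: "odd ((length \<alpha>1 + length \<alpha>2) + length R)" using False_al unfolding M(1) length_append even_add by argo
        have "even (fw d Q1 + fw d (\<tau> @ R @ prev \<alpha>2 @ R2b @ p''))"
        proof (rule ccontr)
          assume con: "odd (fw d Q1 + fw d (\<tau> @ R @ prev \<alpha>2 @ R2b @ p''))"
          have p1: "pth G a (\<alpha>1 @ R2b) w (M1 \<union> RB)"
            by (rule pth_append[OF M(2) rb]) (use F3 in \<open>simp only: set_logic; metis\<close>)
          have p2: "pth G a (R @ \<sigma> @ \<beta>) w (R' \<union> (S \<union> B))"
            by (rule pth_append[OF t(4) sb]) (use F3 in \<open>simp only: set_logic; metis\<close>)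
          have "m \<notin> R' \<union> (S \<union> B)" "m \<in> M1 \<union> RB" using F3 by (simp only: set_logic; metis)+
          then have "\<alpha>1 @ R2b \<noteq> R @ \<sigma> @ \<beta>" using pthD(2)[OF p1] pthD(2)[OF p2] by metis
          moreover have "(M1 \<union> RB) \<inter> (R' \<union> (S \<union> B)) \<subseteq> {a, w}" using F3 by (simp only: set_logic; metis)
          moreover have "even (length (\<alpha>1 @ R2b) + length (R @ \<sigma> @ \<beta>))" using odd lR by simp argo
          ultimately have par: "even (fw d (\<alpha>1 @ R2b) + fw d (R @ \<sigma> @ \<beta>) + length (\<alpha>1 @ R2b))"
            by (intro parallel_parity[OF p1 p2]) (use e e2 e3 mw in simp_all)
          have rho: "pth G w (p'' @ [(v, e, u)] @ \<tau>) a (Y \<union> T)"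
            by (rule pth_e[OF t2(3) t(1)]) (use F3 in \<open>simp only: set_logic; metis\<close>)
          have ap: "apex G w a m b (p'' @ [(v, e, u)] @ \<tau>) (prev R2b) (prev (\<sigma> @ \<beta>)) \<alpha>1 \<alpha>2 (prev R)"
          proof (rule apexI[OF rho pth_prev[OF rb] pth_prev[OF sb] M(2,3) pth_prev[OF t(4)]])
            show "distinct [w, a, m, b]" using mw k1(5) k4 D(8) by auto
          qed (use F3 in \<open>simp only: set_logic; metis\<close>)+
          have fw2: "even (fw d (prev \<alpha>2)) \<longleftrightarrow> (even (fw d \<alpha>2) \<longleftrightarrow> even (length \<alpha>2))" by (rule even_fw_prev'[OF M(3) e3(3)])
          \<comment> \<open>Adding the condition for the parallel routes
            \<open>\<alpha>1 @ R2b\<close> and \<open>R @ \<sigma> @ \<beta>\<close> to the assumed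
            change of the count leaves only lengths; the reversal of \<open>\<alpha>2\<close>
            contributes its own.\<close>
          have star: "odd (length \<alpha>1 + (length \<alpha>2 + length R2b))"
            using con par fw2 unfolding D(1) D2(1) M(1) fw_simps(3) length_append even_add by argo
          have \<rho>: "even (length (p'' @ [(v, e, u)] @ \<tau>)) \<longleftrightarrow> even (length \<alpha>1 + (length \<alpha>2 + (length \<sigma> + length \<beta>)))"
            using l3 by simp argo
          note AP = apex_parity[OF multigraph not_obstructed]
          have "odd (length \<alpha>1) \<and> odd (length \<alpha>2) \<and> odd (length R) \<longrightarrow>
              even (length (p'' @ [(v, e, u)] @ \<tau>) + (length R2b + (length \<sigma> + length \<beta>)))"
          proof
            assume all: "odd (length \<alpha>1) \<and> odd (length \<alpha>2) \<and> odd (length R)"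
            have "even (length (p'' @ [(v, e, u)] @ \<tau>) + length (prev R2b) + length (prev (\<sigma> @ \<beta>)))"
              by (rule AP(1)[OF ap]) (use all in simp_all)
            then show "even (length (p'' @ [(v, e, u)] @ \<tau>) + (length R2b + (length \<sigma> + length \<beta>)))"
              by (simp only: prev_simps(4) length_append[of \<sigma> \<beta>] add.assoc)
          qed
          moreover have "even (length \<alpha>1) \<and> odd (length \<alpha>2) \<and> even (length R) \<longrightarrow>
              even (length (p'' @ [(v, e, u)] @ \<tau>))"
            using AP(2)[OF ap] by simp
          moreover have "even (length \<alpha>2) \<and> odd (length R) \<and> even (length \<alpha>1) \<longrightarrow> even (length R2b)"
            using AP(2)[OF apex_rotate[OF ap]] by simp
          moreover have "even (length R) \<and> odd (length \<alpha>1) \<and> even (length \<alpha>2) \<longrightarrow> even (length \<sigma> + length \<beta>)"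
            using AP(2)[OF apex_rotate[OF apex_rotate[OF ap]]] by simp
          ultimately show False using \<rho> star odd lR unfolding even_add by argo
        qed
        then show ?thesis
          using Q' by (intro IH[of h "\<tau> @ R @ prev \<alpha>2 @ R2b @ p''"]) (use hQ hQ2 hm D(1,2) D2(1,2) M(1) R2(1) odd lR l3 in simp_all, (argo | blast)+)
      qed
    qed
  qed
qed


text \<open>With \<open>W\<close> in place of the tails and \<open>e\<close> the two circuits form a
  ring avoiding \<open>e\<close>. Compared with the conflict, it forces \<open>\<xi>1\<close> and
  \<open>\<gamma>2\<close> to differ in parity, and reversal makes \<open>\<xi>1\<close> the odd
  one.\<close>

lemma conf_no_arc_to_arc:
  assumes C: "conf a b c w (\<xi>1 @ \<xi>2) \<alpha>1 \<sigma> (\<gamma>1 @ \<gamma>2) \<beta>1 \<upsilon> \<tau> (X1 \<union> X2) A1 S (C1 \<union> C2) B1 Y T"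
    and t: "pth G a \<xi>1 x X1" "pth G x \<xi>2 b X2" "X1 \<inter> X2 \<subseteq> {x}" "x \<noteq> a" "x \<noteq> b"
    and s: "pth G c \<gamma>1 y C1" "pth G y \<gamma>2 w C2" "C1 \<inter> C2 \<subseteq> {y}" "y \<noteq> c" "y \<noteq> w"
    and W: "pth G x W y V" "e \<notin> pedges W" "V \<inter> ((X1 \<union> X2) \<union> A1 \<union> S \<union> (C1 \<union> C2) \<union> B1 \<union> Y \<union> T) \<subseteq> {x, y}"
  shows False
proof -
  note c = confD[OF C]
  note m = pth_mem[OF t(1)] pth_mem[OF t(2)] pth_mem[OF c(2)] pth_mem[OF c(3)] pth_mem[OF c(5)] pth_mem[OF c(6)]
    pth_mem[OF c(7)] pth_mem[OF s(1)] pth_mem[OF s(2)]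
  note F = c(15-25) t(3-5) s(3-5) W(3) m
  note E = c(8-14)[simplified]
  have x1: "pth G x (prev \<xi>1 @ \<alpha>1) b (X1 \<union> A1)"
    by (rule pth_append[OF pth_prev[OF t(1)] c(2)]) (use F in \<open>simp only: set_logic; metis\<close>)
  have b1: "pth G c (\<beta>1 @ prev \<gamma>2) y (B1 \<union> C2)"
    by (rule pth_append[OF c(5) pth_prev[OF s(2)]]) (use F in \<open>simp only: set_logic; metis\<close>)
  have "ring x b c y \<xi>2 (prev \<xi>1 @ \<alpha>1) \<sigma> \<gamma>1 (\<beta>1 @ prev \<gamma>2) (prev W) X2 (X1 \<union> A1) S C1 (B1 \<union> C2) V"
    unfolding ring_def
  proof (intro conjI)
    show "X2 \<inter> (X1 \<union> A1) \<subseteq> {x, b}" "C1 \<inter> (B1 \<union> C2) \<subseteq> {c, y}" "(X2 \<union> (X1 \<union> A1)) \<inter> S \<subseteq> {b}"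
      "S \<inter> (C1 \<union> (B1 \<union> C2)) \<subseteq> {c}" "(X2 \<union> (X1 \<union> A1)) \<inter> (C1 \<union> (B1 \<union> C2)) \<subseteq> S"
      "V \<inter> (X2 \<union> (X1 \<union> A1)) \<subseteq> {x}" "V \<inter> (C1 \<union> (B1 \<union> C2)) \<subseteq> {y}" "V \<inter> S \<subseteq> {}"
      using F by (simp only: set_logic; metis)+
    show "odd (length \<xi>2 + length (prev \<xi>1 @ \<alpha>1))" using c(26) unfolding length_append even_add prev_simps by argo
    show "odd (length \<gamma>1 + length (\<beta>1 @ prev \<gamma>2))" using c(27) unfolding length_append even_add prev_simps by argo
  qed (use c x1 b1 t s pth_prev[OF W(1)] in simp_all)
  then have "even (fw d \<xi>2 + fw d (prev \<xi>1 @ \<alpha>1) + fw d \<gamma>1 + fw d (\<beta>1 @ prev \<gamma>2))"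
    by (rule ring_even) (use E W(2) in simp_all)
  moreover have "even (fw d (prev \<xi>1)) \<longleftrightarrow> (even (fw d \<xi>1) \<longleftrightarrow> even (length \<xi>1))"
    by (rule even_fw_prev'[OF t(1)]) (use E in simp)
  moreover have "even (fw d (prev \<gamma>2)) \<longleftrightarrow> (even (fw d \<gamma>2) \<longleftrightarrow> even (length \<gamma>2))"
    by (rule even_fw_prev'[OF s(2)]) (use E in simp)
  ultimately have par: "odd (length \<xi>1 + length \<gamma>2)"
    using c(28) unfolding fw_simps(3) even_add by argo
  show False
  proof (cases "odd (length \<xi>1)")
    case True
    then show False using conf_no_arc_to_arc_odd[OF C t s W] par by simp
  next
    case False
    interpret R: critical G e v u d by (rule critical_sym)
    have C': "R.conf w c b a (prev \<gamma>2 @ prev \<gamma>1) (prev \<beta>1) (prev \<sigma>) (prev \<xi>2 @ prev \<xi>1) (prev \<alpha>1) (prev \<tau>) (prev \<upsilon>)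
        (C2 \<union> C1) B1 S (X2 \<union> X1) A1 T Y"
      using conf_reverse[OF C] by (simp add: Un_commute)
    show False
      by (rule R.conf_no_arc_to_arc_odd[OF C' pth_prev[OF s(2)] pth_prev[OF s(1)] _ s(5,4) pth_prev[OF t(2)] pth_prev[OF t(1)] _ t(5,4)
            pth_prev[OF W(1)]])
        (use s(3) t(3) W(2,3) False par in \<open>auto simp: Int_commute Un_ac insert_commute\<close>)
  qed
qed

text \<open>The path given by \<open>link\<close> is trimmed to a piece \<open>W\<close> from its
  last vertex \<open>x\<close> on the circuit at \<open>a\<close> or its tail to the next vertex
  \<open>y\<close> on the rest of the configuration. As \<open>b\<close> is avoided, landing on the
  joining path cuts off at least one of its edges.\<close>

lemma no_conf_if_linked:
  assumes link: "\<And>a b c w \<alpha>0 \<alpha>1 \<sigma> \<beta>0 \<beta>1 \<upsilon> \<tau> A0 A1 S B0 B1 Y T.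
     conf a b c w \<alpha>0 \<alpha>1 \<sigma> \<beta>0 \<beta>1 \<upsilon> \<tau> A0 A1 S B0 B1 Y T \<Longrightarrow> \<exists>p. path G a p w \<and> e \<notin> pedges p \<and> b \<notin> pverts a p"
  shows "\<not> has_conf n"
proof (induction n rule: less_induct)
  case (less n)
  show ?case
  proof
    assume "has_conf n"
    then obtain a b c w \<alpha>0 \<alpha>1 \<sigma> \<beta>0 \<beta>1 \<upsilon> \<tau> A0 A1 S B0 B1 Y T where
      C: "conf a b c w \<alpha>0 \<alpha>1 \<sigma> \<beta>0 \<beta>1 \<upsilon> \<tau> A0 A1 S B0 B1 Y T" and n: "length \<sigma> = n"
      unfolding has_conf_def by blast
    note c = confD[OF C]
    obtain p where p: "path G a p w" "e \<notin> pedges p" "b \<notin> pverts a p" using link[OF C] by blast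
    have aX: "a \<in> (A0 \<union> A1 \<union> T)" and wZ: "w \<in> S \<union> B0 \<union> B1 \<union> Y" using pth_mem[OF c(1)] pth_mem[OF c(4)] by auto
    obtain p1 p2 x where 1: "p = p1 @ p2" "path G a p1 x" "path G x p2 w" "x \<in> A0 \<union> A1 \<union> T"
      "pverts x p2 \<inter> (A0 \<union> A1 \<union> T) = {x}" "pverts a p = pverts a p1 \<union> pverts x p2"
      by (rule path_last_hit[OF p(1) aX start_in_pverts]) blast
    obtain W p3 y where 2: "p2 = W @ p3" "path G x W y" "y \<in> S \<union> B0 \<union> B1 \<union> Y" "pverts x W \<inter> (S \<union> B0 \<union> B1 \<union> Y) = {y}"
      "pverts x p2 = pverts x W \<union> pverts y p3"
      by (rule path_first_hit[OF 1(3) wZ path_end_in_pverts[OF 1(3)]]) blast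
    define V where "V = pverts x W"
    have W: "pth G x W y V" "e \<notin> pedges W" using 2(2) p(2) 1(1) 2(1) by (auto simp: pth_def V_def)
    have VX: "V \<inter> (A0 \<union> A1 \<union> T) \<subseteq> {x}" using 1(5) 2(5) by (auto simp: V_def)
    have VZ: "V \<inter> (S \<union> B0 \<union> B1 \<union> Y) \<subseteq> {y}" using 2(4) by (auto simp: V_def)
    have bV: "b \<notin> V" using p(3) 1(6) 2(5) by (auto simp: V_def)
    have xb: "x \<noteq> b" "y \<noteq> b" using bV pth_mem[OF W(1)] by auto
    have VU: "V \<inter> (A0 \<union> A1 \<union> S \<union> B0 \<union> B1 \<union> Y \<union> T) \<subseteq> {x, y}"
      using VX VZ by (simp only: set_logic; metis)
    have arc_tail: "x \<noteq> a" if "x \<notin> T" using that pth_mem[OF c(7)] by auto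
    have wlog_\<alpha>: False if "x \<in> A0 \<union> A1" "x \<notin> T"
      "\<And>\<alpha>0 \<alpha>1 A0 A1. conf a b c w \<alpha>0 \<alpha>1 \<sigma> \<beta>0 \<beta>1 \<upsilon> \<tau> A0 A1 S B0 B1 Y T \<Longrightarrow> x \<in> A0 \<Longrightarrow>
         V \<inter> (A0 \<union> A1 \<union> S \<union> B0 \<union> B1 \<union> Y \<union> T) \<subseteq> {x, y} \<Longrightarrow> False"
      using that(1) that(3)[OF C] that(3)[OF conf_swap_\<alpha>[OF C]] VU by (auto simp: Un_ac)
    \<comment> \<open>\<open>c\<close> counts as part of \<open>S\<close> and \<open>w\<close> as
      part of \<open>Y\<close>, so in the third case \<open>y\<close> is an inner vertex of an
      arc.\<close>
    consider "y \<in> S" | "y \<notin> S" "y \<in> Y" | "y \<notin> S" "y \<notin> Y" "y \<in> B0 \<union> B1" using 2(3) by blast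
    then show False
    proof cases
      case 1
      obtain \<sigma>1 \<sigma>2 S1 S2 where s: "\<sigma> = \<sigma>1 @ \<sigma>2" "pth G b \<sigma>1 y S1" "pth G y \<sigma>2 c S2" "S1 \<inter> S2 \<subseteq> {y}" "S = S1 \<union> S2"
        using pth_split[OF c(3) 1] .
      have "\<sigma>1 \<noteq> []" using s(2) xb(2) by (auto simp: pth_def)
      then have lt: "length \<sigma>2 < n" using n s(1) by (cases \<sigma>1) auto
      have no: "\<not> has_conf (length \<sigma>2)" using less.IH[OF lt] .
      show False
      proof (cases "x \<in> T")
        case True
        obtain \<tau>1 \<tau>2 T1 T2 where t: "\<tau> = \<tau>1 @ \<tau>2" "pth G u \<tau>1 x T1" "pth G x \<tau>2 a T2" "T1 \<inter> T2 \<subseteq> {x}" "T = T1 \<union> T2"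
          using pth_split[OF c(7) True] .
        show False
        proof (cases "even (length W + length \<tau>2 + length \<alpha>0 + length \<sigma>1)")
          case True
          show False using shorten_tail[OF C[unfolded s(1,5) t(1,5)] t(2-4) s(2-4) xb(2) W VU[unfolded s(5) t(5)] True] no by simp
        next
          case False
          then have ev: "even (length W + length \<tau>2 + length \<alpha>1 + length \<sigma>1)" using c(26) unfolding even_add by argo
          have VU': "V \<inter> (A1 \<union> A0 \<union> S \<union> B0 \<union> B1 \<union> Y \<union> T) \<subseteq> {x, y}" using VU by (simp add: Un_ac)
          show False
            using shorten_tail[OF conf_swap_\<alpha>[OF C, unfolded s(1,5) t(1,5)] t(2-4) s(2-4) xb(2) W VU'[unfolded s(5) t(5)] ev] no by simp
        qed
      next
        case False
        show False
        proof (rule wlog_\<alpha>)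
          fix \<alpha>0 \<alpha>1 A0 A1
          assume C: "conf a b c w \<alpha>0 \<alpha>1 \<sigma> \<beta>0 \<beta>1 \<upsilon> \<tau> A0 A1 S B0 B1 Y T" and x: "x \<in> A0"
            and VU: "V \<inter> (A0 \<union> A1 \<union> S \<union> B0 \<union> B1 \<union> Y \<union> T) \<subseteq> {x, y}"
          note c = confD[OF C]
          obtain \<xi>1 \<xi>2 X1 X2 where t: "\<alpha>0 = \<xi>1 @ \<xi>2" "pth G a \<xi>1 x X1" "pth G x \<xi>2 b X2" "X1 \<inter> X2 \<subseteq> {x}" "A0 = X1 \<union> X2"
            using pth_split[OF c(1) x] .
          show False
          proof (cases "even (length W + length \<xi>2 + length \<sigma>1)")
            case True
            show False using shorten_arc2[OF C[unfolded s(1,5) t(1,5)] t(2-4) arc_tail[OF False] xb(1) s(2-4) xb(2) W VU[unfolded s(5) t(5)] True] no by simp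
          next
            case f: False
            then have ev: "even (length \<xi>1 + length W + length \<alpha>1 + length \<sigma>1)" using c(26) unfolding t(1) length_append even_add by argo
            show False using shorten_arc1[OF C[unfolded s(1,5) t(1,5)] t(2-4) arc_tail[OF False] xb(1) s(2-4) xb(2) W VU[unfolded s(5) t(5)] ev] no by simp
          qed
        qed (use 1 \<open>x \<in> A0 \<union> A1 \<union> T\<close> False in auto)
      qed
    next
      case 2
      obtain \<upsilon>1 \<upsilon>2 Y1 Y2 where s: "\<upsilon> = \<upsilon>1 @ \<upsilon>2" "pth G w \<upsilon>1 y Y1" "pth G y \<upsilon>2 v Y2" "Y1 \<inter> Y2 \<subseteq> {y}" "Y = Y1 \<union> Y2"
        using pth_split[OF c(6) 2(2)] .
      show False
      proof (cases "x \<in> T")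
        case True
        obtain \<tau>1 \<tau>2 T1 T2 where t: "\<tau> = \<tau>1 @ \<tau>2" "pth G u \<tau>1 x T1" "pth G x \<tau>2 a T2" "T1 \<inter> T2 \<subseteq> {x}" "T = T1 \<union> T2"
          using pth_split[OF c(7) True] .
        show False using conf_no_bypass[OF C[unfolded s(1,5) t(1,5)] t(2-4) s(2-4) W VU[unfolded s(5) t(5)]] .
      next
        case False
        show False
        proof (rule wlog_\<alpha>)
          fix \<alpha>0 \<alpha>1 A0 A1
          assume C: "conf a b c w \<alpha>0 \<alpha>1 \<sigma> \<beta>0 \<beta>1 \<upsilon> \<tau> A0 A1 S B0 B1 Y T" and x: "x \<in> A0"
            and VU: "V \<inter> (A0 \<union> A1 \<union> S \<union> B0 \<union> B1 \<union> Y \<union> T) \<subseteq> {x, y}"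
          note c = confD[OF C]
          obtain \<xi>1 \<xi>2 X1 X2 where t: "\<alpha>0 = \<xi>1 @ \<xi>2" "pth G a \<xi>1 x X1" "pth G x \<xi>2 b X2" "X1 \<inter> X2 \<subseteq> {x}" "A0 = X1 \<union> X2"
            using pth_split[OF c(1) x] .
          \<comment> \<open>A path from an arc at \<open>a\<close> to the tail at \<open>v\<close>
            is, after reversal, a path from a tail to an arc.\<close>
          interpret R: critical G e v u d by (rule critical_sym)
          have C': "R.conf w c b a (prev \<beta>0) (prev \<beta>1) (prev \<sigma>) (prev \<xi>2 @ prev \<xi>1) (prev \<alpha>1) (prev \<tau>) (prev \<upsilon>2 @ prev \<upsilon>1)
              B0 B1 S (X2 \<union> X1) A1 T (Y2 \<union> Y1)"
            using conf_reverse[OF C] unfolding s(1,5) t(1,5) by (simp add: Un_commute)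
          show False
            by (rule R.conf_no_tail_to_arc[OF C' pth_prev[OF s(3)] pth_prev[OF s(2)] _ pth_prev[OF t(3)] pth_prev[OF t(2)] _ xb(1) arc_tail[OF False]
                  pth_prev[OF W(1)]])
              (use s(4,5) t(4,5) W(2) VU in \<open>auto simp: Int_commute Un_ac insert_commute\<close>)
        qed (use 2 \<open>x \<in> A0 \<union> A1 \<union> T\<close> False in auto)
      qed
    next
      case 3
      have yw: "y \<noteq> w" "y \<noteq> c" using 3 pth_mem[OF c(6)] pth_mem[OF c(3)] by auto
      have main: False if C: "conf a b c w \<alpha>0 \<alpha>1 \<sigma> \<beta>0 \<beta>1 \<upsilon> \<tau> A0 A1 S B0 B1 Y T" and y: "y \<in> B0" and x: "x \<in> A0 \<or> x \<in> T"
        and VU: "V \<inter> (A0 \<union> A1 \<union> S \<union> B0 \<union> B1 \<union> Y \<union> T) \<subseteq> {x, y}" for \<alpha>0 \<alpha>1 A0 A1 \<beta>0 \<beta>1 B0 B1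
      proof -
        note c = confD[OF C]
        obtain \<gamma>1 \<gamma>2 C1 C2 where s: "\<beta>0 = \<gamma>1 @ \<gamma>2" "pth G c \<gamma>1 y C1" "pth G y \<gamma>2 w C2" "C1 \<inter> C2 \<subseteq> {y}" "B0 = C1 \<union> C2"
          using pth_split[OF c(4) y] .
        show False
        proof (cases "x \<in> T")
          case True
          obtain \<tau>1 \<tau>2 T1 T2 where t: "\<tau> = \<tau>1 @ \<tau>2" "pth G u \<tau>1 x T1" "pth G x \<tau>2 a T2" "T1 \<inter> T2 \<subseteq> {x}" "T = T1 \<union> T2"
            using pth_split[OF c(7) True] .
          show False
            using conf_no_tail_to_arc[OF C[unfolded s(1,5) t(1,5)] t(2-4) s(2-4) yw(2,1) W VU[unfolded s(5) t(5)]] .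
        next
          case False
          then have "x \<in> A0" using x by simp
          then obtain \<xi>1 \<xi>2 X1 X2 where t: "\<alpha>0 = \<xi>1 @ \<xi>2" "pth G a \<xi>1 x X1" "pth G x \<xi>2 b X2" "X1 \<inter> X2 \<subseteq> {x}" "A0 = X1 \<union> X2"
            using pth_split[OF c(1)] by blast
          show False
            using conf_no_arc_to_arc[OF C[unfolded s(1,5) t(1,5)] t(2-4) arc_tail[OF False] xb(1) s(2-4) yw(2,1) W VU[unfolded s(5) t(5)]] .
        qed
      qed
      have VUs: "V \<inter> (A1 \<union> A0 \<union> S \<union> B0 \<union> B1 \<union> Y \<union> T) \<subseteq> {x, y}" "V \<inter> (A0 \<union> A1 \<union> S \<union> B1 \<union> B0 \<union> Y \<union> T) \<subseteq> {x, y}"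
        "V \<inter> (A1 \<union> A0 \<union> S \<union> B1 \<union> B0 \<union> Y \<union> T) \<subseteq> {x, y}" using VU by (simp_all add: Un_ac)
      show False
        using main[OF C _ _ VU] main[OF conf_swap_\<alpha>[OF C] _ _ VUs(1)] main[OF conf_swap_\<beta>[OF C] _ _ VUs(2)]
          main[OF conf_swap_\<beta>[OF conf_swap_\<alpha>[OF C]] _ _ VUs(3)] 3(3) \<open>x \<in> A0 \<union> A1 \<union> T\<close> by blast
    qed
  qed
qed

end

section \<open>Minimal graphs without an even orientation\<close>

text \<open>Kept as a closure so that connections compose freely; a simple path is extracted only at
  the end. Reflexivity holds at \<open>b\<close> too, which is why \<open>b\<close> is excluded
  where the notion is used.\<close>

definition linked :: "('v, 'e) mgraph \<Rightarrow> 'e set \<Rightarrow> 'v \<Rightarrow> 'v \<Rightarrow> 'v \<Rightarrow> bool" where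
  "linked G F b = (\<lambda>x y. \<exists>f\<in>F. ends G f = {x, y} \<and> x \<noteq> b \<and> y \<noteq> b)\<^sup>*\<^sup>*"

lemma linked_refl [simp]: "linked G F b x x"
  by (simp add: linked_def)

lemma linked_edge: "f \<in> F \<Longrightarrow> ends G f = {x, y} \<Longrightarrow> x \<noteq> b \<Longrightarrow> y \<noteq> b \<Longrightarrow> linked G F b x y"
  unfolding linked_def by (rule r_into_rtranclp) blast

lemma linked_trans: "linked G F b x y \<Longrightarrow> linked G F b y z \<Longrightarrow> linked G F b x z"
  unfolding linked_def by (rule rtranclp_trans)

lemma linked_sym: "linked G F b x y \<Longrightarrow> linked G F b y x"
proof -
  have "symp (\<lambda>x y. \<exists>f\<in>F. ends G f = {x, y} \<and> x \<noteq> b \<and> y \<noteq> b)"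
    by (rule sympI) (metis insert_commute)
  then show "linked G F b x y \<Longrightarrow> linked G F b y x"
    unfolding linked_def by (meson symp_rtranclp sympD)
qed

lemma linked_mono: "linked G F b x y \<Longrightarrow> F \<subseteq> F' \<Longrightarrow> linked G F' b x y"
  unfolding linked_def by (rule rtranclp_mono[THEN predicate2D, rotated]) auto

lemma linked_imp_path:
  assumes "linked G F b x y" "F \<subseteq> edges G" "multigraph G" "x \<in> verts G" "x \<noteq> b"
  shows "\<exists>p. path G x p y \<and> b \<notin> pverts x p \<and> pedges p \<subseteq> F"
  using assms(1) unfolding linked_def
proof (induction rule: rtranclp_induct)
  case base
  show ?case using assms(4,5) by (intro exI[of _ "[]"]) auto
next
  case (step y z)
  obtain p where p: "path G x p y" "b \<notin> pverts x p" "pedges p \<subseteq> F" using step.IH by blast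
  obtain f where f: "f \<in> F" "ends G f = {y, z}" "y \<noteq> b" "z \<noteq> b" using step.hyps(2) by blast
  show ?case
  proof (cases "z \<in> pverts x p")
    case True
    obtain p1 p2 where "p = p1 @ p2" "path G x p1 z" "pverts x p = pverts x p1 \<union> pverts z p2"
      by (rule path_split[OF p(1) True]) blast
    then show ?thesis using p by (intro exI[of _ p1]) auto
  next
    case False
    have z: "z \<in> verts G" "y \<in> verts G" using assms(2,3) f unfolding multigraph_def by blast+
    have "y \<noteq> z" using False path_end_in_pverts[OF p(1)] by auto
    then have 1: "path G y [(y, f, z)] z" using z f assms(2) by auto
    have "path G x (p @ [(y, f, z)]) z"
      by (rule path_appendI[OF p(1) 1]) (use False in auto)
    moreover have "b \<notin> pverts x (p @ [(y, f, z)])" using pverts_append[OF p(1), of "[(y, f, z)]"] p(2) f(3,4) by auto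
    ultimately show ?thesis using p(3) f(1) by (intro exI[of _ "p @ [(y, f, z)]"]) auto
  qed
qed

lemma path_imp_linked:
  "path G x p y \<Longrightarrow> b \<notin> pverts x p \<Longrightarrow> pedges p \<subseteq> F \<Longrightarrow> linked G F b x y"
proof (induction p arbitrary: x)
  case (Cons s p)
  obtain a f m where s: "s = (a, f, m)" by (cases s)
  have "linked G F b x m" by (rule linked_edge[of f]) (use Cons.prems s start_in_pverts[of m p] in auto)
  moreover have "linked G F b m y" using Cons s by auto
  ultimately show ?case by (rule linked_trans)
qed auto

definition biconnected :: "('v, 'e) mgraph \<Rightarrow> 'v set \<Rightarrow> 'e set \<Rightarrow> bool" where
  "biconnected G U F \<longleftrightarrow> (\<forall>b. \<forall>x\<in>U - {b}. \<forall>y\<in>U - {b}. linked G F b x y)"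

text \<open>Removing one vertex leaves every other vertex of the ear attached to \<open>s\<close> or
  to \<open>t\<close>, along one of the two pieces into which it divides the ear.\<close>

lemma biconnected_add_ear:
  assumes "biconnected G U F" "path G s p t" "s \<in> U" "t \<in> U" "s \<noteq> t"
  shows "biconnected G (U \<union> pverts s p) (F \<union> pedges p)"
proof -
  let ?L = "\<lambda>b. linked G (F \<union> pedges p) b"
  have U: "?L b x y" if "x \<in> U - {b}" "y \<in> U - {b}" for b x y
    using assms(1) that linked_mono[of G F b x y] unfolding biconnected_def by blast
  have toU: "\<exists>x\<in>U - {b}. ?L b z x" if z: "z \<in> U \<union> pverts s p" "z \<noteq> b" for b z
  proof (cases "z \<in> U")
    case True
    then show ?thesis using z by (intro bexI[of _ z]) auto
  next
    case False
    then have "z \<in> pverts s p" using z by simp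
    then obtain p1 p2 where p: "p = p1 @ p2" "path G s p1 z" "path G z p2 t" "pverts s p1 \<inter> pverts z p2 = {z}"
      using path_split[OF assms(2)] by blast
    show ?thesis
    proof (cases "b \<in> pverts s p1")
      case True
      then have "b \<notin> pverts z p2" using p(4) z(2) by auto
      moreover from this have "t \<noteq> b" using path_end_in_pverts[OF p(3)] by auto
      ultimately show ?thesis
        using path_imp_linked[OF p(3), of b "F \<union> pedges p"] p(1) assms(4) by (intro bexI[of _ t]) auto
    next
      case False
      moreover from this have "s \<noteq> b" by auto
      ultimately show ?thesis
        using path_imp_linked[OF p(2), of b "F \<union> pedges p"] p(1) assms(3) linked_sym[of G "F \<union> pedges p" b s z]
        by (intro bexI[of _ s]) auto
    qed
  qed
  show ?thesis
    unfolding biconnected_def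
  proof (intro allI ballI)
    fix b x y assume x: "x \<in> U \<union> pverts s p - {b}" and y: "y \<in> U \<union> pverts s p - {b}"
    obtain x' where x': "x' \<in> U - {b}" "?L b x x'" using toU[of x b] x by auto
    obtain y' where y': "y' \<in> U - {b}" "?L b y y'" using toU[of y b] y by auto
    show "?L b x y"
      using linked_trans[OF x'(2) linked_trans[OF U[OF x'(1) y'(1)] linked_sym[OF y'(2)]]] .
  qed
qed

lemma cycle_start_at:
  assumes "cycle G u p v e" "z \<in> pverts u p"
  obtains q t f where "cycle G z q t f" "length q = length p" "insert f (pedges q) = insert e (pedges p)"
    "\<And>d. fw d (q @ [(t, f, z)]) = fw d (p @ [(v, e, u)])"
proof (cases "z = u")
  case True
  then show ?thesis using that assms(1) by blast
next
  case False
  have "path G u p v" using assms(1) by (simp add: cycle_def)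
  then have "set (u # map (snd \<circ> snd) p) = pverts u p" using path_vertex_list by metis
  then have "z \<in> set (map (snd \<circ> snd) p)" using assms(2) False by auto
  then obtain a f where "(a, f, z) \<in> set p" by auto
  then obtain p1 p2 where p: "p = p1 @ (a, f, z) # p2" by (meson split_list)
  show ?thesis
  proof (rule that)
    show "cycle G z (p2 @ (v, e, u) # p1) a f" using cycle_rotate assms(1) p by metis
  qed (use p in auto)
qed

lemma path_first_edge: "path G u p v \<Longrightarrow> u \<noteq> v \<Longrightarrow> \<exists>f\<in>pedges p. u \<in> ends G f"
  by (cases p) auto

lemma path_last_edge:
  assumes "path G u p v" "u \<noteq> v"
  shows "\<exists>f\<in>pedges p. v \<in> ends G f"
  using path_first_edge[OF path_prev[OF assms(1)]] assms(2) by simp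

text \<open>An inner vertex of a path meets two of its edges, and the common ends meet one edge of
  each path. With \<open>no_leaf_avoids_ear\<close> this keeps circuits out of pendant
  paths.\<close>

lemma parallel_paths_no_leaf:
  assumes "path G a p b" "path G a q b" "a \<noteq> b" "pedges p \<inter> pedges q = {}"
    "f \<in> pedges p \<union> pedges q" "z \<in> ends G f"
  shows "\<exists>f'\<in>pedges p \<union> pedges q. f' \<noteq> f \<and> z \<in> ends G f'"
proof -
  have inner: "\<exists>f1 f2. f1 \<in> pedges r \<and> f2 \<in> pedges r \<and> f1 \<noteq> f2 \<and> z \<in> ends G f1 \<and> z \<in> ends G f2"
    if r: "path G a r b" "z \<in> pverts a r" "z \<noteq> a" "z \<noteq> b" for r
  proof -
    obtain r1 r2 where "r = r1 @ r2" "path G a r1 z" "path G z r2 b"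
      using path_split[OF r(1,2)] by blast
    moreover from this have "pedges r1 \<inter> pedges r2 = {}" using path_append_edges r(1) by metis
    ultimately show ?thesis using path_last_edge[of G a r1 z] path_first_edge[of G z r2 b] r(3,4) by fastforce
  qed
  have "\<exists>f1 f2. f1 \<in> pedges p \<union> pedges q \<and> f2 \<in> pedges p \<union> pedges q \<and> f1 \<noteq> f2 \<and> z \<in> ends G f1 \<and> z \<in> ends G f2"
  proof -
    have "z \<in> pverts a p \<or> z \<in> pverts a q"
      using assms(5,6) pedge_ends_subset[OF assms(1), of f] pedge_ends_subset[OF assms(2), of f] by auto
    then consider "z = a" | "z = b" | "z \<noteq> a" "z \<noteq> b" "z \<in> pverts a p" | "z \<noteq> a" "z \<noteq> b" "z \<in> pverts a q" by blast
    then show ?thesis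
    proof cases
      case 1
      then show ?thesis using path_first_edge[OF assms(1,3)] path_first_edge[OF assms(2,3)] assms(4) by (metis UnCI disjoint_iff)
    next
      case 2
      then show ?thesis using path_last_edge[OF assms(1,3)] path_last_edge[OF assms(2,3)] assms(4) by (metis UnCI disjoint_iff)
    next
      case 3
      then show ?thesis using inner[OF assms(1)] by (meson UnCI)
    next
      case 4
      then show ?thesis using inner[OF assms(2)] by (meson UnCI)
    qed
  qed
  then show ?thesis by metis
qed

locale minimal =
  fixes G :: "('v, 'e) mgraph"
  assumes multigraph: "multigraph G"
    and no_even: "\<And>d. \<not> even_orientation G d"
    and minimal: "\<And>f. f \<in> edges G \<Longrightarrow> \<exists>d. even_orientation (del G {f}) d"
begin

text \<open>Minimality concerns edges only, so \<open>verts G\<close> can contain isolated vertices;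
  these would spoil biconnectedness.\<close>

definition V where "V = \<Union> (ends G ` edges G)"

lemma minimal_del:
  assumes "X \<subseteq> edges G" "X \<noteq> {}"
  shows "\<exists>d. even_orientation (del G X) d"
proof -
  obtain f where f: "f \<in> X" using assms by auto
  then obtain d where "even_orientation (del G {f}) d" using minimal assms by blast
  then have "even_orientation (del G X) d" by (rule even_orientation_mono) (use f in auto)
  then show ?thesis by blast
qed

lemma edge_ends: "f \<in> edges G \<Longrightarrow> ends G f \<subseteq> V"
  by (auto simp: V_def)

lemma V_subset: "V \<subseteq> verts G"
  using multigraph by (auto simp: V_def multigraph_def)

text \<open>Whichever direction \<open>c\<close> is given to \<open>e\<close>, some even circuit is
  clockwise odd, and it passes through \<open>e\<close> because \<open>d\<close> is even on the
  rest. It is presented with \<open>e\<close> as closing edge.\<close>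

lemma extend_orientation:
  assumes d: "even_orientation (del G {e}) d" and e: "e \<in> edges G" "ends G e = {u, v}"
    and c: "c = (u, v) \<or> c = (v, u)"
  obtains Q where "path G u Q v" "e \<notin> pedges Q" "odd (length Q)" "odd (fw (d(e := c)) (Q @ [(v, e, u)]))" "u \<noteq> v"
proof -
  define d' where "d' = d(e := c)"
  have or: "orientation G d'"
    using d c e unfolding even_orientation_def orientation_def d'_def by (auto simp: insert_commute)
  then obtain s p t f where p: "cycle G s p t f" "odd (length p)" "odd (fw d' (p @ [(t, f, s)]))"
    using no_even[of d'] unfolding even_orientation_def by blast
  have fw: "fw d' q = fw d q" if "e \<notin> pedges q" for q
    using that by (induction q) (auto simp: d'_def)
  have ei: "e \<in> insert f (pedges p)"
  proof (rule ccontr)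
    assume ne: "e \<notin> insert f (pedges p)"
    then have "cycle (del G {e}) s p t f" using p(1) by (auto simp: cycle_def path_del)
    then have "even (fw d (p @ [(t, f, s)]))" using d p(2) unfolding even_orientation_def by blast
    then show False using p(3) fw[of "p @ [(t, f, s)]"] ne by (auto simp del: fw_simps)
  qed
  obtain s' q t' where q: "cycle G s' q t' e" "length q = length p"
    "\<And>d. fw d (q @ [(t', e, s')]) = fw d (p @ [(t, f, s)])"
    by (rule cycle_close_at[OF p(1) ei]) blast
  have o: "odd (fw d' (q @ [(t', e, s')]))" "odd (length q)" using q(2,3) p(2,3) by simp_all
  have uv: "u \<noteq> v"
  proof
    assume "u = v"
    then have "s' = t'" using q(1) e(2) by (auto simp: cycle_def)
    then show False using q(1) path_self[of G s' q] o(2) by (auto simp: cycle_def)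
  qed
  have "{t', s'} = {u, v}" using q(1) e(2) by (auto simp: cycle_def)
  then consider "s' = u" "t' = v" | "s' = v" "t' = u" by (auto simp: doubleton_eq_iff)
  then show ?thesis
  proof cases
    case 1
    then show ?thesis using that[of q] q(1) o uv unfolding d'_def cycle_def by blast
  next
    case 2
    have r: "cycle G u (prev q) v e" using cycle_prev[OF q(1)] 2 by simp
    have "odd (fw d' (prev q @ [(v, e, u)]))"
      using fw_cycle_prev[OF q(1) o(2) or] o(1) 2 by simp
    then show ?thesis using that[of "prev q"] r o(2) uv unfolding d'_def cycle_def by simp
  qed
qed

lemma no_loop: "f \<in> edges G \<Longrightarrow> \<exists>x y. ends G f = {x, y} \<and> x \<noteq> y"
proof -
  assume f: "f \<in> edges G"
  have "card (ends G f) = 1 \<or> card (ends G f) = 2" using multigraph f by (auto simp: multigraph_def)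
  moreover have "card (ends G f) \<noteq> 1"
  proof
    assume "card (ends G f) = 1"
    then obtain x where x: "ends G f = {x, x}" by (auto simp: card_1_singleton_iff)
    obtain d where "even_orientation (del G {f}) d" using minimal f by blast
    then show False using extend_orientation[OF _ f x] by blast
  qed
  ultimately show ?thesis by (metis card_2_iff)
qed

text \<open>If \<open>b\<close> separated \<open>x\<close> from \<open>y\<close>, the edges would
  split into two proper parts, each with an even orientation by minimality. A circuit passes through
  \<open>b\<close> at most once and so lies in one part; hence the two orientations combine.\<close>

lemma biconnected_V: "biconnected G V (edges G)"
  unfolding biconnected_def
proof (intro allI ballI, rule ccontr)
  fix b x y assume x: "x \<in> V - {b}" and y: "y \<in> V - {b}" and nl: "\<not> linked G (edges G) b x y"
  define C where "C = {z. linked G (edges G) b x z}"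
  have bC: "b \<notin> C"
  proof
    assume "b \<in> C"
    then have "linked G (edges G) b x b" by (simp add: C_def)
    then show False using linked_imp_path[of G "edges G" b x b] multigraph x V_subset path_end_in_pverts by fastforce
  qed
  have step: "t \<in> C \<longleftrightarrow> s \<in> C" if "f \<in> edges G" "ends G f = {s, t}" "s \<noteq> b" "t \<noteq> b" for f s t
    using linked_edge[OF that(1,2), of b] linked_sym that(3,4) linked_trans unfolding C_def by (metis mem_Collect_eq)
  \<comment> \<open>In this proof \<open>E1\<close> is the set of edges on the side of
    \<open>C\<close>, not the graph of that name.\<close>
  define E1 where "E1 = {f \<in> edges G. ends G f \<inter> C \<noteq> {}}"
  obtain f where f: "f \<in> edges G" "x \<in> ends G f" using x by (auto simp: V_def)
  have "f \<in> E1" using f by (auto simp: E1_def C_def)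
  obtain g where g: "g \<in> edges G" "y \<in> ends G g" using y by (auto simp: V_def)
  have "y \<notin> C" using nl by (simp add: C_def)
  have "g \<notin> E1"
  proof
    assume "g \<in> E1"
    then obtain z where z: "z \<in> ends G g" "z \<in> C" by (auto simp: E1_def)
    obtain s t where "ends G g = {s, t}" using no_loop[OF g(1)] by blast
    then have "ends G g = {z, y}" using z g \<open>y \<notin> C\<close> by auto
    then show False using step[OF g(1)] z(2) bC y \<open>y \<notin> C\<close> by auto
  qed
  obtain d1 where d1: "even_orientation (del G (edges G - E1)) d1"
    using minimal_del[of "edges G - E1"] g(1) \<open>g \<notin> E1\<close> by blast
  obtain d2 where d2: "even_orientation (del G E1) d2"
    using minimal_del[of E1] \<open>f \<in> E1\<close> by (auto simp: E1_def)
  define d where "d f = (if f \<in> E1 then d1 f else d2 f)" for f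
  have "orientation G d"
    using d1 d2 unfolding even_orientation_def orientation_def d_def by auto
  moreover have "even (fw d (p @ [(t, f, s)]))" if cy: "cycle G s p t f" and o: "odd (length p)" for s p t f
  proof -
    have status: "z \<in> C \<longleftrightarrow> s \<in> C" if "path G s q t" "b \<notin> pverts s q" "z \<in> pverts s q" for s q t z
      using that
    proof (induction q arbitrary: s)
      case (Cons h q)
      obtain a f m where h: "h = (a, f, m)" by (cases h)
      have "m \<in> C \<longleftrightarrow> s \<in> C" by (rule step[of f]) (use Cons.prems h start_in_pverts[of m q] in auto)
      then show ?case using Cons h by auto
    qed auto
    \<comment> \<open>A circuit through \<open>b\<close> is started at \<open>b\<close>; its other
      vertices then form a path avoiding \<open>b\<close>, which stays on one side.\<close>
    have mono: "(\<forall>g\<in>insert f (pedges p). g \<in> E1) \<or> (\<forall>g\<in>insert f (pedges p). g \<notin> E1)"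
      if cy: "cycle G s p t f" and o: "odd (length p)" and b: "b = s \<or> b \<notin> pverts s p" for s p t f
    proof -
      have p: "path G s p t" "f \<in> edges G" "ends G f = {t, s}" using cy by (auto simp: cycle_def)
      have in_E1: "g \<in> E1 \<longleftrightarrow> z \<in> C" if "g \<in> edges G" "z \<in> ends G g" "z \<noteq> b" for g z
      proof -
        obtain z1 z2 where "ends G g = {z1, z2}" using no_loop[OF \<open>g \<in> edges G\<close>] by blast
        then have "\<exists>z'. ends G g = {z, z'}" using that(2) by auto
        then obtain z' where "ends G g = {z, z'}" by blast
        then show ?thesis using step[of g z z'] that bC by (cases "z' = b") (auto simp: E1_def)
      qed
      show ?thesis
      proof (cases "b = s")
        case False
        then have nb: "b \<notin> pverts s p" using b by simp
        have "g \<in> E1 \<longleftrightarrow> s \<in> C" if gp: "g \<in> pedges p" for g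
        proof -
          obtain z1 z2 where z: "ends G g = {z1, z2}" "z1 \<in> pverts s p" by (rule pedge_ends[OF p(1) gp])
          then have "z1 \<noteq> b" using nb by auto
          then show ?thesis using in_E1[of g z1] pedges_subset[OF p(1)] gp z status[OF p(1) nb z(2)] by auto
        qed
        moreover have "f \<in> E1 \<longleftrightarrow> s \<in> C" using in_E1[of f s] p False by auto
        ultimately show ?thesis by blast
      next
        case True
        obtain g m q where q: "p = (s, g, m) # q" using p(1) o by (cases p) auto
        have qp: "path G m q t" "b \<notin> pverts m q" "g \<in> edges G" "ends G g = {s, m}" using p(1) q True by auto
        have mb: "m \<noteq> b" using qp(2) start_in_pverts[of m q] by metis
        have "h \<in> E1 \<longleftrightarrow> m \<in> C" if hq: "h \<in> pedges q" for h
        proof -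
          obtain z1 z2 where z: "ends G h = {z1, z2}" "z1 \<in> pverts m q" by (rule pedge_ends[OF qp(1) hq])
          then have "z1 \<noteq> b" using qp(2) by auto
          then show ?thesis using in_E1[of h z1] pedges_subset[OF qp(1)] hq z status[OF qp(1,2) z(2)] by auto
        qed
        moreover have "g \<in> E1 \<longleftrightarrow> m \<in> C" using in_E1[of g m] qp(3,4) mb by auto
        moreover have "f \<in> E1 \<longleftrightarrow> m \<in> C"
          using in_E1[of f t] p(2,3) status[OF qp(1,2) path_end_in_pverts[OF qp(1)]] path_end_in_pverts[OF qp(1)] qp(2) by auto
        ultimately show ?thesis using q by auto
      qed
    qed
    have "(\<forall>g\<in>insert f (pedges p). g \<in> E1) \<or> (\<forall>g\<in>insert f (pedges p). g \<notin> E1)"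
    proof (cases "b \<in> pverts s p")
      case False
      then show ?thesis using mono cy o by blast
    next
      case True
      obtain q t' f' where q: "cycle G b q t' f'" "length q = length p" "insert f' (pedges q) = insert f (pedges p)"
        by (rule cycle_start_at[OF cy True]) blast
      have "odd (length q)" using q(2) o by simp
      then show ?thesis using mono[OF q(1)] q(3) by simp
    qed
    then show ?thesis
    proof
      assume a: "\<forall>g\<in>insert f (pedges p). g \<in> E1"
      then have "cycle (del G (edges G - E1)) s p t f" using cy by (auto simp: cycle_def path_del)
      then have "even (fw d1 (p @ [(t, f, s)]))" using d1 o unfolding even_orientation_def by blast
      moreover have "fw d q = fw d1 q" if "pedges q \<subseteq> E1" for q
        using that by (induction q) (auto simp: d_def)
      moreover have "pedges (p @ [(t, f, s)]) \<subseteq> E1" using a by auto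
      ultimately show ?thesis by metis
    next
      assume a: "\<forall>g\<in>insert f (pedges p). g \<notin> E1"
      then have "cycle (del G E1) s p t f" using cy by (auto simp: cycle_def path_del)
      then have "even (fw d2 (p @ [(t, f, s)]))" using d2 o unfolding even_orientation_def by blast
      moreover have "fw d q = fw d2 q" if "pedges q \<inter> E1 = {}" for q
        using that by (induction q) (auto simp: d_def)
      moreover have "pedges (p @ [(t, f, s)]) \<inter> E1 = {}" using a by auto
      ultimately show ?thesis by metis
    qed
  qed
  ultimately have "even_orientation G d" unfolding even_orientation_def by blast
  then show False using no_even by blast
qed


text \<open>\<open>F\<close> is a proper subset, so a maximal block leaves room for an ear; adding
  the ear must then exhaust the edges, as the union would otherwise be a larger block.\<close>

definition block :: "'v set \<Rightarrow> 'e set \<Rightarrow> bool" where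
  "block U F \<longleftrightarrow> F \<subset> edges G \<and> U \<subseteq> V \<and> (\<forall>f\<in>F. ends G f \<subseteq> U) \<and> (\<exists>x\<in>U. \<exists>y\<in>U. x \<noteq> y) \<and> biconnected G U F"

lemma no_odd_path_on_one_edge:
  assumes "edges G \<subseteq> {f}" "cycle G u p v e"
  shows "even (length p)"
proof -
  have "pedges p \<subseteq> {f}" "e = f" "e \<notin> pedges p"
    using assms pedges_subset[of G u p v] unfolding cycle_def by auto
  then have "pedges p = {}" by blast
  then show ?thesis by (simp add: pedges_def)
qed

lemma block_exists: "\<exists>U F. block U F"
proof -
  have "edges G \<noteq> {}"
  proof
    assume "edges G = {}"
    then have "even_orientation G d" for d
      using no_odd_path_on_one_edge unfolding even_orientation_def orientation_def by auto
    then show False using no_even by blast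
  qed
  then obtain f where f: "f \<in> edges G" by blast
  obtain x y where xy: "ends G f = {x, y}" "x \<noteq> y" using no_loop[OF f] by blast
  have "edges G \<noteq> {f}"
  proof
    assume "edges G = {f}"
    then have "even_orientation G (\<lambda>_. (x, y))"
      using no_odd_path_on_one_edge[of f] xy unfolding even_orientation_def orientation_def by auto
    then show False using no_even by blast
  qed
  moreover have "biconnected G {x, y} {f}"
    unfolding biconnected_def using linked_edge[of f "{f}" G] xy by (auto simp: insert_commute)
  ultimately have "block {x, y} {f}" using f xy edge_ends[OF f] unfolding block_def by auto
  then show ?thesis by blast
qed

lemma ear_decomposition:
  obtains U F s P t where "biconnected G U F" "F \<subseteq> edges G" "\<And>f. f \<in> F \<Longrightarrow> ends G f \<subseteq> U" "U \<subseteq> V" "path G s P t" "s \<noteq> t"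
    "pverts s P \<inter> U = {s, t}" "pedges P \<inter> F = {}" "edges G = F \<union> pedges P"
proof -
  have fin: "finite (edges G)" using multigraph by (simp add: multigraph_def)
  have "\<exists>X. (case X of (U, F) \<Rightarrow> block U F) \<and> (\<forall>Y. (case Y of (U, F) \<Rightarrow> block U F) \<longrightarrow> card (snd Y) \<le> card (snd X))"
  proof -
    obtain U F where "block U F" using block_exists by blast
    moreover have "\<forall>Y. (case Y of (U, F) \<Rightarrow> block U F) \<longrightarrow> card (snd Y) < Suc (card (edges G))"
      using fin by (auto simp: block_def less_Suc_eq_le intro: card_mono)
    ultimately show ?thesis
      using ex_has_greatest_nat[of "\<lambda>Y. case Y of (U, F) \<Rightarrow> block U F" "(U, F)" "\<lambda>Y. card (snd Y)" "Suc (card (edges G))"]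
      by auto
  qed
  then obtain U F where UF: "block U F" and max: "\<And>U' F'. block U' F' \<Longrightarrow> card F' \<le> card F" by auto
  have B: "F \<subset> edges G" "U \<subseteq> V" "\<And>f. f \<in> F \<Longrightarrow> ends G f \<subseteq> U" "\<exists>x\<in>U. \<exists>y\<in>U. x \<noteq> y" "biconnected G U F"
    using UF unfolding block_def by auto
  obtain f where f: "f \<in> edges G" "f \<notin> F" using B(1) by blast
  have path_in: "\<exists>p. path G x p y \<and> b \<notin> pverts x p" if "x \<in> V" "y \<in> V" "x \<noteq> b" "y \<noteq> b" for x y b
    using linked_imp_path[of G "edges G" b x y] biconnected_V multigraph that V_subset unfolding biconnected_def by blast
  obtain s P t where P: "path G s P t" "s \<noteq> t" "pverts s P \<inter> U = {s, t}" "pedges P \<inter> F = {}"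
  proof -
    obtain z1 z2 where z: "ends G f = {z1, z2}" "z1 \<noteq> z2" using no_loop[OF f(1)] by blast
    have zV: "z1 \<in> V" "z2 \<in> V" using edge_ends[OF f(1)] z by auto
    show ?thesis
    proof (cases "z1 \<in> U \<and> z2 \<in> U")
      case True
      then show ?thesis using that[of z1 "[(z1, f, z2)]" z2] z f zV V_subset by auto
    next
      case False
      \<comment> \<open>The ear leaves \<open>U\<close> at \<open>s\<close> and returns along a path
        avoiding \<open>s\<close>, which \<open>biconnected_V\<close> provides, so its two ends are
        distinct.\<close>
      then obtain z where zz: "z \<in> V" "z \<notin> U" using zV by blast
      obtain h b where hb: "h \<in> U" "b \<in> U" "h \<noteq> b" using B(4) by blast
      obtain p where p: "path G h p z" using path_in[of h z b] hb zz B(2) by blast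
      obtain p1 p2 s where s: "p = p1 @ p2" "path G s p2 z" "s \<in> U" "pverts s p2 \<inter> U = {s}"
        by (rule path_last_hit[OF p hb(1)]) auto
      have "s \<noteq> z" using s(3) zz by auto
      then obtain g m q where q: "p2 = (s, g, m) # q" using s(2) by (cases p2) auto
      have m: "g \<in> edges G" "ends G g = {s, m}" "s \<noteq> m" "s \<in> verts G" "m \<in> V"
        using s(2) q start_in_pverts[of m q] edge_ends[of g] by auto
      have "m \<in> pverts s p2" using q by simp
      then have mU: "m \<notin> U" using s(4) m(3) by (metis IntI singletonD)
      obtain t where t: "t \<in> U" "t \<noteq> s" using B(4) by metis
      obtain r where r: "path G m r t" "s \<notin> pverts m r" using path_in[of m t s] m(3,5) t B(2) by blast
      obtain r1 t' where t': "path G m r1 t'" "t' \<in> U" "pverts m r1 \<inter> U = {t'}" "pverts m r1 \<subseteq> pverts m r"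
        by (rule path_first_hit[OF r(1) t(1) path_end_in_pverts[OF r(1)]]) auto
      have sn: "s \<notin> pverts m r1" using t'(4) r(2) by auto
      have "path G s ((s, g, m) # r1) t'" using t'(1) m sn by auto
      moreover have "s \<noteq> t'" using sn path_end_in_pverts[OF t'(1)] by auto
      moreover have "pverts s ((s, g, m) # r1) \<inter> U = {s, t'}" using t'(3) s(3) by auto
      moreover have "pedges ((s, g, m) # r1) \<inter> F = {}"
      proof -
        have "g \<notin> F" using B(3)[of g] m mU by auto
        moreover have "h \<notin> F" if h: "h \<in> pedges r1" for h
        proof
          assume "h \<in> F"
          obtain a b where ab: "ends G h = {a, b}" "a \<noteq> b" "a \<in> pverts m r1" "b \<in> pverts m r1"
            by (rule pedge_ends[OF t'(1) h])
          then have "a \<in> U" "b \<in> U" using B(3)[OF \<open>h \<in> F\<close>] by auto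
          then have "a = t'" "b = t'" using t'(3) ab by auto
          then show False using ab(2) by simp
        qed
        ultimately show ?thesis by auto
      qed
      ultimately show ?thesis by (rule that)
    qed
  qed
  have st: "s \<in> U" "t \<in> U" using P(3) by auto
  have "F \<union> pedges P = edges G"
  proof (rule ccontr)
    assume ne: "F \<union> pedges P \<noteq> edges G"
    have pe: "pedges P \<subseteq> edges G" by (rule pedges_subset[OF P(1)])
    have "block (U \<union> pverts s P) (F \<union> pedges P)"
      unfolding block_def
    proof (intro conjI ballI)
      show "F \<union> pedges P \<subset> edges G" using ne pe B(1) by auto
      have "z \<in> V" if "z \<in> pverts s P" for z
      proof (cases "z = s")
        case False
        obtain p1 p2 where p1: "P = p1 @ p2" "path G s p1 z" using path_split[OF P(1) \<open>z \<in> pverts s P\<close>] by blast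
        then obtain f where "f \<in> pedges p1" "z \<in> ends G f" using path_last_edge[OF p1(2)] False by blast
        then show ?thesis using p1(1) pe edge_ends[of f] by auto
      qed (use st B(2) in auto)
      then show "U \<union> pverts s P \<subseteq> V" using B(2) by auto
      show "ends G f \<subseteq> U \<union> pverts s P" if "f \<in> F \<union> pedges P" for f
        using that B(3) pedge_ends_subset[OF P(1)] by blast
      show "\<exists>x\<in>U \<union> pverts s P. \<exists>y\<in>U \<union> pverts s P. x \<noteq> y" using B(4) by blast
      show "biconnected G (U \<union> pverts s P) (F \<union> pedges P)"
        by (rule biconnected_add_ear[OF B(5) P(1) st P(2)])
    qed
    then have "card (F \<union> pedges P) \<le> card F" by (rule max)
    moreover have "card (F \<union> pedges P) = card F + card (pedges P)"
      by (rule card_Un_disjoint) (use P(4) B(1) fin finite_subset in auto)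
    moreover have "pedges P \<noteq> {}" using path_first_edge[OF P(1,2)] by auto
    ultimately show False by (simp add: card_gt_0_iff)
  qed
  then have "edges G = F \<union> pedges P" by simp
  then show ?thesis using that[OF B(5) _ B(3,2) P] B(1) by blast
qed

text \<open>Without its first edge the ear is a pendant path, which no circuit can use.\<close>

lemma no_leaf_avoids_ear:
  assumes G: "edges G = F \<union> pedges P" "\<And>f. f \<in> F \<Longrightarrow> ends G f \<subseteq> U"
    and P: "path G s P t" "pverts s P \<inter> U = {s, t}"
    and Z: "Z \<subseteq> edges G" "\<And>f z. f \<in> Z \<Longrightarrow> z \<in> ends G f \<Longrightarrow> \<exists>f'\<in>Z. f' \<noteq> f \<and> z \<in> ends G f'"
  shows "P = r @ q \<Longrightarrow> r \<noteq> [] \<Longrightarrow> pedges r \<inter> Z = {} \<Longrightarrow> pedges q \<inter> Z = {}"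
proof (induction q arbitrary: r)
  case (Cons h q)
  obtain x f y where h: "h = (x, f, y)" by (cases h)
  obtain m where m: "path G s r m" "path G m (h # q) t" "pverts s r \<inter> pverts m (h # q) = {m}"
    using P(1) unfolding Cons.prems(1) path_append by blast
  have x: "x = m" "path G y q t" "x \<notin> pverts y q" "f \<in> edges G" "ends G f = {x, y}" using m(2) h by auto
  have "x \<noteq> t" using x(3) path_end_in_pverts[OF x(2)] by auto
  moreover have "x \<noteq> s" using path_self m(1) x(1) Cons.prems(2) by metis
  moreover have "x \<in> pverts s P" using pverts_append[OF m(1), of "h # q"] Cons.prems(1) path_end_in_pverts[OF m(1)] x(1) by auto
  ultimately have xU: "x \<notin> U" using P(2) by auto
  have "f \<notin> Z"
  proof
    assume "f \<in> Z"
    then obtain f' where f': "f' \<in> Z" "f' \<noteq> f" "x \<in> ends G f'" using Z(2)[of f x] x(5) by auto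
    have "f' \<notin> F" using G(2)[of f'] f'(3) xU by auto
    then have "f' \<in> pedges P" using G(1) Z(1) f'(1) by auto
    then have "f' \<in> pedges q" using Cons.prems(1,3) f'(1,2) h by auto
    then show False using pedge_ends_subset[OF x(2)] f'(3) x(3) by auto
  qed
  then have "pedges q \<inter> Z = {}" using Cons.IH[of "r @ [h]"] Cons.prems h by auto
  then show ?case using \<open>f \<notin> Z\<close> h by auto
qed auto

lemma obstructed: "obstructed G"
proof (rule ccontr)
  assume no: "\<not> obstructed G"
  obtain U F s P t where E: "biconnected G U F" "F \<subseteq> edges G" "\<And>f. f \<in> F \<Longrightarrow> ends G f \<subseteq> U" "U \<subseteq> V" "path G s P t" "s \<noteq> t"
    "pverts s P \<inter> U = {s, t}" "pedges P \<inter> F = {}" "edges G = F \<union> pedges P"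
    using ear_decomposition by blast
  obtain e y P' where P: "P = (s, e, y) # P'" using E(5,6) by (cases P) auto
  have e: "e \<in> edges G" "ends G e = {s, y}" "e \<notin> F" using E(5,8) P by auto
  obtain d where d: "even_orientation (del G {e}) d" using minimal[OF e(1)] by blast
  \<comment> \<open>The closing step \<open>(y, e, s)\<close> counts 0 if \<open>e\<close> is
    directed from \<open>s\<close> to \<open>y\<close>, and 1 otherwise. Both circuits are clockwise
    odd, so the counts on \<open>Q1\<close> and \<open>Q2\<close> differ in parity.\<close>
  obtain Q1 where Q1: "path G s Q1 y" "e \<notin> pedges Q1" "odd (length Q1)" "odd (fw (d(e := (s, y))) (Q1 @ [(y, e, s)]))" "s \<noteq> y"
    by (rule extend_orientation[OF d e(1,2), of "(s, y)"]) auto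
  obtain Q2 where Q2: "path G s Q2 y" "e \<notin> pedges Q2" "odd (length Q2)" "odd (fw (d(e := (y, s))) (Q2 @ [(y, e, s)]))"
    by (rule extend_orientation[OF d e(1,2), of "(y, s)"]) auto
  interpret C: critical G e s y d
    using multigraph no e d Q1(5) by unfold_locales auto
  have fw: "fw (d(e := c)) q = fw d q" if "e \<notin> pedges q" for q c
    using that by (induction q) auto
  have "odd (fw d Q1)" using Q1(4,5) fw[OF Q1(2)] by simp
  moreover have "even (fw d Q2)" using Q2(4) fw[OF Q2(2)] by simp
  ultimately obtain n where n: "C.has_conf n"
    using C.has_conf_if_conflict[of Q1 "pverts s Q1" Q2 "pverts s Q2"] Q1 Q2 by (auto simp: pth_def)
  \<comment> \<open>A circuit avoiding \<open>e\<close> uses no edge of the ear. Applied to the two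
    odd circuits of a configuration this places \<open>a\<close> and \<open>w\<close> in
    \<open>U\<close>, where a path within \<open>F\<close> avoids \<open>b\<close> and
    \<open>e\<close> at once.\<close>
  have inU: "x \<in> U" if p: "path G x p z" "path G x q z" "x \<noteq> z" "e \<notin> pedges p" "e \<notin> pedges q"
    "pverts x p \<inter> pverts x q = {x, z}" "p \<noteq> q" for x p q z
  proof -
    let ?Z = "pedges p \<union> pedges q"
    have dis: "pedges p \<inter> pedges q = {}" by (rule parallel_paths_edge_disjoint[OF p(1,2,6,7)])
    have "pedges P' \<inter> ?Z = {}"
    proof (rule no_leaf_avoids_ear[OF E(9,3) E(5,7)])
      show "?Z \<subseteq> edges G" using pedges_subset p(1,2) by fast
      show "\<exists>f'\<in>?Z. f' \<noteq> f \<and> w \<in> ends G f'" if "f \<in> ?Z" "w \<in> ends G f" for f w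
        by (rule parallel_paths_no_leaf[OF p(1-3) dis that])
      show "P = [(s, e, y)] @ P'" using P by simp
    qed (use p in auto)
    moreover obtain f where f: "f \<in> pedges p" "x \<in> ends G f" using path_first_edge[OF p(1,3)] by blast
    ultimately have "f \<in> F" using E(9) P p(4) pedges_subset[OF p(1)] by auto
    then show ?thesis using E(3) f(2) by auto
  qed
  have "\<not> C.has_conf n"
  proof (rule C.no_conf_if_linked)
    fix a b c w \<alpha>0 \<alpha>1 \<sigma> \<beta>0 \<beta>1 \<upsilon> \<tau> A0 A1 S B0 B1 Y T
    assume "C.conf a b c w \<alpha>0 \<alpha>1 \<sigma> \<beta>0 \<beta>1 \<upsilon> \<tau> A0 A1 S B0 B1 Y T"
    note c = C.confD[OF this]
    have "\<alpha>0 \<noteq> \<alpha>1" using c(26) by auto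
    have "prev \<beta>0 \<noteq> prev \<beta>1" using c(27) by (metis even_add prev_simps(4))
    have "a \<in> U"
      by (rule inU[OF pthD(1)[OF c(1)] pthD(1)[OF c(2)] c(15) c(8,9)])
        (use c(17) pth_mem[OF c(1)] pth_mem[OF c(2)] pthD(2)[OF c(1)] pthD(2)[OF c(2)] \<open>\<alpha>0 \<noteq> \<alpha>1\<close> in auto)
    note b0 = pth_prev[OF c(4)] and b1 = pth_prev[OF c(5)]
    have "w \<in> U"
      by (rule inU[OF pthD(1)[OF b0] pthD(1)[OF b1] c(16)[symmetric]])
        (use c(11,12,18) pth_mem[OF c(4)] pth_mem[OF c(5)] pthD(2)[OF b0] pthD(2)[OF b1] \<open>prev \<beta>0 \<noteq> prev \<beta>1\<close> in auto)
    have "w \<noteq> b"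
      using c(16,20,19,21) pth_mem[OF c(3)] pth_mem[OF c(4)] by (simp only: set_logic; metis)
    then have "linked G F b a w"
      using E(1) \<open>a \<in> U\<close> \<open>w \<in> U\<close> c(15) unfolding biconnected_def by blast
    then obtain p where p: "path G a p w" "b \<notin> pverts a p" "pedges p \<subseteq> F"
      using linked_imp_path[OF _ E(2) multigraph _ c(15)] \<open>a \<in> U\<close> E(4) V_subset by blast
    then show "\<exists>p. path G a p w \<and> e \<notin> pedges p \<and> b \<notin> pverts a p" using e(3) by blast
  qed
  then show False using n by simp
qed

end

lemma obstructed_if_no_even_orientation:
  assumes "multigraph G" "\<And>d. \<not> even_orientation G d"
  shows "obstructed G"
proof -
  define H where "H X = \<lparr>verts = verts G, edges = X, ends = ends G\<rparr>" for X
  have "\<exists>X. X \<subseteq> edges G \<and> (\<forall>d. \<not> even_orientation (H X) d)"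
  proof (intro exI[of _ "edges G"] conjI allI)
    show "\<not> even_orientation (H (edges G)) d" for d
      using assms(2)[of d] even_orientation_mono[of "H (edges G)" d G] by (auto simp: H_def)
  qed simp
  then obtain X0 where "X0 \<subseteq> edges G \<and> (\<forall>d. \<not> even_orientation (H X0) d)" ..
  \<comment> \<open>An edge set of least cardinality without an even orientation is minimal under
    deleting single edges, which is what the locale asks for.\<close>
  from ex_has_least_nat[where P = "\<lambda>X. X \<subseteq> edges G \<and> (\<forall>d. \<not> even_orientation (H X) d)" and m = card, OF this]
  obtain X where X: "X \<subseteq> edges G" "\<And>d. \<not> even_orientation (H X) d"
    and min: "\<And>X'. X' \<subseteq> edges G \<and> (\<forall>d. \<not> even_orientation (H X') d) \<Longrightarrow> card X \<le> card X'"
    by metis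
  have sub: "subgraph (H X) G"
    unfolding H_def using X(1) assms(1) by (intro subgraph_restrict) (auto simp: multigraph_def)
  interpret minimal "H X"
  proof
    show "multigraph (H X)" using sub by (simp add: subgraph_def)
    show "\<not> even_orientation (H X) d" for d by (rule X(2))
    fix f assume f: "f \<in> edges (H X)"
    have "finite X" using X(1) assms(1) finite_subset by (auto simp: multigraph_def)
    then have "card (X - {f}) < card X" using f by (intro card_Diff1_less) (simp_all add: H_def)
    then have "\<exists>d. even_orientation (H (X - {f})) d" using min[of "X - {f}"] X(1) by force
    moreover have "del (H X) {f} = H (X - {f})" by (simp add: H_def del_def)
    ultimately show "\<exists>d. even_orientation (del (H X) {f}) d" by simp
  qed
  show ?thesis using obstructed sub subgraph_trans unfolding obstructed_def by blast
qed

theorem corollary2: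
  fixes G :: "('v, 'e) mgraph"
  assumes "multigraph G"
  shows "(\<nexists>d. orientation G d \<and>
            (\<forall>vs es. circuit G vs es \<and> even (length es) \<longrightarrow> clockwise_even d vs es))
     \<longleftrightarrow> (\<exists>K. subgraph K G \<and>
            (even_subdivision E1 K \<or> even_subdivision E3 K \<or>
             (\<exists>vs es. circuit K vs es \<and> odd (length es) \<and>
                (even_subdivision E1 (contract_circuit K vs es) \<or>
                 even_subdivision E3 (contract_circuit K vs es)))))"
  unfolding even_orientation_iff[symmetric] obstructed_def[symmetric]
proof
  show "obstructed G" if "\<nexists>d. even_orientation G d"
    using obstructed_if_no_even_orientation[OF assms] that by blast
  show "\<nexists>d. even_orientation G d" if "obstructed G"
    using that no_even_orientation_if_obstruction unfolding obstructed_def by metis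
qed

end
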